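(* Let $k\ge 1$ and let $\Sigma=T(\widetilde A)$ be a partially symmetric, bounded, positive invertible operator on $l^2_{2k}$ generated by a symbol $\widetilde A\in L^\infty_{2k\times 2k}$. For each $n\in\mathbb N$ let $d_1^{(n)}\le\cdots\le d_{nk}^{(n)}$ denote the symplectic eigenvalues of the truncated block Toeplitz matrix $T_n(\widetilde A)$. Then for every function $f$ continuous on $[0,\|\widetilde A\|]$, $$\lim_{n\to\infty}\frac1n\sum_{j=1}^{nk} f\big(d_j^{(n)}\big)=\frac{1}{2\pi}\int_{-\pi}^{\pi}\sum_{j=1}^{k} f\big(d_j(\widetilde A(\theta))\big)\,d\theta .$$
   Context: $L^\infty_{2k\times 2k}$ is the set of measurable functions $\widetilde A$ from $[-\pi,\pi]$ to the complex $2k\times 2k$ matrices with essentially bounded entries and $\widetilde A(-\pi)=\widetilde A(\pi)$; $\|\widetilde A\|=\operatorname{ess\,sup}_\theta\|\widetilde A(\theta)\|$ (operator norm). The Fourier coefficients of $\widetilde A$ are $A_n=\frac1{2\pi}\int_{-\pi}^{\pi}\widetilde A(\theta)e^{-\imath n\theta}d\theta$, $n\in\mathbb Z$. $l^2_{2k}$ is the Hilbert space of square summable sequences $(x_0,x_1,\dots)$ with $x_i\in\mathbb C^{2k}$. $T(\widetilde A)=[A_{i-j}]_{i,j=0}^\infty$ is the block Toeplitz operator on $l^2_{2k}$ generated by $\widetilde A$ (its symbol), and $T_n(\widetilde A)=[A_{i-j}]_{i,j=0}^{n-1}$. $T(\widetilde A)$ is partially symmetric if every $A_n$ is real and $A_{-n}=A_n$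 for all $n\in\mathbb N$. An operator $T$ is positive invertible if it is Hermitian, $\langle x,Tx\rangle>0$ for all $x\neq0$, and $T$ is invertible (with bounded inverse). Under these hypotheses $T_n(\widetilde A)$ is real positive definite for every $n$, and $\widetilde A(\theta)$ is real positive definite for almost every $\theta$. Let $J_2=\begin{bmatrix}0&1\\-1&0\end{bmatrix}$ and $J_{2m}=J_2\oplus\cdots\oplus J_2$ ($m$ times). A real $2m\times 2m$ matrix $M$ is symplectic if $M^TJ_{2m}M=J_{2m}$. By Williamson's theorem, for every real positive definite $2m\times 2m$ matrix $B$ there is a symplectic $M$ with $MBM^T=d_1(B)I_2\oplus\cdots\oplus d_m(B)I_2$, where $0<d_1(B)\le\cdots\le d_m(B)$ are uniquely determined by $B$; they are called the symplectic eigenvalues of $B$. (Equivalently, the eigenvalues of $\imath J_{2m}B$ are $\pm d_1(B),\dots,\pm d_m(B)$.) *)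

theory Defs
  imports
    "HOL-Analysis.Analysis"
    "HOL-Probability.Essential_Supremum"
    "Jordan_Normal_Form.Matrix"
begin

section \<open>Symbols\<close>

definition cvec_norm :: "complex vec \<Rightarrow> real" where
  "cvec_norm v = L2_set (\<lambda>i. cmod (vec_index v i)) {..<dim_vec v}"

definition op_norm :: "complex mat \<Rightarrow> real" where
  "op_norm B = (SUP v \<in> {v \<in> carrier_vec (dim_col B). cvec_norm v \<le> 1}. cvec_norm (B *\<^sub>v v))"

text \<open>Measurability and integrals refer to Lebesgue measure, which is complete: a symbol may be
  changed arbitrarily on a null set.\<close>

definition Linf_symbol :: "nat \<Rightarrow> (real \<Rightarrow> complex mat) \<Rightarrow> bool" where
  "Linf_symbol m A \<longleftrightarrow>
     (\<forall>\<theta> \<in> {-pi..pi}. A \<theta> \<in> carrier_mat m m) \<and>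
     A (-pi) = A pi \<and>
     (\<forall>i<m. \<forall>j<m.
        (\<lambda>\<theta>. A \<theta> $$ (i, j)) \<in> borel_measurable (lebesgue_on {-pi..pi}) \<and>
        (\<exists>C. AE \<theta> in lebesgue_on {-pi..pi}. cmod (A \<theta> $$ (i, j)) \<le> C))"

text \<open>The essential supremum is taken in \<^typ>\<open>ereal\<close> because \<^const>\<open>esssup\<close> needs a complete
  order; it is finite for the symbols above.\<close>

definition symbol_norm :: "(real \<Rightarrow> complex mat) \<Rightarrow> real" where
  "symbol_norm A =
     real_of_ereal (esssup (lebesgue_on {-pi..pi}) (\<lambda>\<theta>. ereal (op_norm (A \<theta>))))"

definition fourier_coeff :: "nat \<Rightarrow> (real \<Rightarrow> complex mat) \<Rightarrow> int \<Rightarrow> complex mat" where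
  "fourier_coeff m A n = Matrix.mat m m (\<lambda>(i, j).
     1 / (2 * complex_of_real pi) *
     (LINT \<theta>|lebesgue_on {-pi..pi}. A \<theta> $$ (i, j) * exp (- (\<i> * of_int n * of_real \<theta>))))"

definition partially_symmetric :: "nat \<Rightarrow> (real \<Rightarrow> complex mat) \<Rightarrow> bool" where
  "partially_symmetric m A \<longleftrightarrow>
     (\<forall>n::int. elements_mat (fourier_coeff m A n) \<subseteq> \<real> \<and>
               fourier_coeff m A (- n) = fourier_coeff m A n)"


section \<open>Operators on square summable sequences of vectors\<close>

definition l2_space :: "nat \<Rightarrow> (nat \<Rightarrow> complex vec) set" where
  "l2_space m = {x. (\<forall>i. x i \<in> carrier_vec m) \<and> summable (\<lambda>i. (cvec_norm (x i))\<^sup>2)}"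

definition l2_norm :: "(nat \<Rightarrow> complex vec) \<Rightarrow> real" where
  "l2_norm x = sqrt (\<Sum>i. (cvec_norm (x i))\<^sup>2)"

text \<open>Conjugate linear in the first argument: \<open>(\<bullet>c)\<close> conjugates its second one.\<close>

definition l2_inner :: "(nat \<Rightarrow> complex vec) \<Rightarrow> (nat \<Rightarrow> complex vec) \<Rightarrow> complex" where
  "l2_inner x y = (\<Sum>i. y i \<bullet>c x i)"

definition l2_bounded_operator ::
    "nat \<Rightarrow> ((nat \<Rightarrow> complex vec) \<Rightarrow> (nat \<Rightarrow> complex vec)) \<Rightarrow> bool" where
  "l2_bounded_operator m T \<longleftrightarrow>
     (\<forall>x \<in> l2_space m. T x \<in> l2_space m) \<and>
     (\<forall>x \<in> l2_space m. \<forall>y \<in> l2_space m. T (\<lambda>i. x i + y i) = (\<lambda>i. T x i + T y i)) \<and>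
     (\<forall>c. \<forall>x \<in> l2_space m. T (\<lambda>i. c \<cdot>\<^sub>v x i) = (\<lambda>i. c \<cdot>\<^sub>v T x i)) \<and>
     (\<exists>C. \<forall>x \<in> l2_space m. l2_norm (T x) \<le> C * l2_norm x)"

definition l2_hermitian ::
    "nat \<Rightarrow> ((nat \<Rightarrow> complex vec) \<Rightarrow> (nat \<Rightarrow> complex vec)) \<Rightarrow> bool" where
  "l2_hermitian m T \<longleftrightarrow>
     (\<forall>x \<in> l2_space m. \<forall>y \<in> l2_space m. l2_inner x (T y) = l2_inner (T x) y)"

definition l2_invertible ::
    "nat \<Rightarrow> ((nat \<Rightarrow> complex vec) \<Rightarrow> (nat \<Rightarrow> complex vec)) \<Rightarrow> bool" where
  "l2_invertible m T \<longleftrightarrow>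
     (\<exists>S. l2_bounded_operator m S \<and> (\<forall>x \<in> l2_space m. S (T x) = x \<and> T (S x) = x))"

definition l2_positive_invertible ::
    "nat \<Rightarrow> ((nat \<Rightarrow> complex vec) \<Rightarrow> (nat \<Rightarrow> complex vec)) \<Rightarrow> bool" where
  "l2_positive_invertible m T \<longleftrightarrow>
     l2_hermitian m T \<and>
     (\<forall>x \<in> l2_space m. x \<noteq> (\<lambda>_. 0\<^sub>v m) \<longrightarrow>
        l2_inner x (T x) \<in> \<real> \<and> 0 < Re (l2_inner x (T x))) \<and>
     l2_invertible m T"


section \<open>Block Toeplitz operators and their truncations\<close>

text \<open>For a symbol in \<^const>\<open>Linf_symbol\<close> and a square summable \<^term>\<open>x\<close>, each of the series
  converges absolutely, because the Fourier coefficients are square summable.\<close>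

definition toeplitz_op ::
    "nat \<Rightarrow> (real \<Rightarrow> complex mat) \<Rightarrow> (nat \<Rightarrow> complex vec) \<Rightarrow> (nat \<Rightarrow> complex vec)" where
  "toeplitz_op m A x = (\<lambda>i. Matrix.vec m (\<lambda>r.
     \<Sum>j. vec_index (fourier_coeff m A (int i - int j) *\<^sub>v x j) r))"

definition toeplitz_mat :: "nat \<Rightarrow> (real \<Rightarrow> complex mat) \<Rightarrow> nat \<Rightarrow> complex mat" where
  "toeplitz_mat m A n = Matrix.mat (n * m) (n * m) (\<lambda>(p, q).
     fourier_coeff m A (int (p div m) - int (q div m)) $$ (p mod m, q mod m))"


section \<open>Symplectic eigenvalues\<close>

definition J2 :: "real mat" where
  "J2 = mat_of_rows_list 2 [[0, 1], [-1, 0]]"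

definition J_mat :: "nat \<Rightarrow> real mat" where
  "J_mat m = diag_block_mat (replicate m J2)"

definition symplectic :: "nat \<Rightarrow> real mat \<Rightarrow> bool" where
  "symplectic m M \<longleftrightarrow>
     M \<in> carrier_mat (2 * m) (2 * m) \<and> transpose_mat M * J_mat m * M = J_mat m"

definition williamson_form :: "real mat \<Rightarrow> nat \<Rightarrow> real list \<Rightarrow> bool" where
  "williamson_form B m ds \<longleftrightarrow>
     length ds = m \<and> sorted ds \<and> (\<forall>d \<in> set ds. 0 < d) \<and>
     (\<exists>M. symplectic m M \<and>
          M * B * transpose_mat M = diag_block_mat (map (\<lambda>d. d \<cdot>\<^sub>m 1\<^sub>m 2) ds))"

text \<open>\<open>symp_eig B j\<close> is \<open>d\<^sub>j(B)\<close> for \<open>1 \<le> j \<le> m\<close>, where \<open>B\<close> is real positive definite of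
  size \<open>2 * m\<close>. By Williamson's theorem the list exists and is unique for such \<open>B\<close>; for other
  matrices the value carries no meaning.\<close>

definition symp_eig :: "real mat \<Rightarrow> nat \<Rightarrow> real" where
  "symp_eig B j = (THE ds. williamson_form B (dim_row B div 2) ds) ! (j - 1)"

text \<open>Under the hypotheses of the theorem the entries of the truncations are real, and those of
  the symbol are real almost everywhere; there \<open>map_mat Re\<close> only changes the element type.\<close>

abbreviation real_mat :: "complex mat \<Rightarrow> real mat" where
  "real_mat B \<equiv> map_mat Re B"

end

theory Submission
  imports Defs "Jordan_Normal_Form.Determinant"
begin

text \<open>Put \<open>C = J A\<close>. Since \<open>J\<close> is block diagonal, \<open>J T\<^sub>n(A) = T\<^sub>n(C)\<close>, and for a positive definite \<open>B\<close> the trace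
  of \<open>(J B)\<close> to the power \<open>2 p\<close> is twice the sum of the \<open>p\<close>-th powers of the \<open>- d\<^sub>j(B)\<^sup>2\<close>. For bounded symbols
  \<open>T\<^sub>n(a) T\<^sub>n(b) - T\<^sub>n(a b)\<close> has Frobenius norm \<open>o(sqrt n)\<close>, so \<open>T\<^sub>n(C)\<close> to the power \<open>q\<close> may be replaced by
  \<open>T\<^sub>n\<close> of the \<open>q\<close>-th power of \<open>C\<close> in normalized traces, and the trace of the latter is exactly \<open>n\<close> times
  a mean over the circle. This proves the claim for polynomials in \<open>d\<^sup>2\<close>. All symplectic eigenvalues
  involved lie in the interval from 0 to the norm of the symbol, so Weierstrass approximation gives it
  for continuous functions. Williamson's theorem is obtained by maximizing the symplectic form on the unit
  sphere of \<open>B\<close>, passing to the orthogonal complement of the maximizing pair, and repeating. That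
  \<open>A(\<theta>)\<close> is positive definite almost everywhere follows from coercivity of the invertible operator
  \<open>T(A)\<close>, tested on trigonometric polynomials.\<close>

section \<open>Fourier coefficients of bounded measurable functions\<close>

text \<open>The matrix \<open>J B\<close> is in general not normal, so perturbation theory for
  Hermitian eigenvalues does not apply to it directly; traces of powers are invariant under
  similarity and need no normality. Odd powers of \<open>J B\<close> have trace zero, and even ones
  suffice because squaring is injective on positive numbers. Errors are measured in the Frobenius
  norm because the product defect is not small in operator norm: for \<open>chr 1\<close> and
  \<open>chr (-1)\<close> it already has a corner entry of modulus 1. Averaged over the columns it
  does become small, and \<open>sqrt n\<close> is exactly what Cauchy-Schwarz on the diagonal can
  afford. Measurability of the integrand involves no measurable choice of eigenvalues: the integrand
  is almost everywhere a uniform limit of linear combinations of traces, which are polynomials in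
  the entries. Two bounds have to be sharp. The eigenvalues must not leave the interval on which
  \<open>f\<close> is continuous, so the constant is the symbol norm itself. And the symbol needs a
  positive lower bound that is the same for all vectors, since mere strict positivity on countably
  many test vectors would be lost in the limit.\<close>

abbreviation circ :: "real measure" where
  "circ \<equiv> lebesgue_on {-pi..pi}"

text \<open>The space L^\<infinity> of the circle. It is an algebra closed under conjugation and
  contained in the integrable functions, so every mean taken below exists.\<close>

definition bmeas :: "(real \<Rightarrow> complex) \<Rightarrow> bool" where
  "bmeas f \<longleftrightarrow> f \<in> borel_measurable circ \<and> (\<exists>C. AE \<theta> in circ. cmod (f \<theta>) \<le> C)"

definition mean :: "(real \<Rightarrow> complex) \<Rightarrow> complex" where
  "mean f = 1 / (2 * complex_of_real pi) * (LINT \<theta>|circ. f \<theta>)"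

definition chr :: "int \<Rightarrow> real \<Rightarrow> complex" where
  "chr n \<theta> = exp (\<i> * of_int n * of_real \<theta>)"

definition fc :: "(real \<Rightarrow> complex) \<Rightarrow> int \<Rightarrow> complex" where
  "fc f n = mean (\<lambda>\<theta>. f \<theta> * chr (- n) \<theta>)"

text \<open>The squared L^2 norm for normalized measure, written as a mean so that it can be
  expanded by linearity.\<close>

definition msq :: "(real \<Rightarrow> complex) \<Rightarrow> real" where
  "msq f = Re (mean (\<lambda>\<theta>. f \<theta> * cnj (f \<theta>)))"

lemma finite_measure_circ: "finite_measure circ"
  by (rule finite_measure_lebesgue_on) (simp add: fmeasurable_cbox[where a = "-pi" and b = pi, simplified])

lemma integral_circ_1: "(LINT \<theta>|circ. (1::complex)) = 2 * complex_of_real pi"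
  by (simp add: measure_restrict_space scaleR_conv_of_real)

lemma bmeasD: "bmeas f \<Longrightarrow> f \<in> borel_measurable circ"
  by (simp add: bmeas_def)

lemma bmeasE:
  assumes "bmeas f"
  obtains C where "C > 0" "AE \<theta> in circ. cmod (f \<theta>) \<le> C"
proof -
  from assms obtain C where "AE \<theta> in circ. cmod (f \<theta>) \<le> C" by (auto simp: bmeas_def)
  then have "AE \<theta> in circ. cmod (f \<theta>) \<le> \<bar>C\<bar> + 1" by (rule AE_mp) auto
  then show ?thesis by (intro that[of "\<bar>C\<bar> + 1"]) auto
qed

lemma bmeasI:
  assumes "f \<in> borel_measurable circ" "AE \<theta> in circ. cmod (f \<theta>) \<le> C"
  shows "bmeas f"
  using assms by (auto simp: bmeas_def)

lemma bmeas_integrable: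
  assumes "bmeas f" shows "integrable circ f"
proof -
  interpret finite_measure circ by (rule finite_measure_circ)
  from assms obtain C where "C > 0" "AE \<theta> in circ. cmod (f \<theta>) \<le> C" by (rule bmeasE)
  then show ?thesis using bmeasD[OF assms] by (intro integrable_const_bound[of _ C]) auto
qed

section \<open>Closure properties of essentially bounded functions\<close>

lemma bmeas_const [simp, intro]: "bmeas (\<lambda>_. c)"
  by (rule bmeasI[of _ "cmod c"]) auto

lemma bmeas_add [intro]:
  assumes "bmeas f" "bmeas g" shows "bmeas (\<lambda>\<theta>. f \<theta> + g \<theta>)"
proof -
  from assms obtain C D where "AE \<theta> in circ. cmod (f \<theta>) \<le> C" "AE \<theta> in circ. cmod (g \<theta>) \<le> D"
    by (auto simp: bmeas_def)
  then have "AE \<theta> in circ. cmod (f \<theta> + g \<theta>) \<le> C + D"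
    by eventually_elim (meson add_mono norm_triangle_le)
  then show ?thesis by (rule bmeasI[OF borel_measurable_add[OF bmeasD[OF assms(1)] bmeasD[OF assms(2)]]])
qed

lemma bmeas_mult [intro]:
  assumes "bmeas f" "bmeas g" shows "bmeas (\<lambda>\<theta>. f \<theta> * g \<theta>)"
proof -
  from assms obtain C where C: "C > 0" "AE \<theta> in circ. cmod (f \<theta>) \<le> C" by (auto elim: bmeasE)
  from assms obtain D where D: "D > 0" "AE \<theta> in circ. cmod (g \<theta>) \<le> D" by (auto elim: bmeasE)
  from C(2) D(2) have "AE \<theta> in circ. cmod (f \<theta> * g \<theta>) \<le> C * D"
    by eventually_elim (use C(1) D(1) in \<open>auto simp: norm_mult intro!: mult_mono\<close>)
  then show ?thesis by (rule bmeasI[OF borel_measurable_times[OF bmeasD[OF assms(1)] bmeasD[OF assms(2)]]])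
qed

lemma borel_measurable_cnj [measurable]: "cnj \<in> borel_measurable borel"
  by (intro borel_measurable_continuous_onI continuous_intros)

lemma bmeas_cnj [intro]: "bmeas f \<Longrightarrow> bmeas (\<lambda>\<theta>. cnj (f \<theta>))"
  by (auto simp: bmeas_def intro!: measurable_compose[OF _ borel_measurable_cnj])

lemma bmeas_cmult [intro]: "bmeas f \<Longrightarrow> bmeas (\<lambda>\<theta>. c * f \<theta>)"
  by (rule bmeas_mult) auto

lemma bmeas_diff [intro]:
  assumes "bmeas f" "bmeas g" shows "bmeas (\<lambda>\<theta>. f \<theta> - g \<theta>)"
  using bmeas_add[OF assms(1) bmeas_cmult[OF assms(2), of "-1"]] by simp

lemma bmeas_sum [intro]: "(\<And>i. i \<in> I \<Longrightarrow> bmeas (f i)) \<Longrightarrow> bmeas (\<lambda>\<theta>. \<Sum>i\<in>I. f i \<theta>)"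
  by (induction I rule: infinite_finite_induct) auto

lemma bmeas_continuous:
  assumes "continuous_on {-pi..pi} f" shows "bmeas f"
proof -
  have "compact (f ` {-pi..pi})" using assms by (intro compact_continuous_image) auto
  then have "bounded (f ` {-pi..pi})" by (rule compact_imp_bounded)
  then obtain C where "\<And>\<theta>. \<theta> \<in> {-pi..pi} \<Longrightarrow> cmod (f \<theta>) \<le> C" unfolding bounded_iff by blast
  then have "AE \<theta> in circ. cmod (f \<theta>) \<le> C" by (intro AE_I2) auto
  moreover have "f \<in> borel_measurable circ"
    using assms by (intro continuous_imp_measurable_on_sets_lebesgue) auto
  ultimately show ?thesis by (intro bmeasI)
qed

lemma continuous_chr: "continuous_on S (chr n)"
  unfolding chr_def by (intro continuous_intros)

lemma bmeas_chr [simp, intro]: "bmeas (chr n)"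
  by (intro bmeas_continuous continuous_chr)

lemma cnj_chr: "cnj (chr n \<theta>) = chr (- n) \<theta>"
  by (simp add: chr_def exp_cnj)

lemma chr_mult: "chr m \<theta> * chr n \<theta> = chr (m + n) \<theta>"
  by (simp add: chr_def exp_add[symmetric] algebra_simps)

lemma chr_0 [simp]: "chr 0 \<theta> = 1"
  by (simp add: chr_def)

lemma chr_cis: "chr n \<theta> = cis (of_int n * \<theta>)"
  by (simp add: chr_def cis_conv_exp algebra_simps)

lemma Re_mult_real: "Re (of_real r * z) = r * Re z"
  by simp

lemma mult_cnj: "z * cnj z = of_real ((cmod z)\<^sup>2)"
  by (rule complex_norm_square[symmetric])

section \<open>Linearity and monotonicity of the mean\<close>

lemma mean_add: "bmeas f \<Longrightarrow> bmeas g \<Longrightarrow> mean (\<lambda>\<theta>. f \<theta> + g \<theta>) = mean f + mean g"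
  by (simp add: mean_def bmeas_integrable algebra_simps)

lemma mean_diff: "bmeas f \<Longrightarrow> bmeas g \<Longrightarrow> mean (\<lambda>\<theta>. f \<theta> - g \<theta>) = mean f - mean g"
  by (simp add: mean_def bmeas_integrable algebra_simps)

lemma mean_cmult: "mean (\<lambda>\<theta>. c * f \<theta>) = c * mean f"
  by (simp add: mean_def)

lemma mean_sum:
  "(\<And>i. i \<in> I \<Longrightarrow> bmeas (f i)) \<Longrightarrow> mean (\<lambda>\<theta>. \<Sum>i\<in>I. f i \<theta>) = (\<Sum>i\<in>I. mean (f i))"
  by (simp add: mean_def Bochner_Integration.integral_sum bmeas_integrable sum_distrib_left)

lemma mean_cnj: "mean (\<lambda>\<theta>. cnj (f \<theta>)) = cnj (mean f)"
  by (simp add: mean_def)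

lemma Re_mean:
  assumes "bmeas f" shows "Re (mean f) = (LINT \<theta>|circ. Re (f \<theta>)) / (2 * pi)"
proof -
  have "mean f = of_real (1 / (2 * pi)) * (LINT \<theta>|circ. f \<theta>)" by (simp add: mean_def)
  then have "Re (mean f) = 1 / (2 * pi) * Re (LINT \<theta>|circ. f \<theta>)" by (simp only: Re_mult_real)
  then show ?thesis using bmeas_integrable[OF assms] by simp
qed

lemma Re_mean_mono:
  assumes "bmeas f" "bmeas g" "AE \<theta> in circ. Re (f \<theta>) \<le> Re (g \<theta>)"
  shows "Re (mean f) \<le> Re (mean g)"
proof -
  have "(LINT \<theta>|circ. Re (f \<theta>)) \<le> (LINT \<theta>|circ. Re (g \<theta>))"
    using assms by (intro integral_mono_AE) (auto intro!: bmeas_integrable)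
  then show ?thesis using assms by (simp add: Re_mean divide_right_mono)
qed

lemma chr_antiderivative: "((\<lambda>x. exp (\<i> * of_int n * of_real x) / (\<i> * of_int n)) has_vector_derivative exp (\<i> * of_int n * of_real x)) (at x within S)"
  if "n \<noteq> 0"
proof -
  have "((\<lambda>z. exp (\<i> * of_int n * z) / (\<i> * of_int n)) has_field_derivative exp (\<i> * of_int n * of_real x)) (at (of_real x))"
    using that by (auto intro!: derivative_eq_intros simp: field_simps)
  then show ?thesis
    by (rule has_vector_derivative_at_within[OF has_vector_derivative_real_field])
qed

lemma mean_chr: "mean (chr n) = (if n = 0 then 1 else 0)"
proof (cases "n = 0")
  case True
  then have "chr n = (\<lambda>_. 1)" by (simp add: fun_eq_iff)
  then show ?thesis using integral_circ_1 True by (simp add: mean_def)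
next
  case False
  let ?F = "\<lambda>x. exp (\<i> * of_int n * of_real x) / (\<i> * of_int n)"
  have "(chr n has_integral (?F pi - ?F (-pi))) {-pi..pi}"
    unfolding chr_def using chr_antiderivative[OF False] by (intro fundamental_theorem_of_calculus) auto
  moreover have "exp (\<i> * of_int n * of_real pi) = exp (\<i> * of_int n * of_real (-pi))"
  proof -
    have e: "exp ((2 * of_int n * of_real pi) * \<i>) = (1::complex)"
      using exp_integer_2pi[of "of_int n"] by (simp add: mult_ac)
    have "exp (\<i> * of_int n * of_real pi) =
        exp (\<i> * of_int n * of_real (-pi)) * exp ((2 * of_int n * of_real pi) * \<i>)"
      unfolding exp_add[symmetric] by (simp add: algebra_simps)
    also have "\<dots> = exp (\<i> * of_int n * of_real (-pi))"
      unfolding e by simp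
    finally show ?thesis .
  qed
  ultimately have "(chr n has_integral 0) {-pi..pi}" by simp
  then have "(LINT \<theta>|circ. chr n \<theta>) = 0"
    using lebesgue_integral_eq_integral[of "{-pi..pi}" "chr n"] bmeas_integrable[of "chr n"]
    by (auto simp: integral_unique)
  then show ?thesis using False by (simp add: mean_def)
qed

section \<open>Trigonometric polynomials, mean squares and Bessel's inequality\<close>

lemma fc_trig:
  assumes "finite S"
  shows "fc (\<lambda>\<theta>. \<Sum>n\<in>S. c n * chr n \<theta>) k = (if k \<in> S then c k else 0)"
proof -
  have "fc (\<lambda>\<theta>. \<Sum>n\<in>S. c n * chr n \<theta>) k = mean (\<lambda>\<theta>. \<Sum>n\<in>S. c n * chr (n - k) \<theta>)"
    unfolding fc_def by (simp add: sum_distrib_right mult.assoc chr_mult)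
  also have "\<dots> = (\<Sum>n\<in>S. c n * (if n - k = 0 then 1 else 0))"
    by (subst mean_sum) (auto simp: mean_cmult mean_chr)
  also have "\<dots> = (if k \<in> S then c k else 0)"
    using assms by (auto simp: if_distrib[of "\<lambda>x. _ * x"] cong: if_cong)
  finally show ?thesis .
qed

lemma msq_complex: "complex_of_real (msq f) = mean (\<lambda>\<theta>. f \<theta> * cnj (f \<theta>))"
proof -
  have "cnj (mean (\<lambda>\<theta>. f \<theta> * cnj (f \<theta>))) = mean (\<lambda>\<theta>. f \<theta> * cnj (f \<theta>))"
    unfolding mean_cnj[symmetric] by (simp add: mult.commute)
  then show ?thesis unfolding msq_def by (metis Reals_cnj_iff of_real_Re)
qed

lemma msq_mono:
  assumes "bmeas f" "bmeas g" "AE \<theta> in circ. cmod (f \<theta>) \<le> cmod (g \<theta>)"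
  shows "msq f \<le> msq g"
  unfolding msq_def
proof (rule Re_mean_mono)
  show "bmeas (\<lambda>\<theta>. f \<theta> * cnj (f \<theta>))" "bmeas (\<lambda>\<theta>. g \<theta> * cnj (g \<theta>))"
    by (intro bmeas_mult bmeas_cnj assms)+
  from assms(3) show "AE \<theta> in circ. Re (f \<theta> * cnj (f \<theta>)) \<le> Re (g \<theta> * cnj (g \<theta>))"
    by eventually_elim (simp only: mult_cnj Re_complex_of_real power_mono norm_ge_zero)
qed

lemma msq_const: "msq (\<lambda>_. c) = (cmod c)\<^sup>2"
proof -
  have "mean (\<lambda>_. c * cnj c) = mean (\<lambda>\<theta>. (c * cnj c) * chr 0 \<theta>)"
    by (simp only: chr_0 mult_1_right)
  also have "\<dots> = c * cnj c"
    by (subst mean_cmult) (simp add: mean_chr)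
  finally show ?thesis by (simp add: msq_def mult_cnj del: of_real_power)
qed

lemma msq_nonneg: "bmeas f \<Longrightarrow> msq f \<ge> 0"
  using msq_mono[of "\<lambda>_. 0" f] by (simp add: msq_const)

lemma msq_cmult: "msq (\<lambda>\<theta>. c * f \<theta>) = (cmod c)\<^sup>2 * msq f"
proof -
  have "mean (\<lambda>\<theta>. (c * f \<theta>) * cnj (c * f \<theta>)) = mean (\<lambda>\<theta>. (c * cnj c) * (f \<theta> * cnj (f \<theta>)))"
    by (simp add: mult_ac)
  also have "\<dots> = of_real ((cmod c)\<^sup>2) * mean (\<lambda>\<theta>. f \<theta> * cnj (f \<theta>))"
    by (subst mean_cmult) (simp only: mult_cnj)
  finally show ?thesis unfolding msq_def by (simp only: Re_mult_real)
qed

lemma msq_le_bound: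
  assumes "bmeas f" "bmeas g" "AE \<theta> in circ. cmod (f \<theta>) \<le> C" "C \<ge> 0"
  shows "msq (\<lambda>\<theta>. f \<theta> * g \<theta>) \<le> C\<^sup>2 * msq g"
proof -
  have "msq (\<lambda>\<theta>. f \<theta> * g \<theta>) \<le> msq (\<lambda>\<theta>. of_real C * g \<theta>)"
  proof (intro msq_mono bmeas_mult assms bmeas_const)
    from assms(3) show "AE \<theta> in circ. cmod (f \<theta> * g \<theta>) \<le> cmod (of_real C * g \<theta>)"
      by eventually_elim (use assms(4) in \<open>auto simp: norm_mult intro!: mult_right_mono\<close>)
  qed
  then show ?thesis by (simp add: msq_cmult)
qed

text \<open>Pythagoras: the distance to a trigonometric polynomial is the distance to the orthogonal
  projection plus the error of the coefficients. Taking \<open>c = fc f\<close> yields Bessel's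
  inequality, \<open>f = 0\<close> the norm of a trigonometric polynomial, and dropping the last sum
  bounds the Bessel defect by the quality of any approximation.\<close>

lemma msq_diff_trig:
  assumes f: "bmeas f" and S: "finite S"
  shows "msq (\<lambda>\<theta>. f \<theta> - (\<Sum>n\<in>S. c n * chr n \<theta>)) =
    msq f - (\<Sum>n\<in>S. (cmod (fc f n))\<^sup>2) + (\<Sum>n\<in>S. (cmod (fc f n - c n))\<^sup>2)"
proof -
  let ?p = "\<lambda>\<theta>. \<Sum>n\<in>S. c n * chr n \<theta>"
  have p: "bmeas ?p" by (intro bmeas_sum bmeas_cmult bmeas_chr)
  have fp: "mean (\<lambda>\<theta>. g \<theta> * cnj (?p \<theta>)) = (\<Sum>n\<in>S. cnj (c n) * fc g n)" if g: "bmeas g" for g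
  proof -
    have "mean (\<lambda>\<theta>. g \<theta> * cnj (?p \<theta>)) = mean (\<lambda>\<theta>. \<Sum>n\<in>S. cnj (c n) * (g \<theta> * chr (-n) \<theta>))"
      by (simp add: sum_distrib_left cnj_chr algebra_simps)
    also have "\<dots> = (\<Sum>n\<in>S. cnj (c n) * fc g n)"
      by (subst mean_sum) (intro bmeas_cmult bmeas_mult bmeas_chr g, simp add: mean_cmult fc_def)
    finally show ?thesis .
  qed
  have pf: "mean (\<lambda>\<theta>. ?p \<theta> * cnj (f \<theta>)) = (\<Sum>n\<in>S. c n * cnj (fc f n))"
  proof -
    have "mean (\<lambda>\<theta>. ?p \<theta> * cnj (f \<theta>)) = cnj (mean (\<lambda>\<theta>. f \<theta> * cnj (?p \<theta>)))"
      unfolding mean_cnj[symmetric] by (simp add: mult.commute)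
    then show ?thesis unfolding fp[OF f] by simp
  qed
  have pp: "mean (\<lambda>\<theta>. ?p \<theta> * cnj (?p \<theta>)) = (\<Sum>n\<in>S. c n * cnj (c n))"
    unfolding fp[OF p] by (intro sum.cong) (auto simp: fc_trig[OF S])
  have "complex_of_real (msq (\<lambda>\<theta>. f \<theta> - ?p \<theta>)) = mean (\<lambda>\<theta>. (f \<theta> * cnj (f \<theta>) - f \<theta> * cnj (?p \<theta>)) - (?p \<theta> * cnj (f \<theta>) - ?p \<theta> * cnj (?p \<theta>)))"
    unfolding msq_complex by (simp add: algebra_simps del: cnj_sum)
  also have "\<dots> = mean (\<lambda>\<theta>. f \<theta> * cnj (f \<theta>)) - mean (\<lambda>\<theta>. f \<theta> * cnj (?p \<theta>)) -
      (mean (\<lambda>\<theta>. ?p \<theta> * cnj (f \<theta>)) - mean (\<lambda>\<theta>. ?p \<theta> * cnj (?p \<theta>)))"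
    by (simp only: mean_diff bmeas_diff bmeas_mult bmeas_cnj f p)
  also have "\<dots> = complex_of_real (msq f) - (\<Sum>n\<in>S. fc f n * cnj (fc f n)) + (\<Sum>n\<in>S. (fc f n - c n) * cnj (fc f n - c n))"
    unfolding fp[OF f] pf pp msq_complex by (simp add: algebra_simps sum_subtractf sum.distrib)
  also have "\<dots> = complex_of_real (msq f - (\<Sum>n\<in>S. (cmod (fc f n))\<^sup>2) + (\<Sum>n\<in>S. (cmod (fc f n - c n))\<^sup>2))"
    by (simp only: mult_cnj of_real_sum of_real_add of_real_diff)
  finally show ?thesis unfolding of_real_eq_iff .
qed

lemma bessel:
  assumes "bmeas f" "finite S" shows "(\<Sum>n\<in>S. (cmod (fc f n))\<^sup>2) \<le> msq f"
proof -
  have "bmeas (\<lambda>\<theta>. f \<theta> - (\<Sum>n\<in>S. fc f n * chr n \<theta>))"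
    by (intro bmeas_diff bmeas_sum bmeas_cmult bmeas_chr assms)
  from msq_nonneg[OF this] show ?thesis
    using msq_diff_trig[OF assms, of "fc f"] by simp
qed

lemma msq_trig:
  assumes "finite S" shows "msq (\<lambda>\<theta>. \<Sum>n\<in>S. c n * chr n \<theta>) = (\<Sum>n\<in>S. (cmod (c n))\<^sup>2)"
proof -
  have "msq (\<lambda>\<theta>. 0 - (\<Sum>n\<in>S. c n * chr n \<theta>)) = (\<Sum>n\<in>S. (cmod (c n))\<^sup>2)"
    using assms by (subst msq_diff_trig) (auto simp: msq_const fc_def mean_def)
  then show ?thesis using msq_cmult[of "-1" "\<lambda>\<theta>. \<Sum>n\<in>S. c n * chr n \<theta>"] by simp
qed

section \<open>Density of trigonometric polynomials in mean square\<close>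

inductive trig_poly :: "(real \<Rightarrow> complex) \<Rightarrow> bool" where
  trig_chr: "trig_poly (\<lambda>\<theta>. c * chr n \<theta>)"
| trig_add: "trig_poly f \<Longrightarrow> trig_poly g \<Longrightarrow> trig_poly (\<lambda>\<theta>. f \<theta> + g \<theta>)"

lemma trig_const: "trig_poly (\<lambda>_. c)"
  using trig_chr[of c 0] by simp

lemma trig_mult:
  assumes "trig_poly f" "trig_poly g" shows "trig_poly (\<lambda>\<theta>. f \<theta> * g \<theta>)"
  using assms(1)
proof induction
  case (trig_chr c n)
  from assms(2) show ?case
  proof induction
    case (trig_chr d m)
    have "(\<lambda>\<theta>. c * chr n \<theta> * (d * chr m \<theta>)) = (\<lambda>\<theta>. (c * d) * chr (n + m) \<theta>)"
      by (simp add: chr_mult[symmetric] mult_ac)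
    then show ?case by (simp add: trig_poly.trig_chr)
  next
    case (trig_add g h)
    then show ?case using trig_poly.trig_add by (simp add: distrib_left)
  qed
next
  case (trig_add f h)
  then show ?case using trig_poly.trig_add by (simp add: distrib_right)
qed

text \<open>The inductive form is convenient for products; the distance formula
  \<open>msq_diff_trig\<close> needs one finite sum with distinct frequencies.\<close>

lemma trig_poly_sum:
  assumes "trig_poly f"
  obtains S c where "finite S" "f = (\<lambda>\<theta>. \<Sum>n\<in>S. c n * chr n \<theta>)"
proof -
  have "\<exists>S c. finite S \<and> f = (\<lambda>\<theta>. \<Sum>n\<in>S. c n * chr n \<theta>)"
    using assms
  proof induction
    case (trig_chr c n)
    show ?case by (rule exI[of _ "{n}"], rule exI[of _ "\<lambda>_. c"]) auto
  next
    case (trig_add f g)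
    then obtain S c T d where *: "finite S" "f = (\<lambda>\<theta>. \<Sum>n\<in>S. c n * chr n \<theta>)"
      "finite T" "g = (\<lambda>\<theta>. \<Sum>n\<in>T. d n * chr n \<theta>)" by auto
    let ?c = "\<lambda>n. if n \<in> S then c n else 0" and ?d = "\<lambda>n. if n \<in> T then d n else 0"
    have 1: "(\<Sum>n\<in>S. c n * chr n \<theta>) = (\<Sum>n\<in>S \<union> T. ?c n * chr n \<theta>)" for \<theta>
      using * by (intro sum.mono_neutral_cong_left) auto
    have 2: "(\<Sum>n\<in>T. d n * chr n \<theta>) = (\<Sum>n\<in>S \<union> T. ?d n * chr n \<theta>)" for \<theta>
      using * by (intro sum.mono_neutral_cong_left) auto
    show ?case
      using * by (intro exI[of _ "S \<union> T"] exI[of _ "\<lambda>n. ?c n + ?d n"])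
        (simp add: 1 2 sum.distrib distrib_right)
  qed
  with that show ?thesis by blast
qed

text \<open>A real linear functional on the plane is \<open>Re z * f 1 + Im z * f \<i>\<close>, and
  on the circle \<open>Re\<close> and \<open>Im\<close> are combinations of \<open>chr 1\<close> and
  \<open>chr (-1)\<close>. Sums and products are then covered by the closure properties.\<close>

lemma trig_poly_real_polynomial_cis:
  assumes "real_polynomial_function P"
  shows "trig_poly (\<lambda>\<theta>. of_real (P (cis \<theta>)))"
  using assms
proof induction
  case (linear f)
  interpret bounded_linear f by fact
  have f: "f z = Re z * f 1 + Im z * f \<i>" for z
  proof -
    have "z = Re z *\<^sub>R 1 + Im z *\<^sub>R \<i>" by (simp add: complex_eq_iff)
    then have "f z = f (Re z *\<^sub>R 1 + Im z *\<^sub>R \<i>)" by simp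
    also have "\<dots> = Re z * f 1 + Im z * f \<i>" unfolding add scaleR by simp
    finally show ?thesis .
  qed
  have "complex_of_real (f (cis \<theta>)) =
      (of_real (f 1) / 2 - \<i> * of_real (f \<i>) / 2) * chr 1 \<theta> +
      (of_real (f 1) / 2 + \<i> * of_real (f \<i>) / 2) * chr (-1) \<theta>" for \<theta>
    by (subst f) (simp add: chr_cis complex_eq_iff field_simps)
  then show ?case by (simp add: trig_add trig_chr)
next
  case (const c)
  then show ?case by (rule trig_const)
next
  case (add f g)
  then show ?case by (simp add: trig_add)
next
  case (mult f g)
  then show ?case by (simp add: trig_mult)
qed

lemma trig_poly_polynomial_cis:
  fixes P :: "complex \<Rightarrow> complex"
  assumes "polynomial_function P"
  shows "trig_poly (\<lambda>\<theta>. P (cis \<theta>))"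
proof -
  have "real_polynomial_function (\<lambda>z. Re (P z))" "real_polynomial_function (\<lambda>z. Im (P z))"
    using assms unfolding polynomial_function_def
    by (auto simp: o_def dest: spec[of _ Re] spec[of _ Im] intro: bounded_linear_Re bounded_linear_Im)
  then have "trig_poly (\<lambda>\<theta>. of_real (Re (P (cis \<theta>))) + \<i> * of_real (Im (P (cis \<theta>))))"
    by (intro trig_add trig_mult trig_const trig_poly_real_polynomial_cis)
  then show ?thesis by (simp flip: complex_eq)
qed

text \<open>Equal values at the end points make \<open>f\<close> a continuous function on the unit
  circle, a compact set in the plane on which Stone-Weierstrass provides polynomials in the two real
  coordinates.\<close>

lemma trig_poly_uniform_approx:
  assumes f: "continuous_on {-pi..pi} f" and per: "f (-pi) = f pi" and e: "e > 0"
  shows "\<exists>p. trig_poly p \<and> (\<forall>\<theta>\<in>{-pi..pi}. cmod (f \<theta> - p \<theta>) < e)"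
proof -
  \<comment> \<open>The inverse of \<open>cis\<close>: \<open>arccos\<close> of the real part is the
    angle up to sign, and the sign of the imaginary part selects it. The branches agree at 1, where
    the angle is 0, and at -1 by \<open>per\<close>.\<close>
  define G where "G z = (if 0 \<le> Im z then f (arccos (Re z)) else f (- arccos (Re z)))" for z
  let ?S = "sphere (0::complex) 1"
  have Re: "\<bar>Re z\<bar> \<le> 1" if "z \<in> ?S" for z
    using abs_Re_le_cmod[of z] that by simp
  have arc: "0 \<le> arccos (Re z)" "arccos (Re z) \<le> pi" if "cmod z = 1" for z
    using Re[of z] that by (auto intro!: arccos_lbound arccos_ubound)
  have "continuous_on ((?S \<inter> {z. 0 \<le> Im z}) \<union> (?S \<inter> {z. Im z \<le> 0})) G"
    unfolding G_def
  proof (rule continuous_on_cases)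
    show "closed (?S \<inter> {z. 0 \<le> Im z})" "closed (?S \<inter> {z. Im z \<le> 0})"
      by (auto intro!: closed_Int closed_halfspace_Im_ge closed_halfspace_Im_le)
    show "continuous_on (?S \<inter> {z. 0 \<le> Im z}) (\<lambda>z. f (arccos (Re z)))"
      using Re
      by (intro continuous_on_compose2[OF f] continuous_intros continuous_on_arccos)
         (use arc in \<open>force simp: abs_le_iff\<close>)+
    show "continuous_on (?S \<inter> {z. Im z \<le> 0}) (\<lambda>z. f (- arccos (Re z)))"
      using Re
      by (intro continuous_on_compose2[OF f] continuous_intros continuous_on_arccos)
         (use arc in \<open>force simp: abs_le_iff\<close>)+
    have "f (arccos (Re z)) = f (- arccos (Re z))" if "cmod z = 1" "Im z = 0" for z
    proof -
      have "\<bar>Re z\<bar> = 1" using that by (simp add: cmod_def)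
      then have "Re z = 1 \<or> Re z = -1" by linarith
      then show ?thesis using per by auto
    qed
    then show "\<forall>z. z \<in> ?S \<inter> {z. 0 \<le> Im z} \<and> \<not> 0 \<le> Im z \<or> z \<in> ?S \<inter> {z. Im z \<le> 0} \<and> 0 \<le> Im z \<longrightarrow>
      f (arccos (Re z)) = f (- arccos (Re z))" by auto
  qed
  moreover have "(?S \<inter> {z. 0 \<le> Im z}) \<union> (?S \<inter> {z. Im z \<le> 0}) = ?S" by auto
  ultimately have "continuous_on ?S G" by simp
  from Stone_Weierstrass_polynomial_function[OF _ this e] obtain P where
    P: "polynomial_function P" "\<And>z. z \<in> ?S \<Longrightarrow> cmod (G z - P z) < e" by auto
  have G: "G (cis \<theta>) = f \<theta>" if \<theta>: "\<theta> \<in> {-pi..pi}" for \<theta>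
  proof (cases "\<theta> \<ge> 0")
    case True
    then show ?thesis using \<theta> by (simp add: G_def sin_ge_zero arccos_cos)
  next
    case False
    have *: "arccos (cos \<theta>) = - \<theta>"
      using False \<theta> arccos_cos[of "-\<theta>"] by simp
    show ?thesis
    proof (cases "\<theta> = -pi")
      case True
      then show ?thesis by (simp add: G_def per)
    next
      case False
      then have "sin (- \<theta>) > 0" using \<theta> \<open>\<not> \<theta> \<ge> 0\<close> by (intro sin_gt_zero) auto
      then show ?thesis using * by (simp add: G_def)
    qed
  qed
  show ?thesis
  proof (intro exI conjI ballI)
    show "trig_poly (\<lambda>\<theta>. P (cis \<theta>))" by (rule trig_poly_polynomial_cis[OF P(1)])
    fix \<theta> assume "\<theta> \<in> {-pi..pi}"
    then show "cmod (f \<theta> - P (cis \<theta>)) < e" using P(2)[of "cis \<theta>"] G[of \<theta>] by simp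
  qed
qed

lemma msq_add_le:
  assumes "bmeas f" "bmeas g"
  shows "msq (\<lambda>\<theta>. f \<theta> + g \<theta>) \<le> 2 * msq f + 2 * msq g"
proof -
  have "msq (\<lambda>\<theta>. f \<theta> + g \<theta>) \<le> Re (mean (\<lambda>\<theta>. 2 * (f \<theta> * cnj (f \<theta>)) + 2 * (g \<theta> * cnj (g \<theta>))))"
    unfolding msq_def
  proof (rule Re_mean_mono)
    show "AE \<theta> in circ. Re ((f \<theta> + g \<theta>) * cnj (f \<theta> + g \<theta>)) \<le> Re (2 * (f \<theta> * cnj (f \<theta>)) + 2 * (g \<theta> * cnj (g \<theta>)))"
    proof (rule AE_I2)
      fix \<theta>
      have "0 \<le> (Re (f \<theta>) - Re (g \<theta>))\<^sup>2 + (Im (f \<theta>) - Im (g \<theta>))\<^sup>2" by simp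
      then show "Re ((f \<theta> + g \<theta>) * cnj (f \<theta> + g \<theta>)) \<le> Re (2 * (f \<theta> * cnj (f \<theta>)) + 2 * (g \<theta> * cnj (g \<theta>)))"
        by (simp add: power2_eq_square algebra_simps)
    qed
  qed (intro bmeas_add bmeas_mult bmeas_cnj bmeas_const assms)+
  also have "\<dots> = 2 * msq f + 2 * msq g"
    by (subst mean_add) (auto simp: mean_cmult msq_def intro!: bmeas_cmult bmeas_mult bmeas_cnj assms)
  finally show ?thesis .
qed

text \<open>A Lebesgue measurable function is almost everywhere a limit of continuous ones. Two
  corrections adapt the sequence: a uniform bound, for dominated convergence, and vanishing end
  values, so that \<open>trig_poly_uniform_approx\<close> applies to each member.\<close>

lemma continuous_approx_AE:
  assumes f: "bmeas f"
  shows "\<exists>h C. (\<forall>n. continuous_on {-pi..pi} (h n)) \<and> (\<forall>n. h n (-pi) = 0) \<and> (\<forall>n. h n pi = 0) \<and>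
    (\<forall>n. \<forall>\<theta>\<in>{-pi..pi}. cmod (h n \<theta>) \<le> C) \<and>
    (AE \<theta> in circ. (\<lambda>n. h n \<theta>) \<longlonglongrightarrow> f \<theta>) \<and> (AE \<theta> in circ. cmod (f \<theta>) \<le> C) \<and> C > 0"
proof -
  obtain C where C: "C > 0" "AE \<theta> in circ. cmod (f \<theta>) \<le> C" using f by (rule bmeasE)
  define F where "F \<theta> = (if \<theta> \<in> {-pi..pi} then f \<theta> else 0)" for \<theta>
  have "F \<in> borel_measurable lebesgue"
    using bmeasD[OF f] borel_measurable_if[of "{-pi..pi}" f] unfolding F_def by simp
  then have "F measurable_on UNIV" by (rule lebesgue_measurable_imp_measurable_on) simp
  then obtain N g where N: "negligible N" and g: "\<And>n. continuous_on UNIV (g n)"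
    and lim: "\<And>x. x \<notin> N \<Longrightarrow> (\<lambda>n. g n x) \<longlonglongrightarrow> F x"
    unfolding measurable_on_def by auto
  \<comment> \<open>The radial retraction of the plane onto the disc of radius \<open>C\<close>. It
    is continuous and fixes almost all values of \<open>f\<close>, hence preserves the
    limit.\<close>
  define cl where "cl z = z * of_real (C / max C (cmod z))" for z
  have cl: "continuous_on UNIV cl"
    unfolding cl_def using C(1) by (intro continuous_intros) auto
  have cl_id: "cl z = z" if "cmod z \<le> C" for z
    using that C(1) by (simp add: cl_def max_def)
  have cl_le: "cmod (cl z) \<le> C" for z
    using C(1) by (auto simp: cl_def norm_mult norm_divide max_def field_simps)
  \<comment> \<open>A cutoff that vanishes at the two end points and equals 1 at any given interior
    point for all large \<open>n\<close>.\<close>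
  define \<psi> where "\<psi> n \<theta> = min 1 (real n * (pi - \<bar>\<theta>\<bar>))" for n \<theta>
  define h where "h n \<theta> = cl (g n \<theta>) * of_real (\<psi> n \<theta>)" for n \<theta>
  have AEN: "AE \<theta> in circ. \<theta> \<notin> N \<union> {-pi, pi}"
  proof -
    have "negligible (N \<union> {-pi, pi})" using N by (intro negligible_Un) auto
    then have "AE \<theta> in lebesgue. \<theta> \<notin> N \<union> {-pi, pi}"
      by (intro AE_not_in) (simp add: negligible_iff_null_sets)
    then show ?thesis by (subst AE_restrict_space_iff) auto
  qed
  show ?thesis
  proof (intro exI[of _ h] exI[of _ C] conjI allI ballI)
    show "continuous_on {-pi..pi} (h n)" for n
      unfolding h_def \<psi>_def
      by (intro continuous_intros continuous_on_compose2[OF cl] continuous_on_subset[OF g]) auto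
    show "h n (-pi) = 0" "h n pi = 0" for n by (auto simp: h_def \<psi>_def)
    show "cmod (h n \<theta>) \<le> C" if "\<theta> \<in> {-pi..pi}" for n \<theta>
    proof -
      have "0 \<le> \<psi> n \<theta>" "\<psi> n \<theta> \<le> 1" using that by (auto simp: \<psi>_def)
      then have "cmod (h n \<theta>) \<le> cmod (cl (g n \<theta>)) * 1"
        unfolding h_def norm_mult by (intro mult_left_mono) auto
      then show ?thesis using cl_le[of "g n \<theta>"] by simp
    qed
    show "AE \<theta> in circ. (\<lambda>n. h n \<theta>) \<longlonglongrightarrow> f \<theta>"
      using AEN C(2) AE_space
    proof eventually_elim
      case (elim \<theta>)
      then have F: "F \<theta> = f \<theta>" and lt: "pi - \<bar>\<theta>\<bar> > 0" by (auto simp: F_def)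
      have "(\<lambda>n. cl (g n \<theta>)) \<longlonglongrightarrow> cl (F \<theta>)"
        using lim[of \<theta>] elim cl by (auto intro: continuous_on_tendsto_compose)
      moreover have "cl (F \<theta>) = f \<theta>" using F cl_id elim by simp
      moreover have "(\<lambda>n. \<psi> n \<theta>) \<longlonglongrightarrow> 1"
      proof (rule tendsto_eventually)
        obtain m where m: "1 < real m * (pi - \<bar>\<theta>\<bar>)" using reals_Archimedean3[OF lt] by blast
        have "\<psi> n \<theta> = 1" if "n \<ge> m" for n
        proof -
          have "real m * (pi - \<bar>\<theta>\<bar>) \<le> real n * (pi - \<bar>\<theta>\<bar>)"
            using that lt by (intro mult_right_mono) auto
          then show ?thesis using m by (simp add: \<psi>_def)
        qed
        then show "\<forall>\<^sub>F n in sequentially. \<psi> n \<theta> = 1" by (auto simp: eventually_sequentially)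
      qed
      ultimately show ?case unfolding h_def by (auto intro!: tendsto_eq_intros)
    qed
  qed (use C in auto)
qed

lemma trig_poly_dense:
  assumes f: "bmeas f" and e: "e > 0"
  obtains S c where "finite S" "msq (\<lambda>\<theta>. f \<theta> - (\<Sum>n\<in>S. c n * chr n \<theta>)) < e"
proof -
  from continuous_approx_AE[OF f] obtain h C where "\<forall>n. continuous_on {-pi..pi} (h n)"
      "\<forall>n. h n (-pi) = 0" "\<forall>n. h n pi = 0" "\<forall>n. \<forall>\<theta>\<in>{-pi..pi}. cmod (h n \<theta>) \<le> C"
    and lim: "AE \<theta> in circ. (\<lambda>n. h n \<theta>) \<longlonglongrightarrow> f \<theta>" and fC: "AE \<theta> in circ. cmod (f \<theta>) \<le> C" and "C > 0"
    by (elim exE conjE)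
  note h = this(1-4)[rule_format]
  have bh: "bmeas (h n)" for n by (rule bmeas_continuous[OF h(1)])
  define u where "u n \<theta> = (f \<theta> - h n \<theta>) * cnj (f \<theta> - h n \<theta>)" for n \<theta>
  have bu: "bmeas (u n)" for n
    unfolding u_def by (intro bmeas_mult bmeas_cnj bmeas_diff f bh)
  have "(\<lambda>n. LINT \<theta>|circ. u n \<theta>) \<longlonglongrightarrow> (LINT \<theta>|circ. 0)"
  proof (rule integral_dominated_convergence[where w = "\<lambda>_. (2 * C)\<^sup>2"])
    show "integrable circ (\<lambda>_. (2 * C)\<^sup>2)"
      using finite_measure.integrable_const[OF finite_measure_circ] by blast
    show "AE \<theta> in circ. (\<lambda>n. u n \<theta>) \<longlonglongrightarrow> 0"
      using lim unfolding u_def by eventually_elim (auto intro!: tendsto_eq_intros)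
    show "AE \<theta> in circ. norm (u n \<theta>) \<le> (2 * C)\<^sup>2" for n
      using fC AE_space
    proof eventually_elim
      case (elim \<theta>)
      have "cmod (f \<theta> - h n \<theta>) \<le> 2 * C"
        using norm_triangle_ineq4[of "f \<theta>" "h n \<theta>"] elim h(4)[of \<theta> n] by simp
      from power_mono[OF this norm_ge_zero, of 2] show ?case
        by (simp only: u_def mult_cnj norm_of_real abs_power2)
    qed
  qed (auto intro: bmeasD bu)
  then have "(\<lambda>n. mean (u n)) \<longlonglongrightarrow> 1 / (2 * complex_of_real pi) * 0"
    unfolding mean_def by (intro tendsto_intros) simp
  then have "(\<lambda>n. Re (mean (u n))) \<longlonglongrightarrow> 0" by (auto dest: tendsto_Re)
  \<comment> \<open>Two errors of \<open>e / 4\<close> are allowed, because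
    \<open>msq_add_le\<close> doubles each of them.\<close>
  then have "\<forall>\<^sub>F n in sequentially. Re (mean (u n)) < e / 4" using e by (intro order_tendstoD) auto
  then obtain n where n: "Re (mean (u n)) < e / 4" by (auto simp: eventually_sequentially)
  then have m1: "msq (\<lambda>\<theta>. f \<theta> - h n \<theta>) < e / 4" by (simp add: msq_def u_def[abs_def])
  have "h n (-pi) = h n pi" by (simp only: h)
  moreover have "sqrt (e / 4) > 0" using e by simp
  ultimately obtain p where p: "trig_poly p" "\<forall>\<theta>\<in>{-pi..pi}. cmod (h n \<theta> - p \<theta>) < sqrt (e / 4)"
    using trig_poly_uniform_approx[OF h(1)] by blast
  obtain S c where S: "finite S" "p = (\<lambda>\<theta>. \<Sum>n\<in>S. c n * chr n \<theta>)" by (rule trig_poly_sum[OF p(1)])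
  have bp: "bmeas p" unfolding S(2) by (intro bmeas_sum bmeas_cmult bmeas_chr)
  have "msq (\<lambda>\<theta>. h n \<theta> - p \<theta>) \<le> msq (\<lambda>_. of_real (sqrt (e / 4)))"
  proof (intro msq_mono bmeas_diff bh bp bmeas_const)
    show "AE \<theta> in circ. cmod (h n \<theta> - p \<theta>) \<le> cmod (of_real (sqrt (e / 4)))"
    proof (rule AE_I2)
      fix \<theta> assume "\<theta> \<in> space circ"
      then have "cmod (h n \<theta> - p \<theta>) < sqrt (e / 4)" using p(2) by simp
      then show "cmod (h n \<theta> - p \<theta>) \<le> cmod (of_real (sqrt (e / 4)))"
        unfolding norm_of_real by linarith
    qed
  qed
  also have "\<dots> = e / 4" using e by (simp add: msq_const)
  finally have m2: "msq (\<lambda>\<theta>. h n \<theta> - p \<theta>) \<le> e / 4" .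
  have "msq (\<lambda>\<theta>. f \<theta> - p \<theta>) \<le> 2 * msq (\<lambda>\<theta>. f \<theta> - h n \<theta>) + 2 * msq (\<lambda>\<theta>. h n \<theta> - p \<theta>)"
    using msq_add_le[OF bmeas_diff[OF f bh] bmeas_diff[OF bh bp], of n n] by simp
  also have "\<dots> < e" using m1 m2 by simp
  finally show ?thesis using that[of S c] S by simp
qed

lemma msq_eq_0_AE:
  assumes f: "bmeas f" and "msq f = 0" shows "AE \<theta> in circ. f \<theta> = 0"
proof -
  have b: "bmeas (\<lambda>\<theta>. f \<theta> * cnj (f \<theta>))" by (intro bmeas_mult bmeas_cnj f)
  have "(LINT \<theta>|circ. (cmod (f \<theta>))\<^sup>2) = 0"
    using assms(2) Re_mean[OF b] by (simp add: msq_def mult_cnj del: of_real_power complex_mult_cnj)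
  moreover have "integrable circ (\<lambda>\<theta>. (cmod (f \<theta>))\<^sup>2)"
    using integrable_Re[OF bmeas_integrable[OF b]] by (simp only: mult_cnj Re_complex_of_real)
  ultimately have "AE \<theta> in circ. (cmod (f \<theta>))\<^sup>2 = 0"
    using integral_nonneg_eq_0_iff_AE[of circ "\<lambda>\<theta>. (cmod (f \<theta>))\<^sup>2"] by auto
  then show ?thesis by simp
qed

text \<open>A function with vanishing coefficients is orthogonal to every trigonometric polynomial,
  so its mean square is at most its squared distance to any of them, which density makes arbitrarily
  small. This later transfers reality and symmetry from the coefficients to the values of the
  symbol.\<close>

lemma fc_unique:
  assumes f: "bmeas f" and g: "bmeas g" and eq: "\<And>n. fc f n = fc g n"
  shows "AE \<theta> in circ. f \<theta> = g \<theta>"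
proof -
  let ?u = "\<lambda>\<theta>. f \<theta> - g \<theta>"
  have u: "bmeas ?u" by (intro bmeas_diff f g)
  have fc0: "fc ?u n = 0" for n
    unfolding fc_def left_diff_distrib using eq[of n]
    by (subst mean_diff) (auto intro!: bmeas_mult f g simp: fc_def)
  have "msq ?u < e" if e: "e > 0" for e
  proof -
    obtain S c where S: "finite S" "msq (\<lambda>\<theta>. ?u \<theta> - (\<Sum>n\<in>S. c n * chr n \<theta>)) < e"
      by (rule trig_poly_dense[OF u e])
    from S(2) show ?thesis
      unfolding msq_diff_trig[OF u S(1)] using sum_nonneg[of S "\<lambda>n. (cmod (c n))\<^sup>2"] by (simp add: fc0)
  qed
  then have "msq ?u \<le> 0" by (meson dense not_le less_asym)
  then have "msq ?u = 0" using msq_nonneg[OF u] by simp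
  from msq_eq_0_AE[OF u this] show ?thesis by simp
qed

text \<open>For column \<open>j\<close> the sum runs over the frequencies from \<open>- j\<close> to
  \<open>n - 1 - j\<close>. This window contains a fixed finite set of frequencies bounded by
  \<open>d\<close> unless \<open>j\<close> is within \<open>d\<close> of an end of the range. Hence
  the Bessel defect is small except for at most \<open>2 * d\<close> columns, where it is still at
  most \<open>msq f\<close>.\<close>

lemma cesaro_parseval:
  assumes f: "bmeas f"
  shows "(\<lambda>n. (\<Sum>j<n. msq f - (\<Sum>l<n. (cmod (fc f (int l - int j)))\<^sup>2)) / real n) \<longlonglongrightarrow> 0"
proof (rule LIMSEQ_I)
  fix e :: real assume e: "e > 0"
  obtain S c where S: "finite S" "msq (\<lambda>\<theta>. f \<theta> - (\<Sum>n\<in>S. c n * chr n \<theta>)) < e / 2"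
    using trig_poly_dense[OF f, of "e / 2"] e by auto
  have S2: "msq f - (\<Sum>n\<in>S. (cmod (fc f n))\<^sup>2) < e / 2"
    using S(2) unfolding msq_diff_trig[OF f S(1)]
    using sum_nonneg[of S "\<lambda>n. (cmod (fc f n - c n))\<^sup>2"] by simp
  obtain d where d: "\<And>n. n \<in> S \<Longrightarrow> \<bar>n\<bar> \<le> int d"
  proof -
    have "\<bar>n\<bar> \<le> int (nat (Max (insert 0 (abs ` S))))" if "n \<in> S" for n
      using that S(1) by (auto intro!: Max_ge simp: le_nat_iff)
    then show ?thesis using that by blast
  qed
  define t where "t n j = msq f - (\<Sum>l<n. (cmod (fc f (int l - int j)))\<^sup>2)" for n j
  have sl: "(\<Sum>l<n. (cmod (fc f (int l - int j)))\<^sup>2) = (\<Sum>r\<in>(\<lambda>l. int l - int j) ` {..<n}. (cmod (fc f r))\<^sup>2)" for n j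
    by (subst sum.reindex) (auto simp: inj_on_def)
  have t0: "t n j \<ge> 0" for n j
    unfolding t_def sl using bessel[OF f, of "(\<lambda>l. int l - int j) ` {..<n}"] by simp
  have tm: "t n j \<le> msq f" for n j
    unfolding t_def by (simp add: sum_nonneg)
  have te: "t n j < e / 2" if j: "d \<le> j" "j + d < n" for n j
  proof -
    have "S \<subseteq> (\<lambda>l. int l - int j) ` {..<n}"
    proof
      fix r assume "r \<in> S"
      with d have "\<bar>r\<bar> \<le> int d" by simp
      then show "r \<in> (\<lambda>l. int l - int j) ` {..<n}"
        using j by (intro image_eqI[of _ _ "nat (r + int j)"]) auto
    qed
    then have "(\<Sum>r\<in>S. (cmod (fc f r))\<^sup>2) \<le> (\<Sum>l<n. (cmod (fc f (int l - int j)))\<^sup>2)"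
      unfolding sl by (intro sum_mono2) auto
    then show ?thesis using S2 by (simp add: t_def)
  qed
  \<comment> \<open>From \<open>n0\<close> on, the exceptional columns together cost less than
    \<open>n * (e / 2)\<close>; the other half of \<open>e\<close> pays for the regular
    ones.\<close>
  obtain n0 where n0: "real n0 * (e / 2) > 2 * real d * msq f + 1" "n0 > 0"
  proof -
    obtain k where "2 * real d * msq f + 1 < real k * (e/2)"
      using reals_Archimedean3[of "e/2"] e by (meson half_gt_zero)
    moreover have "real k * (e/2) \<le> real (Suc k) * (e/2)" using e by simp
    ultimately show ?thesis using that[of "Suc k"] by linarith
  qed
  have "norm ((\<Sum>j<n. t n j) / real n - 0) < e" if n: "n \<ge> n0" for n
  proof -
    have "(\<Sum>j<n. t n j) \<le> (\<Sum>j<n. e / 2 + (if j < d \<or> n \<le> j + d then msq f else 0))"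
    proof (rule sum_mono)
      fix j assume "j \<in> {..<n}"
      show "t n j \<le> e / 2 + (if j < d \<or> n \<le> j + d then msq f else 0)"
        using te[of j n] tm[of n j] e by (cases "j < d \<or> n \<le> j + d") auto
    qed
    also have "\<dots> = real n * (e / 2) + real (card {j \<in> {..<n}. j < d \<or> n \<le> j + d}) * msq f"
      by (simp add: sum.distrib sum.If_cases Int_def conj_commute)
    also have "\<dots> \<le> real n * (e / 2) + real (2 * d) * msq f"
    proof -
      have "{j \<in> {..<n}. j < d \<or> n \<le> j + d} \<subseteq> {..<d} \<union> {n-d..<n}" by auto
      then have "card {j \<in> {..<n}. j < d \<or> n \<le> j + d} \<le> card ({..<d} \<union> {n-d..<n})"
        by (intro card_mono) auto
      also have "\<dots> \<le> d + d" by (rule order_trans[OF card_Un_le]) auto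
      finally show ?thesis using msq_nonneg[OF f] by (intro add_left_mono mult_right_mono) auto
    qed
    also have "\<dots> < real n * (e / 2) + real n * (e / 2)"
    proof -
      have "real n0 * (e / 2) \<le> real n * (e / 2)" using n e by (intro mult_right_mono) auto
      then show ?thesis using n0(1) by (simp add: algebra_simps)
    qed
    finally have "(\<Sum>j<n. t n j) < real n * e" by (simp add: mult.commute)
    moreover have "(\<Sum>j<n. t n j) \<ge> 0" by (intro sum_nonneg t0)
    ultimately show ?thesis using n n0 by (simp add: divide_less_eq mult.commute)
  qed
  then show "\<exists>n0. \<forall>n\<ge>n0. norm ((\<Sum>j<n. msq f - (\<Sum>l<n. (cmod (fc f (int l - int j)))\<^sup>2)) / real n - 0) < e"
    unfolding t_def by blast
qed

section \<open>Fourier coefficients of combinations and shifts\<close>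

lemma fc_diff:
  assumes "bmeas f" "bmeas g" shows "fc (\<lambda>\<theta>. f \<theta> - g \<theta>) n = fc f n - fc g n"
  unfolding fc_def left_diff_distrib by (intro mean_diff bmeas_mult bmeas_chr assms)

lemma fc_sum:
  assumes "\<And>i. i \<in> I \<Longrightarrow> bmeas (f i)" shows "fc (\<lambda>\<theta>. \<Sum>i\<in>I. f i \<theta>) n = (\<Sum>i\<in>I. fc (f i) n)"
  unfolding fc_def sum_distrib_right by (intro mean_sum bmeas_mult bmeas_chr assms)

lemma fc_cmult: "fc (\<lambda>\<theta>. c * f \<theta>) n = c * fc f n"
  unfolding fc_def mult.assoc by (rule mean_cmult)

lemma fc_chr_mult: "fc (\<lambda>\<theta>. f \<theta> * chr j \<theta>) n = fc f (n - j)"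
  unfolding fc_def by (simp add: mult.assoc chr_mult)

lemma msq_chr_mult: "msq (\<lambda>\<theta>. f \<theta> * chr j \<theta>) = msq f"
proof -
  have "f \<theta> * chr j \<theta> * cnj (f \<theta> * chr j \<theta>) = f \<theta> * cnj (f \<theta>) * (chr j \<theta> * chr (-j) \<theta>)" for \<theta>
    by (simp add: cnj_chr mult_ac)
  then show ?thesis unfolding msq_def by (simp only: chr_mult right_minus chr_0 mult_1_right)
qed

lemma bessel_shifted:
  fixes n :: nat
  assumes "bmeas f" "inj_on u {..<n}"
  shows "(\<Sum>i<n. (cmod (fc f (u i)))\<^sup>2) \<le> msq f"
proof -
  have "(\<Sum>i<n. (cmod (fc f (u i)))\<^sup>2) = (\<Sum>r\<in>u ` {..<n}. (cmod (fc f r))\<^sup>2)"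
    using assms(2) by (simp add: sum.reindex)
  then show ?thesis using bessel[OF assms(1), of "u ` {..<n}"] by simp
qed

section \<open>Products of truncated Toeplitz matrices\<close>

text \<open>The Frobenius norm of the \<open>n \<times> n\<close> matrix \<open>E n\<close> is \<open>o(sqrt n)\<close>; such an error changes its
  normalized trace by \<open>o(1)\<close>.\<close>

definition negl :: "(nat \<Rightarrow> nat \<Rightarrow> nat \<Rightarrow> complex) \<Rightarrow> bool" where
  "negl E \<longleftrightarrow> (\<lambda>n. (\<Sum>i<n. \<Sum>j<n. (cmod (E n i j))\<^sup>2) / real n) \<longlonglongrightarrow> 0"

lemma negl_mono:
  assumes "u \<longlonglongrightarrow> 0" "\<And>n. (\<Sum>i<n. \<Sum>j<n. (cmod (E n i j))\<^sup>2) / real n \<le> u n"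
  shows "negl E"
  unfolding negl_def
proof (rule tendsto_sandwich[OF _ _ tendsto_const assms(1)])
  show "\<forall>\<^sub>F n in sequentially. 0 \<le> (\<Sum>i<n. \<Sum>j<n. (cmod (E n i j))\<^sup>2) / real n"
    by (intro always_eventually allI divide_nonneg_nonneg sum_nonneg) auto
qed (use assms(2) in auto)

lemma negl_cong:
  assumes "\<And>n i j. i < n \<Longrightarrow> j < n \<Longrightarrow> E n i j = F n i j"
  shows "negl E = negl F"
proof -
  have "(\<Sum>i<n. \<Sum>j<n. (cmod (E n i j))\<^sup>2) = (\<Sum>i<n. \<Sum>j<n. (cmod (F n i j))\<^sup>2)" for n
    using assms by (intro sum.cong) auto
  then show ?thesis unfolding negl_def by simp
qed

lemma negl_0: "negl (\<lambda>_ _ _. 0)"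
  by (simp add: negl_def)

lemma norm_add_sq_le: "(cmod (a + b))\<^sup>2 \<le> 2 * (cmod a)\<^sup>2 + 2 * (cmod b)\<^sup>2"
proof -
  have "0 \<le> (Re a - Re b)\<^sup>2 + (Im a - Im b)\<^sup>2" by simp
  then show ?thesis unfolding cmod_power2 by (simp add: power2_eq_square algebra_simps)
qed

lemma negl_add:
  assumes "negl E" "negl F" shows "negl (\<lambda>n i j. E n i j + F n i j)"
proof (rule negl_mono)
  let ?s = "\<lambda>E n. (\<Sum>i<n. \<Sum>j<n. (cmod (E n i j))\<^sup>2) / real n"
  show "(\<lambda>n. 2 * ?s E n + 2 * ?s F n) \<longlonglongrightarrow> 0"
    using tendsto_add[OF tendsto_mult_left[OF assms(1)[unfolded negl_def], of 2]
      tendsto_mult_left[OF assms(2)[unfolded negl_def], of 2]] by simp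
  fix n
  have "(\<Sum>i<n. \<Sum>j<n. (cmod (E n i j + F n i j))\<^sup>2) \<le>
      (\<Sum>i<n. \<Sum>j<n. 2 * (cmod (E n i j))\<^sup>2 + 2 * (cmod (F n i j))\<^sup>2)"
    by (intro sum_mono norm_add_sq_le)
  then have "?s (\<lambda>n i j. E n i j + F n i j) n \<le> (\<Sum>i<n. \<Sum>j<n. 2 * (cmod (E n i j))\<^sup>2 + 2 * (cmod (F n i j))\<^sup>2) / real n"
    by (intro divide_right_mono) auto
  then show "?s (\<lambda>n i j. E n i j + F n i j) n \<le> 2 * ?s E n + 2 * ?s F n"
    by (simp add: sum.distrib sum_distrib_left add_divide_distrib)
qed

lemma negl_sum:
  "(\<And>t. t \<in> I \<Longrightarrow> negl (E t)) \<Longrightarrow> negl (\<lambda>n i j. \<Sum>t\<in>I. E t n i j)"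
  by (induction I rule: infinite_finite_induct) (auto simp: negl_0 intro: negl_add)

text \<open>The truncation has operator norm at most \<open>C\<close>, uniformly in
  \<open>n\<close>. If \<open>q\<close> has the coefficient \<open>x l\<close> at frequency
  \<open>- l\<close>, then the inner sums are coefficients of \<open>b q\<close> at the frequencies
  \<open>- j\<close>, since \<open>l - j = (- j) - (- l)\<close>. Bessel and the pointwise bound on
  \<open>b\<close> finish the argument.\<close>

lemma toeplitz_form_bound:
  assumes b: "bmeas b" and C: "AE \<theta> in circ. cmod (b \<theta>) \<le> C" "C \<ge> 0"
  shows "(\<Sum>j<n. (cmod (\<Sum>l<n. x l * fc b (int l - int j)))\<^sup>2) \<le> C\<^sup>2 * (\<Sum>l<n. (cmod (x l))\<^sup>2)"
proof -
  define S where "S = (\<lambda>l. - int l) ` {..<n}"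
  define q where "q \<theta> = (\<Sum>l<n. x l * chr (- int l) \<theta>)" for \<theta>
  have inj: "inj_on (\<lambda>l. - int l) {..<n}" by (auto simp: inj_on_def)
  have q: "bmeas q" unfolding q_def by (intro bmeas_sum bmeas_cmult bmeas_chr)
  have "q = (\<lambda>\<theta>. \<Sum>r\<in>S. x (nat (- r)) * chr r \<theta>)"
    unfolding S_def sum.reindex[OF inj] q_def by simp
  moreover have "finite S" unfolding S_def by simp
  ultimately have mq: "msq q = (\<Sum>l<n. (cmod (x l))\<^sup>2)"
    by (simp add: msq_trig) (simp add: S_def sum.reindex[OF inj])
  have "fc (\<lambda>\<theta>. b \<theta> * q \<theta>) (- int j) = (\<Sum>l<n. x l * fc b (int l - int j))" for j
  proof -
    have "(\<lambda>\<theta>. b \<theta> * q \<theta>) = (\<lambda>\<theta>. \<Sum>l<n. x l * (b \<theta> * chr (- int l) \<theta>))"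
      by (simp add: q_def sum_distrib_left mult_ac)
    then have "fc (\<lambda>\<theta>. b \<theta> * q \<theta>) (- int j) = (\<Sum>l<n. x l * fc b (- int j - - int l))"
      by (simp add: fc_sum fc_cmult fc_chr_mult bmeas_cmult bmeas_mult b)
    then show ?thesis by (simp add: algebra_simps)
  qed
  then have "(\<Sum>j<n. (cmod (\<Sum>l<n. x l * fc b (int l - int j)))\<^sup>2) =
      (\<Sum>j<n. (cmod (fc (\<lambda>\<theta>. b \<theta> * q \<theta>) (- int j)))\<^sup>2)" by simp
  also have "\<dots> \<le> msq (\<lambda>\<theta>. b \<theta> * q \<theta>)" using inj by (intro bessel_shifted bmeas_mult b q)
  also have "\<dots> \<le> C\<^sup>2 * msq q" by (intro msq_le_bound b q C)
  finally show ?thesis unfolding mq .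
qed

text \<open>Multiplication by a matrix of operator norm at most \<open>C\<close> increases the
  Frobenius norm at most by the factor \<open>C\<close>; the preceding bound is applied to each row
  of the error.\<close>

lemma negl_mult_toeplitz:
  assumes b: "bmeas b" and E: "negl E"
  shows "negl (\<lambda>n i j. \<Sum>l<n. E n i l * fc b (int l - int j))"
proof -
  obtain C where C: "C > 0" "AE \<theta> in circ. cmod (b \<theta>) \<le> C" using b by (rule bmeasE)
  show ?thesis
  proof (rule negl_mono)
    show "(\<lambda>n. C\<^sup>2 * ((\<Sum>i<n. \<Sum>j<n. (cmod (E n i j))\<^sup>2) / real n)) \<longlonglongrightarrow> 0"
      using tendsto_mult_left[OF E[unfolded negl_def], of "C\<^sup>2"] by simp
    fix n
    have "(\<Sum>i<n. \<Sum>j<n. (cmod (\<Sum>l<n. E n i l * fc b (int l - int j)))\<^sup>2) \<le>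
        (\<Sum>i<n. C\<^sup>2 * (\<Sum>j<n. (cmod (E n i j))\<^sup>2))"
      using C by (intro sum_mono toeplitz_form_bound[OF b]) auto
    also have "\<dots> = C\<^sup>2 * (\<Sum>i<n. \<Sum>j<n. (cmod (E n i j))\<^sup>2)" by (simp add: sum_distrib_left)
    finally show "(\<Sum>i<n. \<Sum>j<n. (cmod (\<Sum>l<n. E n i l * fc b (int l - int j)))\<^sup>2) / real n \<le>
        C\<^sup>2 * ((\<Sum>i<n. \<Sum>j<n. (cmod (E n i j))\<^sup>2) / real n)"
      by (simp add: divide_right_mono)
  qed
qed

text \<open>Column \<open>j\<close> of the difference consists of Fourier coefficients of \<open>a\<close> times the tail of the Fourier
  series of \<open>b\<close> shifted by \<open>j\<close>. By Bessel it is bounded by that tail, which is small on average.\<close>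

lemma negl_toeplitz_product:
  assumes a: "bmeas a" and b: "bmeas b"
  shows "negl (\<lambda>n i j. (\<Sum>l<n. fc a (int i - int l) * fc b (int l - int j)) - fc (\<lambda>\<theta>. a \<theta> * b \<theta>) (int i - int j))"
    (is "negl ?E")
proof -
  obtain C where C: "C > 0" "AE \<theta> in circ. cmod (a \<theta>) \<le> C" using a by (rule bmeasE)
  show ?thesis
  proof (rule negl_mono)
    show "(\<lambda>n. C\<^sup>2 * ((\<Sum>j<n. msq b - (\<Sum>l<n. (cmod (fc b (int l - int j)))\<^sup>2)) / real n)) \<longlonglongrightarrow> 0"
      using tendsto_mult_left[OF cesaro_parseval[OF b], of "C\<^sup>2"] by simp
    fix n
    have "(\<Sum>i<n. (cmod (?E n i j))\<^sup>2) \<le> C\<^sup>2 * (msq b - (\<Sum>l<n. (cmod (fc b (int l - int j)))\<^sup>2))" for j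
    proof -
      \<comment> \<open>The shift moves the coefficients of \<open>b\<close> in column
        \<open>j\<close> to the frequencies \<open>0..<n\<close>, and \<open>p\<close> is the part
        of the series of \<open>g\<close> at just these frequencies. The truncated product sees
        \<open>a p\<close>, the truncation of the product sees \<open>a g\<close>, so the error is
        the coefficient of \<open>a (g - p)\<close> up to sign.\<close>
      define g where "g \<theta> = b \<theta> * chr (int j) \<theta>" for \<theta>
      define p where "p \<theta> = (\<Sum>r\<in>int ` {..<n}. fc b (r - int j) * chr r \<theta>)" for \<theta>
      have g: "bmeas g" unfolding g_def by (intro bmeas_mult b bmeas_chr)
      have p: "bmeas p" unfolding p_def by (intro bmeas_sum bmeas_cmult bmeas_chr)
      have inj: "inj_on int {..<n}" by simp
      have "fc (\<lambda>\<theta>. a \<theta> * p \<theta>) i = (\<Sum>l<n. fc a (i - int l) * fc b (int l - int j))" for i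
      proof -
        have "(\<lambda>\<theta>. a \<theta> * p \<theta>) = (\<lambda>\<theta>. \<Sum>l<n. fc b (int l - int j) * (a \<theta> * chr (int l) \<theta>))"
          by (simp add: p_def sum.reindex sum_distrib_left mult_ac)
        then show ?thesis
          by (simp add: fc_sum fc_cmult fc_chr_mult bmeas_cmult bmeas_mult a)
            (intro sum.cong refl mult.commute)
      qed
      moreover have "fc (\<lambda>\<theta>. a \<theta> * g \<theta>) i = fc (\<lambda>\<theta>. a \<theta> * b \<theta>) (i - int j)" for i
        using fc_chr_mult[of "\<lambda>\<theta>. a \<theta> * b \<theta>" "int j" i] by (simp add: g_def mult.assoc)
      ultimately have "fc (\<lambda>\<theta>. a \<theta> * (g \<theta> - p \<theta>)) (int i) = - ?E n i j" for i
        unfolding right_diff_distrib by (simp add: fc_diff bmeas_mult a g p)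
      then have "(\<Sum>i<n. (cmod (?E n i j))\<^sup>2) = (\<Sum>i<n. (cmod (fc (\<lambda>\<theta>. a \<theta> * (g \<theta> - p \<theta>)) (int i)))\<^sup>2)"
        by (simp add: norm_minus_commute)
      also have "\<dots> \<le> msq (\<lambda>\<theta>. a \<theta> * (g \<theta> - p \<theta>))"
        by (intro bessel_shifted bmeas_mult bmeas_diff a g p) simp
      also have "\<dots> \<le> C\<^sup>2 * msq (\<lambda>\<theta>. g \<theta> - p \<theta>)"
        using C by (intro msq_le_bound bmeas_diff a g p) auto
      also have "msq (\<lambda>\<theta>. g \<theta> - p \<theta>) = msq b - (\<Sum>l<n. (cmod (fc b (int l - int j)))\<^sup>2)"
        unfolding p_def by (subst msq_diff_trig[OF g])
          (simp_all add: g_def[abs_def] msq_chr_mult fc_chr_mult sum.reindex)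
      finally show ?thesis .
    qed
    then have "(\<Sum>j<n. \<Sum>i<n. (cmod (?E n i j))\<^sup>2) \<le>
        (\<Sum>j<n. C\<^sup>2 * (msq b - (\<Sum>l<n. (cmod (fc b (int l - int j)))\<^sup>2)))" by (intro sum_mono)
    then have "(\<Sum>i<n. \<Sum>j<n. (cmod (?E n i j))\<^sup>2) \<le>
        C\<^sup>2 * (\<Sum>j<n. msq b - (\<Sum>l<n. (cmod (fc b (int l - int j)))\<^sup>2))"
      by (subst sum.swap) (simp add: sum_distrib_left)
    then show "(\<Sum>i<n. \<Sum>j<n. (cmod (?E n i j))\<^sup>2) / real n \<le>
        C\<^sup>2 * ((\<Sum>j<n. msq b - (\<Sum>l<n. (cmod (fc b (int l - int j)))\<^sup>2)) / real n)"
      by (simp add: divide_right_mono)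
  qed
qed

text \<open>Cauchy-Schwarz on the diagonal bounds the trace by \<open>sqrt n\<close> times the
  Frobenius norm; division by \<open>n\<close> leaves the square root of the quantity in
  \<open>negl\<close>.\<close>

lemma negl_trace:
  assumes "negl E" shows "(\<lambda>n. (\<Sum>i<n. E n i i) / of_nat n) \<longlonglongrightarrow> 0"
proof -
  let ?s = "\<lambda>n. (\<Sum>i<n. \<Sum>j<n. (cmod (E n i j))\<^sup>2) / real n"
  have "(\<lambda>n. sqrt (?s n)) \<longlonglongrightarrow> 0"
    using assms tendsto_real_sqrt unfolding negl_def by fastforce
  then show ?thesis
  proof (rule Lim_null_comparison[rotated], intro always_eventually allI)
    fix n
    show "norm ((\<Sum>i<n. E n i i) / of_nat n) \<le> sqrt (?s n)"
    proof (cases "n = 0")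
      case False
      have "(\<Sum>i<n. cmod (E n i i) * 1) \<le> L2_set (\<lambda>i. cmod (E n i i)) {..<n} * L2_set (\<lambda>_. 1) {..<n}"
        using L2_set_mult_ineq[of "\<lambda>i. cmod (E n i i)" "\<lambda>_. 1" "{..<n}"] by simp
      also have "\<dots> = sqrt (\<Sum>i<n. (cmod (E n i i))\<^sup>2) * sqrt (real n)" by (simp add: L2_set_def)
      also have "\<dots> \<le> sqrt (\<Sum>i<n. \<Sum>j<n. (cmod (E n i j))\<^sup>2) * sqrt (real n)"
        by (intro mult_right_mono real_sqrt_le_mono sum_mono member_le_sum) auto
      finally have "cmod (\<Sum>i<n. E n i i) \<le> sqrt (\<Sum>i<n. \<Sum>j<n. (cmod (E n i j))\<^sup>2) * sqrt (real n)"
        using norm_sum[of "\<lambda>i. E n i i" "{..<n}"] by simp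
      then have "cmod (\<Sum>i<n. E n i i) / real n \<le>
          sqrt (\<Sum>i<n. \<Sum>j<n. (cmod (E n i j))\<^sup>2) * sqrt (real n) / (sqrt (real n) * sqrt (real n))"
        by (simp add: divide_right_mono del: times_divide_eq_left)
      also have "\<dots> = sqrt (?s n)" unfolding real_sqrt_divide using False
        by (intro nonzero_mult_divide_mult_cancel_right) simp
      finally show ?thesis by (simp add: norm_divide)
    qed simp
  qed
qed

section \<open>Blocks of truncated Toeplitz matrices\<close>

lemma fourier_coeff_index:
  "r < m \<Longrightarrow> s < m \<Longrightarrow> fourier_coeff m A n $$ (r, s) = fc (\<lambda>\<theta>. A \<theta> $$ (r, s)) n"
  by (simp add: fourier_coeff_def fc_def mean_def chr_def)

lemma block_index:
  fixes i n r m :: nat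
  assumes "i < n" "r < m"
  shows "i * m + r < n * m" "(i * m + r) div m = i" "(i * m + r) mod m = r"
proof -
  have "i * m + r < Suc i * m" using assms(2) by simp
  also have "\<dots> \<le> n * m" using assms(1) by (intro mult_le_mono1) simp
  finally show "i * m + r < n * m" .
qed (use assms in auto)

lemma toeplitz_mat_index:
  assumes "i < n" "j < n" "r < m" "s < m"
  shows "toeplitz_mat m A n $$ (i * m + r, j * m + s) = fc (\<lambda>\<theta>. A \<theta> $$ (r, s)) (int i - int j)"
  using assms by (simp add: toeplitz_mat_def block_index fourier_coeff_index)

lemma sum_blocks:
  fixes g :: "nat \<Rightarrow> 'a::comm_monoid_add"
  shows "(\<Sum>p<n * m. g p) = (\<Sum>i<n. \<Sum>r<m. g (i * m + r))"
proof -
  have "(\<Sum>p<n * m. g p) = (\<Sum>i<n. sum g {i * m..<i * m + m})" by (rule sum.nat_group[symmetric])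
  also have "\<dots> = (\<Sum>i<n. \<Sum>r<m. g (i * m + r))"
    using sum.shift_bounds_nat_ivl[of g 0 "_ * m" m] by (simp add: lessThan_atLeast0 add.commute)
  finally show ?thesis .
qed

lemma bmeas_cong:
  assumes "\<And>\<theta>. \<theta> \<in> {-pi..pi} \<Longrightarrow> f \<theta> = g \<theta>" shows "bmeas f = bmeas g"
proof -
  have "f \<in> borel_measurable circ \<longleftrightarrow> g \<in> borel_measurable circ"
    using assms by (intro measurable_cong) simp
  moreover have "(AE \<theta> in circ. cmod (f \<theta>) \<le> C) \<longleftrightarrow> (AE \<theta> in circ. cmod (g \<theta>) \<le> C)" for C
    using assms by (intro AE_cong) simp
  ultimately show ?thesis by (simp add: bmeas_def)
qed

lemma fc_cong:
  assumes "\<And>\<theta>. \<theta> \<in> {-pi..pi} \<Longrightarrow> f \<theta> = g \<theta>" shows "fc f n = fc g n"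
  unfolding fc_def mean_def using assms
  by (intro arg_cong2[where f = "(*)"] Bochner_Integration.integral_cong) auto

text \<open>Common to the symbol \<open>A\<close> and to the symbol \<open>J A\<close>, to which the
  trace limit is applied.\<close>

definition bsymbol :: "nat \<Rightarrow> (real \<Rightarrow> complex mat) \<Rightarrow> bool" where
  "bsymbol m C \<longleftrightarrow> (\<forall>\<theta> \<in> {-pi..pi}. C \<theta> \<in> carrier_mat m m) \<and>
     (\<forall>r<m. \<forall>s<m. bmeas (\<lambda>\<theta>. C \<theta> $$ (r, s)))"

lemma bsymbol_dim: "bsymbol m C \<Longrightarrow> - pi \<le> \<theta> \<Longrightarrow> \<theta> \<le> pi \<Longrightarrow> dim_row (C \<theta>) = m"
  by (auto simp: bsymbol_def)

lemma Linf_symbol_bsymbol: "Linf_symbol m A \<Longrightarrow> bsymbol m A"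
  by (auto simp: Linf_symbol_def bsymbol_def bmeas_def)

lemma pow_Suc_index:
  assumes "X \<in> carrier_mat m m" "r < m" "s < m"
  shows "(X ^\<^sub>m Suc p) $$ (r, s) = (\<Sum>t<m. (X ^\<^sub>m p) $$ (r, t) * X $$ (t, s))"
  using assms pow_carrier_mat[OF assms(1), of p]
  by (auto simp: scalar_prod_def lessThan_atLeast0)

lemma bmeas_pow:
  assumes "bsymbol m C" "r < m" "s < m" shows "bmeas (\<lambda>\<theta>. (C \<theta> ^\<^sub>m p) $$ (r, s))"
  using assms(2,3)
proof (induction p arbitrary: r s)
  case 0
  then have "bmeas (\<lambda>\<theta>. (C \<theta> ^\<^sub>m 0) $$ (r, s)) = bmeas (\<lambda>\<theta>. if r = s then 1 else 0)"
    by (intro bmeas_cong) (simp add: bsymbol_dim[OF assms(1)])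
  then show ?case by simp
next
  case (Suc p)
  have "bmeas (\<lambda>\<theta>. (C \<theta> ^\<^sub>m Suc p) $$ (r, s)) =
      bmeas (\<lambda>\<theta>. \<Sum>t<m. (C \<theta> ^\<^sub>m p) $$ (r, t) * C \<theta> $$ (t, s))"
    using assms(1) Suc.prems by (intro bmeas_cong pow_Suc_index) (auto simp: bsymbol_def)
  moreover have "bmeas (\<lambda>\<theta>. \<Sum>t<m. (C \<theta> ^\<^sub>m p) $$ (r, t) * C \<theta> $$ (t, s))"
    using assms(1) Suc by (intro bmeas_sum bmeas_mult) (auto simp: bsymbol_def)
  ultimately show ?case by blast
qed

lemma toeplitz_mat_carrier: "toeplitz_mat m A n \<in> carrier_mat (n * m) (n * m)"
  by (simp add: toeplitz_mat_def)

lemma toeplitz_mat_dim [simp]: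
  "dim_row (toeplitz_mat m A n) = n * m" "dim_col (toeplitz_mat m A n) = n * m"
  by (simp_all add: toeplitz_mat_def)

lemma fc_const: "fc (\<lambda>_. c) n = (if n = 0 then c else 0)"
  using fc_trig[of "{0}" "\<lambda>_. c" n] by simp

text \<open>Passing from \<open>p\<close> to \<open>p + 1\<close> produces two errors in each block:
  \<open>?F\<close>, the old error multiplied by a truncated Toeplitz matrix, and \<open>?G\<close>,
  the defect of a product of two truncations. Both are negligible, and only finitely many are added,
  because the block size \<open>m\<close> is fixed.\<close>

lemma negl_toeplitz_power:
  assumes C: "bsymbol m C" and "r < m" "s < m"
  shows "negl (\<lambda>n i j. (toeplitz_mat m C n ^\<^sub>m p) $$ (i * m + r, j * m + s) -
    fc (\<lambda>\<theta>. (C \<theta> ^\<^sub>m p) $$ (r, s)) (int i - int j))"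
  using assms(2,3)
proof (induction p arbitrary: r s)
  case 0
  have "(1\<^sub>m (n * m) :: complex mat) $$ (i * m + r, j * m + s) =
      fc (\<lambda>\<theta>. (C \<theta> ^\<^sub>m 0) $$ (r, s)) (int i - int j)" if ij: "i < n" "j < n" for n i j
  proof -
    have "fc (\<lambda>\<theta>. (C \<theta> ^\<^sub>m 0) $$ (r, s)) (int i - int j) = fc (\<lambda>\<theta>. if r = s then 1 else 0) (int i - int j)"
      using 0 by (intro fc_cong) (simp add: bsymbol_dim[OF C])
    moreover have "i * m + r = j * m + s \<longleftrightarrow> i = j \<and> r = s"
      using block_index(2,3)[OF ij(1) 0(1)] block_index(2,3)[OF ij(2) 0(2)] by metis
    ultimately show ?thesis using ij 0 by (simp add: fc_const block_index)
  qed
  then have "negl (\<lambda>n i j. (toeplitz_mat m C n ^\<^sub>m 0) $$ (i * m + r, j * m + s) -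
    fc (\<lambda>\<theta>. (C \<theta> ^\<^sub>m 0) $$ (r, s)) (int i - int j)) = negl (\<lambda>_ _ _. 0)"
    by (intro negl_cong) (simp add: toeplitz_mat_def)
  then show ?case using negl_0 by simp
next
  case (Suc p)
  let ?T = "\<lambda>n. toeplitz_mat m C n ^\<^sub>m p"
  let ?b = "\<lambda>t s \<theta>. C \<theta> $$ (t, s)" and ?a = "\<lambda>r t \<theta>. (C \<theta> ^\<^sub>m p) $$ (r, t)"
  let ?E = "\<lambda>t n i j. ?T n $$ (i * m + r, j * m + t) - fc (?a r t) (int i - int j)"
  let ?F = "\<lambda>t n i j. \<Sum>l<n. ?E t n i l * fc (?b t s) (int l - int j)"
  let ?G = "\<lambda>t n i j. (\<Sum>l<n. fc (?a r t) (int i - int l) * fc (?b t s) (int l - int j)) -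
      fc (\<lambda>\<theta>. ?a r t \<theta> * ?b t s \<theta>) (int i - int j)"
  have b: "bmeas (?b t s)" if "t < m" for t using C that Suc.prems by (auto simp: bsymbol_def)
  have a: "bmeas (?a r t)" if "t < m" for t using that Suc.prems by (intro bmeas_pow[OF C])
  have "negl (\<lambda>n i j. \<Sum>t<m. ?F t n i j + ?G t n i j)"
    using Suc by (intro negl_sum negl_add negl_mult_toeplitz negl_toeplitz_product a b) auto
  also have "?this = negl (\<lambda>n i j. (toeplitz_mat m C n ^\<^sub>m Suc p) $$ (i * m + r, j * m + s) -
    fc (\<lambda>\<theta>. (C \<theta> ^\<^sub>m Suc p) $$ (r, s)) (int i - int j))"
  proof (rule negl_cong)
    fix n i j :: nat assume ij: "i < n" "j < n"
    have "(toeplitz_mat m C n ^\<^sub>m Suc p) $$ (i * m + r, j * m + s) =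
        (\<Sum>q<n * m. ?T n $$ (i * m + r, q) * toeplitz_mat m C n $$ (q, j * m + s))"
      using ij Suc.prems by (intro pow_Suc_index toeplitz_mat_carrier block_index)
    also have "\<dots> = (\<Sum>l<n. \<Sum>t<m. ?T n $$ (i * m + r, l * m + t) * fc (?b t s) (int l - int j))"
      unfolding sum_blocks using ij Suc.prems by (intro sum.cong refl) (simp add: toeplitz_mat_index)
    also have "\<dots> = (\<Sum>t<m. \<Sum>l<n. ?T n $$ (i * m + r, l * m + t) * fc (?b t s) (int l - int j))"
      by (rule sum.swap)
    finally have 1: "(toeplitz_mat m C n ^\<^sub>m Suc p) $$ (i * m + r, j * m + s) = \<dots>" .
    have "fc (\<lambda>\<theta>. (C \<theta> ^\<^sub>m Suc p) $$ (r, s)) (int i - int j) =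
        fc (\<lambda>\<theta>. \<Sum>t<m. ?a r t \<theta> * ?b t s \<theta>) (int i - int j)"
      using C Suc.prems by (intro fc_cong pow_Suc_index) (auto simp: bsymbol_def)
    also have "\<dots> = (\<Sum>t<m. fc (\<lambda>\<theta>. ?a r t \<theta> * ?b t s \<theta>) (int i - int j))"
      using a b by (intro fc_sum bmeas_mult) auto
    finally show "(\<Sum>t<m. ?F t n i j + ?G t n i j) = (toeplitz_mat m C n ^\<^sub>m Suc p) $$ (i * m + r, j * m + s) -
      fc (\<lambda>\<theta>. (C \<theta> ^\<^sub>m Suc p) $$ (r, s)) (int i - int j)"
      unfolding 1 by (simp add: sum.distrib sum_subtractf left_diff_distrib)
  qed
  finally show ?case .
qed

definition diag_sum :: "'a::comm_monoid_add mat \<Rightarrow> 'a" where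
  "diag_sum X = (\<Sum>i<dim_row X. X $$ (i, i))"

text \<open>On the diagonal \<open>int i - int j\<close> is 0, so every block contributes the same
  zeroth coefficient, which is a mean; only the trace of the error remains.\<close>

lemma toeplitz_power_trace:
  assumes C: "bsymbol m C"
  shows "(\<lambda>n. diag_sum (toeplitz_mat m C n ^\<^sub>m p) / of_nat n) \<longlonglongrightarrow> mean (\<lambda>\<theta>. diag_sum (C \<theta> ^\<^sub>m p))"
proof -
  let ?E = "\<lambda>r n i j. (toeplitz_mat m C n ^\<^sub>m p) $$ (i * m + r, j * m + r) -
      fc (\<lambda>\<theta>. (C \<theta> ^\<^sub>m p) $$ (r, r)) (int i - int j)"
  have "mean (\<lambda>\<theta>. diag_sum (C \<theta> ^\<^sub>m p)) = mean (\<lambda>\<theta>. \<Sum>r<m. (C \<theta> ^\<^sub>m p) $$ (r, r))"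
  proof -
    have "diag_sum (C \<theta> ^\<^sub>m p) = (\<Sum>r<m. (C \<theta> ^\<^sub>m p) $$ (r, r))" if "\<theta> \<in> {-pi..pi}" for \<theta>
      using C that pow_carrier_mat[of "C \<theta>" m p] by (auto simp: bsymbol_def diag_sum_def)
    then show ?thesis using fc_cong[of "\<lambda>\<theta>. diag_sum (C \<theta> ^\<^sub>m p)" "\<lambda>\<theta>. \<Sum>r<m. (C \<theta> ^\<^sub>m p) $$ (r, r)" 0]
      by (simp add: fc_def)
  qed
  also have "\<dots> = (\<Sum>r<m. fc (\<lambda>\<theta>. (C \<theta> ^\<^sub>m p) $$ (r, r)) 0)"
    using C by (subst mean_sum) (auto simp: fc_def intro!: bmeas_pow)
  finally have M: "mean (\<lambda>\<theta>. diag_sum (C \<theta> ^\<^sub>m p)) = (\<Sum>r<m. fc (\<lambda>\<theta>. (C \<theta> ^\<^sub>m p) $$ (r, r)) 0)" (is "_ = ?M") .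
  have "(\<lambda>n. \<Sum>r<m. (\<Sum>i<n. ?E r n i i) / of_nat n) \<longlonglongrightarrow> (\<Sum>r<m. 0)"
    using C by (intro tendsto_sum negl_trace negl_toeplitz_power) auto
  then have "(\<lambda>n. (\<Sum>r<m. (\<Sum>i<n. ?E r n i i) / of_nat n) + ?M) \<longlonglongrightarrow> 0 + ?M"
    by (intro tendsto_add) auto
  moreover have "\<forall>\<^sub>F n in sequentially. (\<Sum>r<m. (\<Sum>i<n. ?E r n i i) / of_nat n) + ?M =
      diag_sum (toeplitz_mat m C n ^\<^sub>m p) / of_nat n"
    using eventually_gt_at_top[of 0]
  proof eventually_elim
    case (elim n)
    have "(\<Sum>r<m. (\<Sum>i<n. ?E r n i i) / of_nat n) + ?M =
        (\<Sum>r<m. (\<Sum>i<n. (toeplitz_mat m C n ^\<^sub>m p) $$ (i * m + r, i * m + r)) / of_nat n)"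
      using elim by (simp add: sum_subtractf diff_divide_distrib)
    also have "\<dots> = (\<Sum>i<n. \<Sum>r<m. (toeplitz_mat m C n ^\<^sub>m p) $$ (i * m + r, i * m + r)) / of_nat n"
      by (subst sum.swap) (simp add: sum_divide_distrib)
    also have "\<dots> = diag_sum (toeplitz_mat m C n ^\<^sub>m p) / of_nat n"
      by (simp add: diag_sum_def sum_blocks)
    finally show ?case .
  qed
  ultimately show ?thesis unfolding M using Lim_transform_eventually by fastforce
qed

section \<open>Existence of symplectic normal forms\<close>

text \<open>Vectors are functions on all natural numbers of which only the values below
  \<open>N\<close> count. Thus the dimension stays a variable, linear combinations are plain lambda
  terms, and the product topology on \<open>nat \<Rightarrow> real\<close> is available for the
  maximization.\<close>

definition bform :: "(nat \<Rightarrow> nat \<Rightarrow> real) \<Rightarrow> nat \<Rightarrow> (nat \<Rightarrow> real) \<Rightarrow> (nat \<Rightarrow> real) \<Rightarrow> real" where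
  "bform B N x y = (\<Sum>i<N. \<Sum>j<N. x i * B i j * y j)"

lemma bform_right_add: "bform B N x (\<lambda>i. y i + z i) = bform B N x y + bform B N x z"
  by (simp add: bform_def distrib_left sum.distrib)

lemma bform_left_add: "bform B N (\<lambda>i. y i + z i) x = bform B N y x + bform B N z x"
  by (simp add: bform_def distrib_right sum.distrib)

lemma bform_right_scale: "bform B N x (\<lambda>i. c * y i) = c * bform B N x y"
  by (simp add: bform_def sum_distrib_left mult_ac)

lemma bform_left_scale: "bform B N (\<lambda>i. c * y i) x = c * bform B N y x"
  by (simp add: bform_def sum_distrib_left mult_ac)

lemma bform_right_sum: "bform B N x (\<lambda>i. \<Sum>k\<in>I. y k i) = (\<Sum>k\<in>I. bform B N x (y k))"
proof (induction I rule: infinite_finite_induct)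
  case (insert k I)
  then show ?case by (simp add: bform_right_add)
qed (auto simp: bform_def)

lemma bform_right_diff: "bform B N x (\<lambda>i. y i - z i) = bform B N x y - bform B N x z"
  using bform_right_add[of B N x y "\<lambda>i. - 1 * z i"] by (simp only: bform_right_scale) simp

lemma bform_cong:
  assumes "\<And>i. i < N \<Longrightarrow> x i = x' i" "\<And>i. i < N \<Longrightarrow> y i = y' i"
  shows "bform B N x y = bform B N x' y'"
  unfolding bform_def using assms by (intro sum.cong) auto

lemma continuous_on_bform:
  assumes "\<And>i. continuous_on S (\<lambda>p. f p i)" "\<And>i. continuous_on S (\<lambda>p. g p i)"
  shows "continuous_on S (\<lambda>p. bform B N (f p) (g p))"
  unfolding bform_def by (intro continuous_intros assms)

text \<open>The entries of \<open>J\<close>, given by one formula that serves all sizes: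
  \<open>J\<close> couples the indices \<open>2 * q\<close> and \<open>2 * q + 1\<close>.\<close>

definition jform :: "nat \<Rightarrow> nat \<Rightarrow> real" where
  "jform i j = (if even i \<and> j = Suc i then 1 else if odd i \<and> i = Suc j then - 1 else 0)"

lemma jform_swap: "jform j i = - jform i j"
  by (auto simp: jform_def)

lemma sum_jform:
  fixes z :: "nat \<Rightarrow> real"
  assumes "i < 2 * m"
  shows "(\<Sum>j<2 * m. jform i j * z j) = (if even i then z (Suc i) else - z (i - 1))"
proof -
  let ?j = "if even i then Suc i else i - 1"
  have "?j < 2 * m" using assms by (auto elim!: evenE)
  then have "(\<Sum>j<2 * m. jform i j * z j) = (\<Sum>j\<in>{?j}. jform i j * z j)"
    by (intro sum.mono_neutral_right) (auto simp: jform_def split: if_splits)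
  then show ?thesis by (auto simp: jform_def elim!: oddE)
qed

lemma bform_jform_swap: "bform jform N y x = - bform jform N x y"
proof -
  have "bform jform N y x = (\<Sum>j<N. \<Sum>i<N. y i * jform i j * x j)"
    unfolding bform_def by (rule sum.swap)
  also have "\<dots> = (\<Sum>j<N. \<Sum>i<N. - (x j * jform j i * y i))"
  proof (intro sum.cong refl)
    show "y i * jform i j * x j = - (x j * jform j i * y i)" for i j
      unfolding jform_swap[of i j] by simp
  qed
  finally show ?thesis by (simp add: bform_def sum_negf)
qed

text \<open>The witness \<open>?z\<close> is \<open>- J x\<close>; then \<open>J ?z = x\<close>, and
  the form becomes the sum of the squares of \<open>x\<close>.\<close>

lemma jform_nondegenerate:
  assumes "i < 2 * m" "x i \<noteq> 0" shows "\<exists>z. bform jform (2 * m) x z > 0"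
proof -
  let ?z = "\<lambda>j. if even j then - x (Suc j) else x (j - 1)"
  have "bform jform (2 * m) x ?z = (\<Sum>i<2 * m. x i * (\<Sum>j<2 * m. jform i j * ?z j))"
    by (simp add: bform_def sum_distrib_left mult.assoc)
  also have "\<dots> = (\<Sum>i<2 * m. (x i)\<^sup>2)"
    by (intro sum.cong refl) (auto simp: sum_jform power2_eq_square elim!: oddE)
  also have "\<dots> > 0" using assms by (intro sum_pos2[of _ i]) auto
  finally show ?thesis by blast
qed

text \<open>Since \<open>r < N\<close>, the last row of an \<open>N \<times> N\<close> matrix
  carries none of the equations. Making it zero kills the determinant, and a kernel vector solves
  the system.\<close>

lemma underdetermined_system:
  fixes R :: "nat \<Rightarrow> nat \<Rightarrow> real"
  assumes "r < N"
  shows "\<exists>z. (\<exists>i<N. z i \<noteq> 0) \<and> (\<forall>i<r. (\<Sum>j<N. R i j * z j) = 0)"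
proof -
  let ?A = "mat\<^sub>r N N (\<lambda>i. if i = N - 1 then 0\<^sub>v N else vec N (R i))"
  have A: "?A \<in> carrier_mat N N" by simp
  have "Determinant.det ?A = 0" using assms by (intro det_row_0) auto
  then obtain v where v: "v \<in> carrier_vec N" "v \<noteq> 0\<^sub>v N" "?A *\<^sub>v v = 0\<^sub>v N"
    using det_0_iff_vec_prod_zero_field[OF A] by blast
  have "\<exists>i<N. v $ i \<noteq> 0" using v(1,2) by (metis eq_vecI carrier_vecD index_zero_vec)
  moreover have "(\<Sum>j<N. R i j * v $ j) = 0" if "i < r" for i
  proof -
    have "(?A *\<^sub>v v) $ i = (\<Sum>j<N. R i j * v $ j)"
      using that assms v(1) by (simp add: scalar_prod_def lessThan_atLeast0)
    moreover have "(?A *\<^sub>v v) $ i = 0" unfolding v(3) using that assms by simp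
    ultimately show ?thesis by simp
  qed
  ultimately show ?thesis by blast
qed

text \<open>A cube of dimension \<open>N\<close> inside the space of sequences, with the other
  coordinates pinned to 0; compactness is Tychonoff's theorem.\<close>

lemma compact_finite_support_box:
  "compact {u :: nat \<Rightarrow> real. (\<forall>i<N. \<bar>u i\<bar> \<le> 1) \<and> (\<forall>i\<ge>N. u i = 0)}"
proof -
  let ?S = "\<lambda>i. if i < N then {-1..1::real} else {0}"
  have "compactin (product_topology (\<lambda>_. euclidean) UNIV) (PiE UNIV ?S)"
    unfolding compactin_PiE by auto
  then have "compact (PiE UNIV ?S)" unfolding euclidean_product_topology compactin_euclidean_iff .
  also have "PiE UNIV ?S = {u. (\<forall>i<N. \<bar>u i\<bar> \<le> 1) \<and> (\<forall>i\<ge>N. u i = 0)}"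
    by (auto simp: PiE_iff abs_le_iff minus_le_iff split: if_splits)
  finally show ?thesis .
qed

text \<open>Here \<open>b\<close> is an inner product and \<open>w\<close> the symplectic form on
  the same space. Williamson's theorem amounts to a basis that is orthogonal for \<open>b\<close>
  and standard for \<open>w\<close>.\<close>

locale posdef_form =
  fixes B :: "nat \<Rightarrow> nat \<Rightarrow> real" and m :: nat
  assumes sym: "\<And>i j. i < 2 * m \<Longrightarrow> j < 2 * m \<Longrightarrow> B i j = B j i"
    and pos: "\<And>x i. i < 2 * m \<Longrightarrow> x i \<noteq> 0 \<Longrightarrow> bform B (2 * m) x x > 0"
begin

abbreviation b where "b \<equiv> bform B (2 * m)"
abbreviation w where "w \<equiv> bform jform (2 * m)"

lemma b_sym: "b x y = b y x"
proof -
  have "b x y = (\<Sum>j<2*m. \<Sum>i<2*m. x i * B i j * y j)" unfolding bform_def by (rule sum.swap)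
  also have "\<dots> = b y x" unfolding bform_def by (intro sum.cong refl) (simp add: sym mult_ac)
  finally show ?thesis .
qed

lemma b_nonneg: "b x x \<ge> 0"
proof (cases "\<exists>i<2 * m. x i \<noteq> 0")
  case True
  then show ?thesis using pos by (metis less_imp_le)
next
  case False
  then show ?thesis by (auto simp: bform_def)
qed

definition orthogonal_to :: "nat \<Rightarrow> (nat \<Rightarrow> nat \<Rightarrow> real) \<Rightarrow> (nat \<Rightarrow> real) set" where
  "orthogonal_to n p = {z. \<forall>i<n. b (p i) z = 0}"

lemma orthogonal_to_scale: "z \<in> orthogonal_to n p \<Longrightarrow> (\<lambda>i. c * z i) \<in> orthogonal_to n p"
  by (simp add: orthogonal_to_def bform_right_scale)

lemma orthogonal_to_add:
  "z \<in> orthogonal_to n p \<Longrightarrow> y \<in> orthogonal_to n p \<Longrightarrow> (\<lambda>i. z i + y i) \<in> orthogonal_to n p"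
  by (simp add: orthogonal_to_def bform_right_add)

text \<open>The quotient is maximized over the Euclidean unit sphere of the subspace, where compactness is
  available, and then extended to the whole subspace by homogeneity.\<close>

lemma maximizer_exists:
  assumes z0: "z0 \<in> orthogonal_to n p" "i0 < 2 * m" "z0 i0 \<noteq> 0"
  shows "\<exists>u v. u \<in> orthogonal_to n p \<and> v \<in> orthogonal_to n p \<and> b u u = 1 \<and> b v v = 1 \<and>
    (\<forall>u' v'. u' \<in> orthogonal_to n p \<longrightarrow> v' \<in> orthogonal_to n p \<longrightarrow>
       w u' v' \<le> w u v * sqrt (b u' u') * sqrt (b v' v'))"
proof -
  let ?V = "orthogonal_to n p" and ?N = "2 * m"
  \<comment> \<open>The forms see only the first \<open>2 * m\<close> coordinates. Setting the
    others to 0 is what makes the sphere compact in the space of sequences.\<close>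
  define K where "K = {u :: nat \<Rightarrow> real. (\<forall>i<?N. \<bar>u i\<bar> \<le> 1) \<and> (\<forall>i\<ge>?N. u i = 0)}"
  define S where "S = K \<inter> {u. (\<Sum>i<?N. (u i)\<^sup>2) = 1} \<inter> (\<Inter>i\<in>{..<n}. {u. b (p i) u = 0})"
  have coord: "continuous_on UNIV (\<lambda>u :: nat \<Rightarrow> real. u i)" for i
    by (rule continuous_on_product_coordinates)
  have "closed (\<Inter>i\<in>{..<n}. {u. b (p i) u = 0})"
    by (intro closed_INT ballI closed_Collect_eq continuous_on_bform coord continuous_on_const)
  moreover have "closed {u :: nat \<Rightarrow> real. (\<Sum>i<?N. (u i)\<^sup>2) = 1}"
    by (intro closed_Collect_eq continuous_intros coord)
  ultimately have cS: "compact S"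
    unfolding S_def K_def by (intro compact_Int_closed compact_finite_support_box)
  have S_V: "S \<subseteq> ?V" by (auto simp: S_def orthogonal_to_def)
  have S_pos: "b u u > 0" if "u \<in> S" for u
  proof -
    have "\<exists>i<?N. u i \<noteq> 0"
    proof (rule ccontr)
      assume "\<not> (\<exists>i<?N. u i \<noteq> 0)"
      then have "(\<Sum>i<?N. (u i)\<^sup>2) = 0" by simp
      then show False using that by (simp add: S_def)
    qed
    then show ?thesis using pos by blast
  qed
  have scaled: "\<exists>c>0. \<exists>u\<in>S. \<forall>i<?N. z i = c * u i" if z: "z \<in> ?V" "i < ?N" "z i \<noteq> 0" for z i
  proof -
    define c where "c = sqrt (\<Sum>i<?N. (z i)\<^sup>2)"
    define u where "u i = (if i < ?N then z i / c else 0)" for i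
    have "(\<Sum>i<?N. (z i)\<^sup>2) > 0" using z by (intro sum_pos2[of _ i]) auto
    then have c: "c > 0" "c\<^sup>2 = (\<Sum>i<?N. (z i)\<^sup>2)" by (auto simp: c_def)
    have u1: "(\<Sum>i<?N. (u i)\<^sup>2) = 1"
      using c(1) by (simp add: u_def power_divide c(2)[symmetric] flip: sum_divide_distrib)
    moreover have "u \<in> K"
    proof -
      have "\<bar>u i\<bar> \<le> 1" if "i < ?N" for i
      proof -
        have "(u i)\<^sup>2 \<le> (\<Sum>i<?N. (u i)\<^sup>2)" using that by (intro member_le_sum) auto
        then show ?thesis unfolding u1 by (simp add: abs_square_le_1)
      qed
      then show ?thesis by (auto simp: K_def u_def)
    qed
    moreover have "b (p i) u = 0" if "i < n" for i
    proof -
      have "b (p i) u = b (p i) (\<lambda>j. 1 / c * z j)" by (intro bform_cong) (auto simp: u_def)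
      then show ?thesis using z(1) that by (simp only: bform_right_scale) (simp add: orthogonal_to_def)
    qed
    ultimately have "u \<in> S" by (auto simp: S_def)
    moreover have "\<forall>i<?N. z i = c * u i" using c by (auto simp: u_def)
    ultimately show ?thesis using c by blast
  qed
  define F where "F q = w (fst q) (snd q) / (sqrt (b (fst q) (fst q)) * sqrt (b (snd q) (snd q)))" for q
  have cf: "continuous_on T (\<lambda>q. fst q i)" "continuous_on T (\<lambda>q. snd q i)"
    for T :: "((nat \<Rightarrow> real) \<times> (nat \<Rightarrow> real)) set" and i
    by (intro continuous_on_compose2[OF coord] continuous_intros subset_UNIV)+
  have "continuous_on (S \<times> S) F"
    unfolding F_def using S_pos
    by (intro continuous_intros continuous_on_bform cf) force
  moreover have "S \<times> S \<noteq> {}" using scaled[OF z0] by auto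
  moreover have "compact (S \<times> S)" by (intro compact_Times cS)
  ultimately obtain q where q: "q \<in> S \<times> S" "\<And>q'. q' \<in> S \<times> S \<Longrightarrow> F q' \<le> F q"
    using continuous_attains_sup by meson
  obtain u v where uv: "q = (u, v)" "u \<in> S" "v \<in> S" using q(1) by auto
  let ?u = "\<lambda>i. (1 / sqrt (b u u)) * u i" and ?v = "\<lambda>i. (1 / sqrt (b v v)) * v i"
  have bb: "b (\<lambda>i. 1 / sqrt (b u u) * u i) (\<lambda>i. 1 / sqrt (b u u) * u i) = 1" if "u \<in> S" for u
    using S_pos[OF that] by (simp only: bform_left_scale bform_right_scale) simp
  have wF: "w ?u ?v = F q"
    by (simp only: bform_left_scale bform_right_scale) (simp add: uv F_def)
  have "w u' v' \<le> F q * sqrt (b u' u') * sqrt (b v' v')" if V: "u' \<in> ?V" "v' \<in> ?V" for u' v'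
  proof (cases "(\<exists>i<?N. u' i \<noteq> 0) \<and> (\<exists>i<?N. v' i \<noteq> 0)")
    case True
    then obtain c d f g where cd: "c > 0" "d > 0" "f \<in> S" "g \<in> S" "\<And>i. i < ?N \<Longrightarrow> u' i = c * f i"
        "\<And>i. i < ?N \<Longrightarrow> v' i = d * g i"
      using scaled[OF V(1)] scaled[OF V(2)] by metis
    have w': "w u' v' = c * (d * w f g)"
      using bform_cong[of ?N u' "\<lambda>i. c * f i" v' "\<lambda>i. d * g i" jform] cd
      by (simp add: bform_left_scale bform_right_scale)
    have bu: "b u' u' = c * (c * b f f)"
      using bform_cong[of ?N u' "\<lambda>i. c * f i" u' "\<lambda>i. c * f i" B] cd
      by (simp add: bform_left_scale bform_right_scale)
    have bv: "b v' v' = d * (d * b g g)"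
      using bform_cong[of ?N v' "\<lambda>i. d * g i" v' "\<lambda>i. d * g i" B] cd
      by (simp add: bform_left_scale bform_right_scale)
    have "w f g / (sqrt (b f f) * sqrt (b g g)) \<le> F q"
      using q(2)[of "(f, g)"] cd by (simp add: F_def)
    moreover have p: "sqrt (b f f) * sqrt (b g g) > 0" using cd S_pos by simp
    ultimately have "w f g \<le> F q * (sqrt (b f f) * sqrt (b g g))" by (simp add: divide_le_eq)
    then have "c * d * w f g \<le> c * d * (F q * (sqrt (b f f) * sqrt (b g g)))"
      using cd by (intro mult_left_mono) auto
    moreover have "sqrt (b u' u') = c * sqrt (b f f)" "sqrt (b v' v') = d * sqrt (b g g)"
      unfolding bu bv using cd by (simp_all add: real_sqrt_mult flip: mult.assoc)
    ultimately show ?thesis unfolding w' by (simp only: mult_ac)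
  next
    case False
    then have "w u' v' = 0" "b u' u' = 0 \<or> b v' v' = 0" by (auto simp: bform_def)
    then show ?thesis by auto
  qed
  moreover have "?u \<in> ?V" "?v \<in> ?V" using uv(2,3) S_V by (blast intro: orthogonal_to_scale)+
  ultimately show ?thesis
    using bb[OF uv(2)] bb[OF uv(3)] unfolding wF[symmetric] by blast
qed

text \<open>First-order condition at a maximum: compare \<open>v\<close> with \<open>v + t y\<close> for \<open>y\<close> orthogonal to \<open>v\<close>.\<close>

lemma maximizer_stationary:
  assumes uv: "u \<in> orthogonal_to n p" "v \<in> orthogonal_to n p" "b v v = 1"
    and l: "r > 0" "w u v = r"
    and max: "\<And>v'. v' \<in> orthogonal_to n p \<Longrightarrow> w u v' \<le> r * sqrt (b v' v')"
    and z: "z \<in> orthogonal_to n p"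
  shows "w u z = r * b v z"
proof -
  define y where "y = (\<lambda>i. z i + (- b v z) * v i)"
  define c where "c = w u y"
  define q where "q = b y y"
  have y: "y \<in> orthogonal_to n p" unfolding y_def by (intro orthogonal_to_add z orthogonal_to_scale uv)
  have vy: "b v y = 0" using uv by (simp only: y_def bform_right_add bform_right_scale)
  have q: "q \<ge> 0" unfolding q_def by (rule b_nonneg)
  \<comment> \<open>Concavity of the square root bounds the length of \<open>v + t y\<close> by
    \<open>1 + t\<^sup>2 * q / 2\<close>: the gain is linear in \<open>t\<close>, the cost
    quadratic.\<close>
  have key: "t * c \<le> r * (t\<^sup>2 * q / 2)" for t
  proof -
    let ?v = "\<lambda>i. v i + t * y i"
    have "?v \<in> orthogonal_to n p" by (intro orthogonal_to_add y orthogonal_to_scale uv)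
    from max[OF this] have "r + t * c \<le> r * sqrt (b ?v ?v)"
      by (simp add: bform_right_add bform_right_scale l c_def)
    also have "b ?v ?v = 1 + t\<^sup>2 * q"
      using uv vy b_sym[of y v]
      by (simp add: bform_right_add bform_right_scale bform_left_add bform_left_scale q_def power2_eq_square)
    also have "sqrt (1 + t\<^sup>2 * q) \<le> 1 + t\<^sup>2 * q / 2"
    proof (rule real_le_lsqrt)
      show "1 + s \<le> (1 + s / 2)\<^sup>2" for s :: real by (simp add: power2_sum power_divide)
    qed (use q in auto)
    finally show ?thesis using l by (simp add: algebra_simps)
  qed
  have "c = 0"
  proof (rule ccontr)
    assume c: "c \<noteq> 0"
    \<comment> \<open>With \<open>t = e * c\<close> the estimate \<open>key\<close> becomes
      \<open>e * c\<^sup>2 \<le> e * c\<^sup>2 * (e * r * q / 2)\<close>; this \<open>e\<close>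
      makes \<open>e * r * q\<close> less than 1.\<close>
    define e where "e = 1 / (r * q + 1)"
    have lq: "r * q \<ge> 0" using l q by simp
    then have e: "e > 0" by (simp add: e_def)
    have "e * c\<^sup>2 \<le> e * c\<^sup>2 * (e * (r * q) / 2)"
      using key[of "e * c"] by (simp add: power2_eq_square algebra_simps)
    then have "1 \<le> e * (r * q) / 2" using c e by (simp add: mult_le_cancel_left1)
    moreover have "e * (r * q) < 1" using lq by (simp add: e_def)
    ultimately show False by simp
  qed
  then have "w u z + (- b v z) * w u v = 0"
    unfolding c_def y_def by (simp only: bform_right_add bform_right_scale)
  then show ?thesis using l by simp
qed

text \<open>The last condition says that no pair of vectors in the complement could yield a symplectic
  eigenvalue smaller than those already found; this makes the resulting list sorted.\<close>

definition williamson_pairs :: "nat \<Rightarrow> (nat \<Rightarrow> nat \<Rightarrow> real) \<Rightarrow> (nat \<Rightarrow> real) \<Rightarrow> bool" where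
  "williamson_pairs n p d \<longleftrightarrow>
     (\<forall>i<n. d i > 0) \<and> (\<forall>i<n. \<forall>j<n. i \<le> j \<longrightarrow> d i \<le> d j) \<and>
     (\<forall>i<2*n. \<forall>j<2*n. b (p i) (p j) = (if i = j then d (i div 2) else 0)) \<and>
     (\<forall>i<2*n. \<forall>j<2*n. w (p i) (p j) = jform i j) \<and>
     (\<forall>z\<in>orthogonal_to (2*n) p. \<forall>i<2*n. w (p i) z = 0) \<and>
     (\<forall>u\<in>orthogonal_to (2*n) p. \<forall>v\<in>orthogonal_to (2*n) p. b u u = 1 \<longrightarrow> b v v = 1 \<longrightarrow>
        (\<forall>i<n. d i * w u v \<le> 1))"

text \<open>For a maximizing pair with value \<open>l\<close>, stationarity says that on the
  complement \<open>w u\<close> is \<open>l\<close> times \<open>b v\<close>, and \<open>w v\<close>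
  is \<open>- l\<close> times \<open>b u\<close>. A vector that is \<open>b\<close>-orthogonal to
  both is therefore also \<open>w\<close>-orthogonal to both, so the complement splits. The new
  eigenvalue is \<open>1 / l\<close>: as \<open>l\<close> is the largest value of \<open>w\<close>
  on unit vectors, those found later cannot be smaller.\<close>

lemma williamson_pairs_Suc:
  assumes P: "williamson_pairs n p d" and n: "n < m"
  shows "\<exists>p d. williamson_pairs (Suc n) p d"
proof -
  let ?V = "orthogonal_to (2 * n) p"
  note P' = P[unfolded williamson_pairs_def]
  have d0: "d i > 0" if "i < n" for i using P' that by blast
  have dmono: "d i \<le> d j" if "i \<le> j" "j < n" for i j using P' that by (meson le_less_trans)
  have bp: "b (p i) (p j) = (if i = j then d (i div 2) else 0)" if "i < 2*n" "j < 2*n" for i j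
    using P' that by blast
  have wp: "w (p i) (p j) = jform i j" if "i < 2*n" "j < 2*n" for i j using P' that by blast
  have wV: "w (p i) z = 0" if "z \<in> ?V" "i < 2*n" for z i using P' that by blast
  have dw: "d i * w u v \<le> 1" if "u \<in> ?V" "v \<in> ?V" "b u u = 1" "b v v = 1" "i < n" for u v i
    using P' that by blast
  have bV: "b (p i) z = 0" if "z \<in> ?V" "i < 2*n" for z i using that by (simp add: orthogonal_to_def)
  \<comment> \<open>Only \<open>2 * n < 2 * m\<close> linear conditions are imposed, so the
    complement contains a nonzero vector.\<close>
  obtain z0 i0 where z0: "i0 < 2 * m" "z0 i0 \<noteq> 0" "\<And>i. i < 2 * n \<Longrightarrow> (\<Sum>j<2*m. (\<Sum>k<2*m. p i k * B k j) * z0 j) = 0"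
    using underdetermined_system[of "2*n" "2*m" "\<lambda>i j. \<Sum>k<2*m. p i k * B k j"] n by auto
  have "b (p i) z = (\<Sum>j<2*m. (\<Sum>k<2*m. p i k * B k j) * z j)" for i z
    unfolding bform_def by (subst sum.swap) (simp add: sum_distrib_right)
  then have z0V: "z0 \<in> ?V" using z0(3) by (simp add: orthogonal_to_def)
  from maximizer_exists[OF z0V z0(1,2)] obtain u v where u: "u \<in> ?V" "b u u = 1"
    and v: "v \<in> ?V" "b v v = 1"
    and max: "\<And>u' v'. u' \<in> ?V \<Longrightarrow> v' \<in> ?V \<Longrightarrow> w u' v' \<le> w u v * sqrt (b u' u') * sqrt (b v' v')"
    by blast
  define l where "l = w u v"
  have l: "l > 0"
  proof -
    obtain z where z: "w z0 z > 0" using jform_nondegenerate[of i0 m z0] z0 by blast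
    \<comment> \<open>The \<open>b\<close>-orthogonal projection of \<open>z\<close> to the
      complement. The removed components lie along the \<open>p i\<close>, which are
      \<open>w\<close>-orthogonal to \<open>z0\<close>, so \<open>w z0 y\<close> is still
      positive.\<close>
    define y where "y = (\<lambda>j. z j - (\<Sum>i<2*n. b (p i) z / d (i div 2) * p i j))"
    have "y \<in> ?V"
    proof -
      have "b (p k) y = 0" if k: "k < 2 * n" for k
      proof -
        have k2: "k div 2 < n" using k by linarith
        have "b (p k) y = b (p k) z - (\<Sum>i<2*n. b (p i) z / d (i div 2) * b (p k) (p i))"
          unfolding y_def by (simp only: bform_right_diff bform_right_sum bform_right_scale)
        also have "(\<Sum>i<2*n. b (p i) z / d (i div 2) * b (p k) (p i)) =
            (\<Sum>i<2*n. if i = k then b (p k) z else 0)"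
        proof (intro sum.cong refl)
          fix i assume "i \<in> {..<2*n}"
          then show "b (p i) z / d (i div 2) * b (p k) (p i) = (if i = k then b (p k) z else 0)"
            using bp[OF k, of i] d0[OF k2] k by (cases "i = k") auto
        qed
        finally show ?thesis using k by simp
      qed
      then show ?thesis by (simp add: orthogonal_to_def)
    qed
    moreover have "w z0 y = w z0 z"
    proof -
      have "w z0 y = w z0 z - (\<Sum>i<2*n. b (p i) z / d (i div 2) * w z0 (p i))"
        unfolding y_def by (simp only: bform_right_diff bform_right_sum bform_right_scale)
      also have "(\<Sum>i<2*n. b (p i) z / d (i div 2) * w z0 (p i)) = 0"
        using wV[OF z0V] by (intro sum.neutral) (auto simp: bform_jform_swap[of _ z0])
      finally show ?thesis by simp
    qed
    ultimately have "w z0 z \<le> l * (sqrt (b z0 z0) * sqrt (b y y))" using max[OF z0V, of y] by (simp add: l_def mult.assoc)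
    moreover have "sqrt (b z0 z0) * sqrt (b y y) \<ge> 0" by (simp add: b_nonneg)
    ultimately show ?thesis using z by (metis less_le_trans mult_nonpos_nonneg not_le)
  qed
  have uz: "w u z = l * b v z" if "z \<in> ?V" for z
    using max[OF u(1)] u v l that by (intro maximizer_stationary[of u "2*n" p]) (auto simp: l_def)
  have vz: "w v z = - (l * b u z)" if z: "z \<in> ?V" for z
  proof -
    \<comment> \<open>By antisymmetry \<open>w v (- u) = w u v\<close>, so \<open>v\<close> and
      \<open>- u\<close> form another maximizing pair.\<close>
    let ?u = "\<lambda>i. - 1 * u i"
    have "w v z = l * b ?u z"
    proof (rule maximizer_stationary[of v "2*n" p])
      show "?u \<in> ?V" by (rule orthogonal_to_scale[OF u(1)])
      show "b ?u ?u = 1" using u by (simp only: bform_left_scale bform_right_scale)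
      show "w v ?u = l" unfolding bform_right_scale using bform_jform_swap[of _ v u] by (simp add: l_def)
      show "w v v' \<le> l * sqrt (b v' v')" if "v' \<in> ?V" for v'
        using max[OF v(1) that] v by (simp add: l_def)
    qed (use v l z in auto)
    then show ?thesis by (simp only: bform_left_scale)
  qed
  have ww: "w x x = 0" for x using bform_jform_swap[of "2*m" x x] by simp
  have uv0: "b u v = 0" using uz[OF u(1)] ww[of u] l b_sym[of u v] by simp
  \<comment> \<open>The scaling is dictated by \<open>w x y = s\<^sup>2 * l = 1\<close>; it forces
    \<open>b x x = b y y = 1 / l\<close>.\<close>
  define s where "s = 1 / sqrt l"
  have s0: "s \<noteq> 0" using l by (simp add: s_def)
  have s2: "s * s = 1 / l" using l by (simp add: s_def)
  define x where "x = (\<lambda>i. s * u i)"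
  define y where "y = (\<lambda>i. s * v i)"
  have xV: "x \<in> ?V" and yV: "y \<in> ?V" unfolding x_def y_def by (intro orthogonal_to_scale u v)+
  have bx: "b x x = 1 / l" "b y y = 1 / l" "b x y = 0" "b y x = 0"
    using u v uv0 b_sym[of u v] s2
    by (simp_all add: x_def y_def bform_left_scale bform_right_scale flip: mult.assoc)
  have wx: "w x y = 1" "w y x = - 1" "w x x = 0" "w y y = 0"
    using ww l s2 bform_jform_swap[of _ v u]
    by (simp_all add: x_def y_def bform_left_scale bform_right_scale l_def flip: mult.assoc)
  define p' where "p' = (\<lambda>i. if i < 2*n then p i else if i = 2*n then x else y)"
  define d' where "d' = d (n := 1 / l)"
  have p'1: "p' i = p i" if "i < 2*n" for i using that by (simp add: p'_def)
  have p'2: "p' (2*n) = x" "p' (Suc (2*n)) = y" by (auto simp: p'_def)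
  have V': "z \<in> ?V" "b x z = 0" "b y z = 0" if z: "z \<in> orthogonal_to (2 * Suc n) p'" for z
  proof -
    have *: "b (p' i) z = 0" if "i < 2 * Suc n" for i using z that by (simp add: orthogonal_to_def)
    show "b x z = 0" "b y z = 0" using *[of "2*n"] *[of "Suc (2*n)"] by (simp_all add: p'2)
    show "z \<in> ?V" using *  by (auto simp: orthogonal_to_def p'1[symmetric])
  qed
  have cases: "i < 2*n \<or> i = 2*n \<or> i = Suc (2*n)" if "i < 2 * Suc n" for i using that by auto
  have "williamson_pairs (Suc n) p' d'"
    unfolding williamson_pairs_def
  proof (intro conjI allI impI ballI)
    show "d' i > 0" if "i < Suc n" for i using that d0 l by (auto simp: d'_def less_Suc_eq)
    \<comment> \<open>The last clause of the invariant, applied to the maximizing pair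
      itself.\<close>
    have dl: "d i \<le> 1 / l" if "i < n" for i
      using dw[OF u(1) v(1) u(2) v(2) that] l by (simp add: l_def pos_le_divide_eq)
    show "d' i \<le> d' j" if "i < Suc n" "j < Suc n" "i \<le> j" for i j
      using that dmono[of i j] dl[of i] by (auto simp: d'_def less_Suc_eq)
    show "b (p' i) (p' j) = (if i = j then d' (i div 2) else 0)" if "i < 2 * Suc n" "j < 2 * Suc n" for i j
    proof -
      have 1: "b (p i) x = 0" "b (p i) y = 0" "b x (p i) = 0" "b y (p i) = 0" if "i < 2*n" for i
        using bV[OF xV that] bV[OF yV that] b_sym by metis+
      show ?thesis
        using cases[OF that(1)] cases[OF that(2)]
        by (elim disjE) (auto simp: p'1 p'2 1 bx bp d'_def)
    qed
    show "w (p' i) (p' j) = jform i j" if "i < 2 * Suc n" "j < 2 * Suc n" for i j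
    proof -
      have 1: "w (p i) x = 0" "w (p i) y = 0" if "i < 2*n" for i
        using wV[OF xV that] wV[OF yV that] by auto
      have 2: "w x (p i) = 0" "w y (p i) = 0" if "i < 2*n" for i
        using 1[OF that] bform_jform_swap[of "2*m" x "p i"] bform_jform_swap[of "2*m" y "p i"] by auto
      have 3: "jform i (2*n) = 0" "jform i (Suc (2*n)) = 0" "jform (2*n) i = 0" "jform (Suc (2*n)) i = 0"
        if "i < 2*n" for i using that by (auto simp: jform_def; presburger)+
      have 4: "jform (2*n) (2*n) = 0" "jform (2*n) (Suc (2*n)) = 1" "jform (Suc (2*n)) (2*n) = - 1"
        "jform (Suc (2*n)) (Suc (2*n)) = 0" by (auto simp: jform_def)
      show ?thesis
        using cases[OF that(1)] cases[OF that(2)]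
        by (elim disjE) (simp_all add: p'1 p'2 1 2 3 4 wx wp)
    qed
    show "w (p' i) z = 0" if z: "z \<in> orthogonal_to (2 * Suc n) p'" and i: "i < 2 * Suc n" for z i
    proof -
      have "b u z = 0" "b v z = 0"
        using V'(2,3)[OF z] s0 by (auto simp: x_def y_def bform_left_scale)
      then have "w x z = 0" "w y z = 0"
        using uz[OF V'(1)[OF z]] vz[OF V'(1)[OF z]] by (auto simp: x_def y_def bform_left_scale)
      then show ?thesis using cases[OF i] wV[OF V'(1)[OF z]] by (elim disjE) (auto simp: p'1 p'2)
    qed
    show "d' i * w u' v' \<le> 1" if uv': "u' \<in> orthogonal_to (2 * Suc n) p'" "v' \<in> orthogonal_to (2 * Suc n) p'"
      "b u' u' = 1" "b v' v' = 1" "i < Suc n" for u' v' i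
    proof (cases "i = n")
      case True
      have "w u' v' \<le> l" using max[OF V'(1)[OF uv'(1)] V'(1)[OF uv'(2)]] uv' by (simp add: l_def)
      then show ?thesis using l True by (simp add: d'_def)
    next
      case False
      then show ?thesis using dw[OF V'(1)[OF uv'(1)] V'(1)[OF uv'(2)]] uv' by (simp add: d'_def)
    qed
  qed
  then show ?thesis by blast
qed

lemma williamson_pairs_exist: "n \<le> m \<Longrightarrow> \<exists>p d. williamson_pairs n p d"
proof (induction n)
  case 0
  show ?case by (intro exI[of _ undefined]) (simp add: williamson_pairs_def)
next
  case (Suc n)
  then show ?case using williamson_pairs_Suc[of n] by auto
qed

end

section \<open>Symplectic eigenvalues\<close>

lemma diag_block_mat_index:
  assumes "\<And>d. d \<in> set ds \<Longrightarrow> f d \<in> carrier_mat 2 2"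
  shows "diag_block_mat (map f ds) \<in> carrier_mat (2 * length ds) (2 * length ds) \<and>
    (\<forall>i<2 * length ds. \<forall>j<2 * length ds. diag_block_mat (map f ds) $$ (i, j) =
      (if i div 2 = j div 2 then f (ds ! (i div 2)) $$ (i mod 2, j mod 2) else 0))"
  using assms
proof (induction ds)
  case (Cons d ds)
  have fd: "f d \<in> carrier_mat 2 2" using Cons.prems by simp
  let ?D = "diag_block_mat (map f ds)"
  have IH: "?D \<in> carrier_mat (2 * length ds) (2 * length ds)"
    "\<And>i j. i < 2 * length ds \<Longrightarrow> j < 2 * length ds \<Longrightarrow> ?D $$ (i, j) =
      (if i div 2 = j div 2 then f (ds ! (i div 2)) $$ (i mod 2, j mod 2) else 0)"
    using Cons by auto
  have "diag_block_mat (map f (d # ds)) $$ (i, j) =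
      (if i div 2 = j div 2 then f ((d # ds) ! (i div 2)) $$ (i mod 2, j mod 2) else 0)"
    if ij: "i < 2 * length (d # ds)" "j < 2 * length (d # ds)" for i j
  proof -
    have small: "k div 2 = 0" "k mod 2 = k" if "k < 2" for k :: nat using that by auto
    have large: "k div 2 = Suc ((k - 2) div 2)" "k mod 2 = (k - 2) mod 2" if "\<not> k < 2" for k :: nat
      using that by (simp_all add: le_div_geq le_mod_geq)
    have "diag_block_mat (map f (d # ds)) $$ (i, j) =
        (if i < 2 then if j < 2 then f d $$ (i, j) else 0 else if j < 2 then 0 else ?D $$ (i - 2, j - 2))"
      using ij fd IH(1) by (auto simp: Let_def)
    then show ?thesis
      using ij IH(2)[of "i - 2" "j - 2"] small[of i] small[of j] large[of i] large[of j] by auto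
  qed
  moreover have "diag_block_mat (map f (d # ds)) \<in> carrier_mat (2 * length (d # ds)) (2 * length (d # ds))"
  proof -
    have "diag_block_mat (map f (d # ds)) \<in> carrier_mat (2 + 2 * length ds) (2 + 2 * length ds)"
      unfolding list.map diag_block_mat.simps Let_def by (intro four_block_carrier_mat fd IH(1))
    then show ?thesis by simp
  qed
  ultimately show ?case by blast
qed simp

lemma J_mat_carrier [simp]: "J_mat m \<in> carrier_mat (2 * m) (2 * m)"
  and J_mat_index [simp]: "i < 2 * m \<Longrightarrow> j < 2 * m \<Longrightarrow> J_mat m $$ (i, j) = jform i j"
proof -
  have J2: "J2 \<in> carrier_mat 2 2" unfolding J2_def mat_of_rows_list_def carrier_mat_def by simp
  have e: "J2 $$ (i mod 2, j mod 2) = jform i j" if "i div 2 = j div 2" for i j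
  proof -
    define q r t where "q = j div 2" and "r = i mod 2" and "t = j mod 2"
    have ij: "i = 2 * q + r" "j = 2 * q + t" using that unfolding q_def r_def t_def by presburger+
    have "r = 0 \<or> r = 1" "t = 0 \<or> t = 1" unfolding r_def t_def by auto
    then show ?thesis unfolding ij
      by (elim disjE) (simp_all add: J2_def mat_of_rows_list_def jform_def)
  qed
  have z: "jform i j = 0" if "i div 2 \<noteq> j div 2" for i j
    using that by (auto simp: jform_def)
  have r: "J_mat m = diag_block_mat (map (\<lambda>_. J2) [0..<m])"
    by (simp add: J_mat_def map_replicate_const)
  show "J_mat m \<in> carrier_mat (2 * m) (2 * m)"
    unfolding r using diag_block_mat_index[of "[0..<m]" "\<lambda>_. J2"] J2 by simp
  show "i < 2 * m \<Longrightarrow> j < 2 * m \<Longrightarrow> J_mat m $$ (i, j) = jform i j"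
    unfolding r using diag_block_mat_index[of "[0..<m]" "\<lambda>_. J2"] J2 e z by simp
qed

lemma J_mat_dim [simp]: "dim_row (J_mat m) = 2 * m" "dim_col (J_mat m) = 2 * m"
  using carrier_matD[OF J_mat_carrier] by simp_all

definition williamson_diag :: "real list \<Rightarrow> real mat" where
  "williamson_diag ds = diag_block_mat (map (\<lambda>d. d \<cdot>\<^sub>m 1\<^sub>m 2) ds)"

lemma williamson_diag_carrier [simp]:
    "williamson_diag ds \<in> carrier_mat (2 * length ds) (2 * length ds)"
  and williamson_diag_index [simp]: "i < 2 * length ds \<Longrightarrow> j < 2 * length ds \<Longrightarrow>
    williamson_diag ds $$ (i, j) = (if i = j then ds ! (i div 2) else 0)"
proof -
  note * = diag_block_mat_index[of ds "\<lambda>d. d \<cdot>\<^sub>m 1\<^sub>m 2"]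
  show "williamson_diag ds \<in> carrier_mat (2 * length ds) (2 * length ds)"
    unfolding williamson_diag_def using * by simp
  assume "i < 2 * length ds" "j < 2 * length ds"
  moreover have "i = j" if "i div 2 = j div 2" "i mod 2 = j mod 2" using that by (metis div_mult_mod_eq)
  ultimately show "williamson_diag ds $$ (i, j) = (if i = j then ds ! (i div 2) else 0)"
    unfolding williamson_diag_def using * by auto
qed

text \<open>The passage from forms to matrices: when basis vectors are the rows of \<open>M\<close>,
  congruence by \<open>M\<close> evaluates the form on pairs of them.\<close>

lemma congruence_index:
  fixes M B :: "real mat"
  assumes "M \<in> carrier_mat N N" "B \<in> carrier_mat N N" "i < N" "j < N"
  shows "(M * B * transpose_mat M) $$ (i, j) =
    bform (\<lambda>a b. B $$ (a, b)) N (\<lambda>k. M $$ (i, k)) (\<lambda>k. M $$ (j, k))"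
proof -
  have "(M * B * transpose_mat M) $$ (i, j) = (\<Sum>k<N. M $$ (i, k) * (\<Sum>l<N. B $$ (k, l) * M $$ (j, l)))"
    using assms by (simp add: scalar_prod_def lessThan_atLeast0)
  then show ?thesis by (simp add: bform_def sum_distrib_left mult.assoc)
qed

lemma J_mat_square: "J_mat m * J_mat m = - 1\<^sub>m (2 * m)"
proof (rule eq_matI)
  fix i j assume ij: "i < dim_row (- 1\<^sub>m (2 * m) :: real mat)" "j < dim_col (- 1\<^sub>m (2 * m) :: real mat)"
  have "(J_mat m * J_mat m) $$ (i, j) = (\<Sum>k<2 * m. jform i k * jform k j)"
    using ij carrier_matD[OF J_mat_carrier[of m]] by (simp add: scalar_prod_def lessThan_atLeast0)
  also have "\<dots> = (if even i then jform (Suc i) j else - jform (i - 1) j)" using ij by (simp add: sum_jform)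
  also have "\<dots> = (if i = j then - 1 else 0)" by (auto simp: jform_def elim!: oddE)
  finally show "(J_mat m * J_mat m) $$ (i, j) = (- 1\<^sub>m (2 * m)) $$ (i, j)" using ij by simp
qed (use carrier_matD[OF J_mat_carrier[of m]] in auto)

text \<open>Multiplying the symplectic relation by \<open>J\<close> and using
  \<open>J\<^sup>2 = - 1\<close> exhibits a left inverse, which for square matrices is also a right
  inverse.\<close>

lemma symplectic_inverse:
  assumes "symplectic m M"
  shows "- (J_mat m * transpose_mat M * J_mat m) * M = 1\<^sub>m (2 * m)"
    "M * - (J_mat m * transpose_mat M * J_mat m) = 1\<^sub>m (2 * m)"
proof -
  let ?N = "2 * m"
  note [simp] = assoc_mult_mat[of _ ?N ?N _ ?N _ ?N] mult_carrier_mat[of _ ?N ?N _ ?N]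
  have M: "M \<in> carrier_mat ?N ?N" "transpose_mat M * J_mat m * M = J_mat m"
    using assms by (auto simp: symplectic_def)
  have MT: "transpose_mat M \<in> carrier_mat ?N ?N" using M by simp
  have P: "J_mat m * transpose_mat M * J_mat m \<in> carrier_mat ?N ?N" using M by (intro mult_carrier_mat[of _ _ ?N]) auto
  have "- (J_mat m * transpose_mat M * J_mat m) * M = - (J_mat m * transpose_mat M * J_mat m * M)"
    using M P by (intro uminus_mult_left_mat) auto
  also have "J_mat m * transpose_mat M * J_mat m * M = J_mat m * (transpose_mat M * J_mat m * M)"
    using M(1) MT by simp
  also have "\<dots> = - 1\<^sub>m ?N" by (simp add: M(2) J_mat_square)
  finally show 1: "- (J_mat m * transpose_mat M * J_mat m) * M = 1\<^sub>m ?N" by simp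
  show "M * - (J_mat m * transpose_mat M * J_mat m) = 1\<^sub>m ?N"
    using mat_mult_left_right_inverse[OF _ M(1) 1] P by simp
qed

text \<open>The constructed basis sits in the rows of \<open>M\<close>, which yields
  \<open>M J M\<^sup>T = J\<close>, whereas the definition demands \<open>M\<^sup>T J M = J\<close>.
  The first relation says that \<open>- J M\<^sup>T J\<close> is a right inverse of
  \<open>M\<close>; being also a left inverse, it gives the second.\<close>

lemma symplecticI:
  assumes M: "M \<in> carrier_mat (2 * m) (2 * m)" and eq: "M * J_mat m * transpose_mat M = J_mat m"
  shows "symplectic m M"
proof -
  let ?N = "2 * m" and ?J = "J_mat m"
  note [simp] = assoc_mult_mat[of _ ?N ?N _ ?N _ ?N] mult_carrier_mat[of _ ?N ?N _ ?N]
  have MT: "transpose_mat M \<in> carrier_mat ?N ?N" using M by simp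
  define Q where "Q = - (?J * transpose_mat M * ?J)"
  have P: "?J * transpose_mat M * ?J \<in> carrier_mat ?N ?N" using MT by (intro mult_carrier_mat[of _ _ ?N]) auto
  then have Q: "Q \<in> carrier_mat ?N ?N" by (simp add: Q_def)
  have "M * Q = - (M * (?J * transpose_mat M * ?J))" unfolding Q_def using M P by (intro uminus_mult_right_mat) auto
  also have "M * (?J * transpose_mat M * ?J) = (M * ?J * transpose_mat M) * ?J"
    using M MT mult_carrier_mat[OF J_mat_carrier MT] by simp
  also have "\<dots> = - 1\<^sub>m ?N" unfolding eq by (rule J_mat_square)
  finally have "M * Q = 1\<^sub>m ?N" by simp
  from mat_mult_left_right_inverse[OF M Q this] have QM: "Q * M = 1\<^sub>m ?N" .
  have "Q * M = - (?J * transpose_mat M * ?J * M)" unfolding Q_def using M P by (intro uminus_mult_left_mat) auto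
  then have "?J * transpose_mat M * ?J * M = - 1\<^sub>m ?N" using QM by (metis uminus_uminus_mat)
  then have "?J * (?J * transpose_mat M * ?J * M) = ?J * - 1\<^sub>m ?N" by simp
  moreover have "?J * (?J * transpose_mat M * ?J * M) = (?J * ?J) * (transpose_mat M * ?J * M)"
    using M MT by simp
  moreover have "\<dots> = - (transpose_mat M * ?J * M)"
    unfolding J_mat_square using M MT by simp
  moreover have "?J * - 1\<^sub>m ?N = - ?J" by (subst uminus_mult_right_mat) auto
  ultimately have "transpose_mat M * ?J * M = ?J" by (metis uminus_uminus_mat)
  then show ?thesis using M by (simp add: symplectic_def)
qed

definition posdef_mat :: "nat \<Rightarrow> real mat \<Rightarrow> bool" where
  "posdef_mat N B \<longleftrightarrow> B \<in> carrier_mat N N \<and> (\<forall>i<N. \<forall>j<N. B $$ (i, j) = B $$ (j, i)) \<and>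
     (\<forall>x i. i < N \<longrightarrow> x i \<noteq> 0 \<longrightarrow> bform (\<lambda>a b. B $$ (a, b)) N x x > 0)"

theorem williamson_exists:
  assumes "posdef_mat (2 * m) B" shows "\<exists>ds. williamson_form B m ds"
proof -
  let ?N = "2 * m"
  interpret posdef_form "\<lambda>a b. B $$ (a, b)" m
    using assms by unfold_locales (auto simp: posdef_mat_def)
  have B: "B \<in> carrier_mat ?N ?N" using assms by (simp add: posdef_mat_def)
  obtain p d where P: "williamson_pairs m p d" using williamson_pairs_exist by blast
  note P' = P[unfolded williamson_pairs_def]
  define ds where "ds = map d [0..<m]"
  define M where "M = mat ?N ?N (\<lambda>(i, j). p i j)"
  have M: "M \<in> carrier_mat ?N ?N" by (simp add: M_def)
  have row: "bform F ?N (\<lambda>k. M $$ (i, k)) (\<lambda>k. M $$ (j, k)) = bform F ?N (p i) (p j)"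
    if "i < ?N" "j < ?N" for F i j
    using that by (intro bform_cong) (simp_all add: M_def)
  have len: "length ds = m" by (simp add: ds_def)
  have "M * J_mat m * transpose_mat M = J_mat m"
  proof (rule eq_matI)
    fix i j assume ij': "i < dim_row (J_mat m)" "j < dim_col (J_mat m)"
    then have ij: "i < ?N" "j < ?N" using carrier_matD[OF J_mat_carrier[of m]] by simp_all
    have "(M * J_mat m * transpose_mat M) $$ (i, j) = bform (\<lambda>a b. J_mat m $$ (a, b)) ?N (p i) (p j)"
      using ij by (simp add: congruence_index[OF M J_mat_carrier] row)
    also have "\<dots> = w (p i) (p j)" unfolding bform_def by (intro sum.cong) auto
    also have "\<dots> = jform i j" using P' ij by blast
    finally show "(M * J_mat m * transpose_mat M) $$ (i, j) = J_mat m $$ (i, j)" using ij by simp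
  qed (use carrier_matD[OF J_mat_carrier[of m]] M in auto)
  then have "symplectic m M" by (rule symplecticI[OF M])
  moreover have "M * B * transpose_mat M = williamson_diag ds"
  proof (rule eq_matI)
    fix i j assume "i < dim_row (williamson_diag ds)" "j < dim_col (williamson_diag ds)"
    then have ij: "i < ?N" "j < ?N" using carrier_matD[OF williamson_diag_carrier[of ds]] len by simp_all
    have "(M * B * transpose_mat M) $$ (i, j) = b (p i) (p j)"
      using ij by (simp add: congruence_index[OF M B] row)
    also have "\<dots> = (if i = j then d (i div 2) else 0)" using P' ij by blast
    finally show "(M * B * transpose_mat M) $$ (i, j) = williamson_diag ds $$ (i, j)"
      using ij len by (auto simp: ds_def less_mult_imp_div_less mult.commute)
  qed (use carrier_matD[OF williamson_diag_carrier[of ds]] M len in auto)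
  moreover have "\<forall>d\<in>set ds. 0 < d" using P' by (auto simp: ds_def)
  moreover have "sorted ds" unfolding sorted_iff_nth_mono_less ds_def using P' by auto
  ultimately show ?thesis unfolding williamson_form_def williamson_diag_def using len by blast
qed

section \<open>Traces of powers and uniqueness of the normal form\<close>

lemma diag_sum_commute:
  fixes X Y :: "'a::comm_ring_1 mat"
  assumes "X \<in> carrier_mat N N" "Y \<in> carrier_mat N N"
  shows "diag_sum (X * Y) = diag_sum (Y * X)"
proof -
  have "diag_sum (X * Y) = (\<Sum>i<N. \<Sum>j<N. X $$ (i, j) * Y $$ (j, i))"
    using assms by (simp add: diag_sum_def scalar_prod_def lessThan_atLeast0)
  also have "\<dots> = (\<Sum>j<N. \<Sum>i<N. Y $$ (j, i) * X $$ (i, j))"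
    by (subst sum.swap) (simp add: mult.commute)
  also have "\<dots> = diag_sum (Y * X)"
    using assms by (simp add: diag_sum_def scalar_prod_def lessThan_atLeast0)
  finally show ?thesis .
qed

lemma JD_index:
  assumes "i < 2 * length ds" "j < 2 * length ds"
  shows "(J_mat (length ds) * williamson_diag ds) $$ (i, j) = jform i j * ds ! (j div 2)"
proof -
  have "(J_mat (length ds) * williamson_diag ds) $$ (i, j) =
      (\<Sum>k<2 * length ds. jform i k * (if k = j then ds ! (k div 2) else 0))"
    using assms carrier_matD[OF williamson_diag_carrier[of ds]] carrier_matD[OF J_mat_carrier[of "length ds"]]
    by (simp add: scalar_prod_def lessThan_atLeast0)
  also have "\<dots> = (\<Sum>k\<in>{j}. jform i k * ds ! (k div 2))"
    using assms by (intro sum.mono_neutral_cong_right) auto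
  finally show ?thesis by simp
qed

lemma mult_mat_index:
  assumes "X \<in> carrier_mat N N" "Y \<in> carrier_mat N N" "i < N" "j < N"
  shows "(X * Y) $$ (i, j) = (\<Sum>k<N. X $$ (i, k) * Y $$ (k, j))"
  using assms by (simp add: scalar_prod_def lessThan_atLeast0)

text \<open>The diagonal matrix \<open>D\<close> is constant on the blocks coupled by
  \<open>J\<close>, so the two commute and
  \<open>(J D)\<^sup>2 = J\<^sup>2 D\<^sup>2 = - D\<^sup>2\<close>.\<close>

lemma JD_square_index:
  assumes "i < 2 * length ds" "j < 2 * length ds"
  shows "((J_mat (length ds) * williamson_diag ds) * (J_mat (length ds) * williamson_diag ds)) $$ (i, j) =
    (if i = j then - (ds ! (i div 2))\<^sup>2 else 0)"
proof -
  let ?X = "J_mat (length ds) * williamson_diag ds"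
  have X: "?X \<in> carrier_mat (2 * length ds) (2 * length ds)" by (intro mult_carrier_mat[of _ _ "2 * length ds"]) auto
  have "(?X * ?X) $$ (i, j) = (\<Sum>k<2 * length ds. jform i k * (ds ! (k div 2) * (jform k j * ds ! (j div 2))))"
    using assms unfolding mult_mat_index[OF X X assms] by (intro sum.cong refl) (simp add: JD_index mult.assoc del: index_mult_mat)
  also have "\<dots> = (if even i then ds ! (Suc i div 2) * (jform (Suc i) j * ds ! (j div 2))
      else - (ds ! ((i - 1) div 2) * (jform (i - 1) j * ds ! (j div 2))))"
    using assms(1) by (rule sum_jform)
  also have "\<dots> = (if i = j then - (ds ! (i div 2))\<^sup>2 else 0)"
    by (auto simp: jform_def power2_eq_square elim!: oddE)
  finally show ?thesis .
qed

lemma lessThan_two: "{..<2::nat} = {0, 1}"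
  by auto

lemma diag_sum_JD_power:
  fixes ds :: "real list"
  shows "diag_sum ((J_mat (length ds) * williamson_diag ds) ^\<^sub>m (2 * p)) = 2 * (\<Sum>d\<leftarrow>ds. (- d\<^sup>2) ^ p)"
proof -
  let ?N = "2 * length ds"
  let ?X = "J_mat (length ds) * williamson_diag ds"
  let ?E = "\<lambda>p. mat ?N ?N (\<lambda>(i, j). if i = j then (- (ds ! (i div 2))\<^sup>2) ^ p else 0)"
  have X: "?X \<in> carrier_mat ?N ?N" by (intro mult_carrier_mat[of _ _ "2 * length ds"]) auto
  have XX: "?X * ?X = ?E 1"
  proof (rule eq_matI)
    fix i j assume "i < dim_row (?E 1)" "j < dim_col (?E 1)"
    then show "(?X * ?X) $$ (i, j) = ?E 1 $$ (i, j)" using JD_square_index[of i ds j] by simp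
  qed (use carrier_matD[OF X] in auto)
  have "?X ^\<^sub>m (2 * p) = ?E p"
  proof (induction p)
    case 0
    show ?case using carrier_matD[OF X] by (intro eq_matI) auto
  next
    case (Suc p)
    have "?X ^\<^sub>m (2 * Suc p) = ?X ^\<^sub>m (2 * p) * ?X * ?X" by simp
    also have "\<dots> = ?X ^\<^sub>m (2 * p) * (?X * ?X)"
      using X by (intro assoc_mult_mat[of _ ?N ?N _ ?N _ ?N] pow_carrier_mat) auto
    also have "\<dots> = ?E p * ?E 1" unfolding Suc XX ..
    also have "\<dots> = ?E (Suc p)"
    proof (rule eq_matI)
      fix i j assume ij: "i < dim_row (?E (Suc p))" "j < dim_col (?E (Suc p))"
      have "(?E p * ?E 1) $$ (i, j) = (\<Sum>k<?N. (if i = k then (- (ds ! (i div 2))\<^sup>2) ^ p else 0) *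
          (if k = j then (- (ds ! (k div 2))\<^sup>2) ^ 1 else 0))"
        using ij by (subst mult_mat_index[where N = ?N]) auto
      also have "\<dots> = (\<Sum>k\<in>{i}. (if i = k then (- (ds ! (i div 2))\<^sup>2) ^ p else 0) *
          (if k = j then (- (ds ! (k div 2))\<^sup>2) ^ 1 else 0))"
        using ij by (intro sum.mono_neutral_right) auto
      finally show "(?E p * ?E 1) $$ (i, j) = ?E (Suc p) $$ (i, j)" using ij by simp
    qed auto
    finally show ?case .
  qed
  then have "diag_sum (?X ^\<^sub>m (2 * p)) = (\<Sum>i<length ds * 2. (- (ds ! (i div 2))\<^sup>2) ^ p)"
    by (simp add: diag_sum_def mult.commute)
  also have "\<dots> = (\<Sum>i<length ds. \<Sum>r<2. (- (ds ! ((i * 2 + r) div 2))\<^sup>2) ^ p)" by (rule sum_blocks)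
  also have "\<dots> = (\<Sum>i<length ds. 2 * (- (ds ! i)\<^sup>2) ^ p)"
    by (intro sum.cong refl) (simp add: lessThan_two)
  also have "\<dots> = 2 * (\<Sum>d\<leftarrow>ds. (- d\<^sup>2) ^ p)"
    by (simp add: sum_list_sum_nth lessThan_atLeast0 sum_distrib_left)
  finally show ?thesis .
qed

text \<open>The matrices \<open>J B\<close> and \<open>J D\<close> are similar: with
  \<open>Q\<close> the inverse of \<open>M\<^sup>T\<close>, the relations
  \<open>D = M B M\<^sup>T\<close> and \<open>M\<^sup>T J M = J\<close> give
  \<open>M\<^sup>T (J D) Q = (M\<^sup>T J M) B (M\<^sup>T Q) = J B\<close>.\<close>

theorem williamson_trace:
  assumes W: "williamson_form B m ds" and B: "B \<in> carrier_mat (2 * m) (2 * m)"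
  shows "diag_sum ((J_mat m * B) ^\<^sub>m (2 * p)) = 2 * (\<Sum>d\<leftarrow>ds. (- d\<^sup>2) ^ p)"
proof -
  let ?N = "2 * m" and ?J = "J_mat m" and ?D = "williamson_diag ds"
  note [simp] = assoc_mult_mat[of _ ?N ?N _ ?N _ ?N] mult_carrier_mat[of _ ?N ?N _ ?N]
  obtain M where len: "length ds = m" and M: "symplectic m M" "M * B * transpose_mat M = ?D"
    using W by (auto simp: williamson_form_def williamson_diag_def)
  have Mc: "M \<in> carrier_mat ?N ?N" "transpose_mat M * ?J * M = ?J" using M(1) by (auto simp: symplectic_def)
  let ?P = "transpose_mat M"
  have P: "?P \<in> carrier_mat ?N ?N" using Mc by simp
  have D: "?D \<in> carrier_mat ?N ?N" using len williamson_diag_carrier[of ds] by simp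
  define R where "R = - (?J * transpose_mat M * ?J)"
  have R: "R \<in> carrier_mat ?N ?N" unfolding R_def using P by (intro uminus_carrier_mat mult_carrier_mat[of _ _ ?N]) auto
  have MR: "M * R = 1\<^sub>m ?N" "R * M = 1\<^sub>m ?N" using symplectic_inverse[OF M(1)] by (simp_all add: R_def)
  let ?Q = "transpose_mat R"
  have Q: "?Q \<in> carrier_mat ?N ?N" using R by simp
  have PQ: "?P * ?Q = 1\<^sub>m ?N" "?Q * ?P = 1\<^sub>m ?N"
    using transpose_mult[OF R Mc(1)] transpose_mult[OF Mc(1) R] unfolding MR by (metis transpose_one)+
  have "?P * (?J * ?D) * ?Q = (?P * ?J * M) * B * (?P * ?Q)"
    unfolding M(2)[symmetric] using Mc(1) P Q B by simp
  also have "\<dots> = ?J * B" unfolding Mc(2) PQ using B by simp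
  finally have "?J * B = ?P * (?J * ?D) * ?Q" ..
  moreover have JB: "?J * B \<in> carrier_mat ?N ?N" and JD: "?J * ?D \<in> carrier_mat ?N ?N"
    using B D by (auto intro!: mult_carrier_mat)
  ultimately have "similar_mat_wit (?J * B) (?J * ?D) ?P ?Q"
    using P Q PQ by (auto simp: similar_mat_wit_def Let_def)
  from similar_mat_wit_pow_id[OF this, of "2 * p"]
  have "(?J * B) ^\<^sub>m (2 * p) = ?P * ((?J * ?D) ^\<^sub>m (2 * p) * ?Q)"
    using P Q pow_carrier_mat[OF JD, of "2 * p"] by simp
  then have "diag_sum ((?J * B) ^\<^sub>m (2 * p)) = diag_sum ((?J * ?D) ^\<^sub>m (2 * p) * ?Q * ?P)"
    using P Q pow_carrier_mat[OF JD, of "2 * p"] by (simp add: diag_sum_commute[of ?P ?N])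
  also have "(?J * ?D) ^\<^sub>m (2 * p) * ?Q * ?P = (?J * ?D) ^\<^sub>m (2 * p)"
    using P Q PQ right_mult_one_mat[OF pow_carrier_mat[OF JD, of "2 * p"]] pow_carrier_mat[OF JD, of "2 * p"] by simp
  finally show ?thesis using diag_sum_JD_power[of ds p] len by simp
qed

text \<open>A polynomial vanishing at all but one of the values \<open>- y\<^sup>2\<close> recovers the multiplicity of that value.\<close>

lemma sorted_list_eqI_power_sums:
  fixes ds es :: "real list"
  assumes "sorted ds" "sorted es" "\<forall>d\<in>set ds. d > 0" "\<forall>e\<in>set es. e > 0"
    and eq: "\<And>p. (\<Sum>d\<leftarrow>ds. (- d\<^sup>2) ^ p) = (\<Sum>e\<leftarrow>es. (- e\<^sup>2) ^ p)"
  shows "ds = es"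
proof -
  have poly_eq: "(\<Sum>d\<leftarrow>ds. poly P (- d\<^sup>2)) = (\<Sum>e\<leftarrow>es. poly P (- e\<^sup>2))" for P :: "real poly"
  proof -
    have *: "(\<Sum>d\<leftarrow>xs. poly P (- d\<^sup>2)) = (\<Sum>i\<le>degree P. coeff P i * (\<Sum>d\<leftarrow>xs. (- d\<^sup>2) ^ i))" for xs :: "real list"
    proof -
      have "(\<Sum>d\<leftarrow>xs. poly P (- d\<^sup>2)) = (\<Sum>d\<leftarrow>xs. \<Sum>i\<le>degree P. coeff P i * (- d\<^sup>2) ^ i)"
        by (simp add: poly_altdef)
      also have "\<dots> = (\<Sum>i\<le>degree P. coeff P i * (\<Sum>d\<leftarrow>xs. (- d\<^sup>2) ^ i))"
        by (induction xs) (simp_all add: sum.distrib distrib_left)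
      finally show ?thesis .
    qed
    show ?thesis unfolding * eq ..
  qed
  define S where "S = set ds \<union> set es"
  have "count_list ds v = count_list es v" for v
  proof (cases "v \<in> S")
    case True
    define P where "P = (\<Prod>y\<in>S - {v}. [:y\<^sup>2, 1:])"
    have fin: "finite S" by (simp add: S_def)
    \<comment> \<open>Positivity enters here: squares of distinct positive values are distinct, so
      \<open>P\<close> does not vanish at \<open>- v\<^sup>2\<close>.\<close>
    have sq: "y\<^sup>2 \<noteq> v\<^sup>2" if "y \<in> S" "y \<noteq> v" for y
    proof
      have "0 < y" "0 < v" using that True assms(3,4) by (auto simp: S_def)
      moreover assume "y\<^sup>2 = v\<^sup>2"
      ultimately show False using that power2_eq_imp_eq[of y v] by simp
    qed
    have Pv: "poly P (- v\<^sup>2) \<noteq> 0"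
      using sq fin by (auto simp: P_def poly_prod)
    have P0: "poly P (- y\<^sup>2) = 0" if "y \<in> S" "y \<noteq> v" for y
      using that fin by (force simp: P_def poly_prod)
    have *: "(\<Sum>d\<leftarrow>xs. poly P (- d\<^sup>2)) = real (count_list xs v) * poly P (- v\<^sup>2)" if "set xs \<subseteq> S" for xs
      using that by (induction xs) (auto simp: P0 algebra_simps)
    show ?thesis
      using poly_eq[of P] Pv *[of ds] *[of es] by (simp add: S_def)
  next
    case False
    then show ?thesis by (simp add: S_def)
  qed
  then have "mset ds = mset es" by (intro multiset_eqI) (simp add: count_mset)
  then show ?thesis using assms(1,2) properties_for_sort sorted_sort_id by metis
qed

text \<open>The power sums of either list are half the traces of powers of \<open>J B\<close>, and
  these do not depend on the chosen \<open>M\<close>.\<close>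

lemma williamson_unique:
  assumes B: "B \<in> carrier_mat (2 * m) (2 * m)" and "williamson_form B m ds" "williamson_form B m es"
  shows "ds = es"
proof (rule sorted_list_eqI_power_sums)
  show "(\<Sum>d\<leftarrow>ds. (- d\<^sup>2) ^ p) = (\<Sum>e\<leftarrow>es. (- e\<^sup>2) ^ p)" for p
    using williamson_trace[OF assms(2) B, of p] williamson_trace[OF assms(3) B, of p] by simp
qed (use assms in \<open>auto simp: williamson_form_def\<close>)

section \<open>Symplectic eigenvalues do not exceed the operator norm\<close>

lemma jform_isometry: "(\<Sum>k<2 * m. (\<Sum>a<2 * m. jform k a * v a)\<^sup>2) = (\<Sum>a<2 * m. (v a)\<^sup>2)"
proof -
  have "(\<Sum>k<2 * m. (\<Sum>a<2 * m. jform k a * v a)\<^sup>2) =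
      (\<Sum>k<m * 2. (if even k then v (Suc k) else - v (k - 1))\<^sup>2)"
    unfolding mult.commute[of m 2] by (intro sum.cong refl) (simp add: sum_jform)
  also have "\<dots> = (\<Sum>i<m. (v (Suc (i * 2)))\<^sup>2 + (v (i * 2))\<^sup>2)"
    unfolding sum_blocks by (simp add: lessThan_two)
  also have "\<dots> = (\<Sum>k<m * 2. (v k)\<^sup>2)" unfolding sum_blocks by (simp add: lessThan_two add.commute)
  finally show ?thesis by (simp add: mult.commute)
qed

text \<open>A real argument without eigenvectors. Put \<open>R\<close> for the inverse of
  \<open>M\<close>; then \<open>R D = B M\<^sup>T\<close>. In column \<open>q\<close> the right side
  is \<open>B\<close> applied to row \<open>q\<close> of \<open>M\<close>, while the left side has
  the length of row \<open>pt q\<close> times the eigenvalue, because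
  \<open>R = - J M\<^sup>T J\<close> and \<open>J\<close> preserves lengths. Going from
  \<open>q\<close> to its partner and back gives the fourth power of the claim.\<close>

lemma williamson_bound:
  assumes W: "williamson_form B m ds" and B: "B \<in> carrier_mat (2 * m) (2 * m)"
    and L: "L \<ge> 0"
    and bound: "\<And>x. (\<Sum>i<2 * m. (\<Sum>j<2 * m. B $$ (i, j) * x j)\<^sup>2) \<le> L\<^sup>2 * (\<Sum>j<2 * m. (x j)\<^sup>2)"
    and d: "d \<in> set ds"
  shows "d \<le> L"
proof -
  let ?N = "2 * m" and ?J = "J_mat m" and ?D = "williamson_diag ds"
  note [simp] = assoc_mult_mat[of _ ?N ?N _ ?N _ ?N] mult_carrier_mat[of _ ?N ?N _ ?N]
  obtain M where len: "length ds = m" and M: "symplectic m M" "M * B * transpose_mat M = ?D"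
    using W by (auto simp: williamson_form_def williamson_diag_def)
  have Mc: "M \<in> carrier_mat ?N ?N" using M(1) by (auto simp: symplectic_def)
  then have MT: "transpose_mat M \<in> carrier_mat ?N ?N" by simp
  have D: "?D \<in> carrier_mat ?N ?N" using len williamson_diag_carrier[of ds] by simp
  let ?K = "transpose_mat M * ?J"
  have K: "?K \<in> carrier_mat ?N ?N" using MT by (intro mult_carrier_mat[of _ _ ?N]) auto
  define R where "R = - (?J * transpose_mat M * ?J)"
  have R: "R \<in> carrier_mat ?N ?N"
    unfolding R_def using MT by (intro uminus_carrier_mat mult_carrier_mat[of _ _ ?N]) auto
  have RM: "R * M = 1\<^sub>m ?N" using symplectic_inverse[OF M(1)] by (simp add: R_def)
  have "R * ?D = (R * M) * (B * transpose_mat M)" unfolding M(2)[symmetric] using R Mc B MT by simp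
  then have RD: "R * ?D = B * transpose_mat M" unfolding RM using B MT by simp
  define nsq where "nsq q = (\<Sum>k<?N. (M $$ (q, k))\<^sup>2)" for q
  \<comment> \<open>The partner of \<open>q\<close> under \<open>J\<close>: it exchanges
    \<open>2 * i\<close> and \<open>2 * i + 1\<close>, which belong to the same symplectic
    eigenvalue.\<close>
  define pt where "pt q = (if even q then Suc q else q - 1)" for q :: nat
  have ptN: "pt q < ?N" if "q < ?N" for q using that by (auto simp: pt_def elim!: evenE)
  have pt2: "pt (pt q) = q" "pt q div 2 = q div 2" for q by (auto simp: pt_def elim!: oddE)
  have key: "(ds ! (q div 2))\<^sup>2 * nsq (pt q) \<le> L\<^sup>2 * nsq q" if q: "q < ?N" for q
  proof -
    have K_idx: "(?K $$ (a, q))\<^sup>2 = (M $$ (pt q, a))\<^sup>2" if a: "a < ?N" for a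
    proof -
      have "?K $$ (a, q) = (\<Sum>c<?N. M $$ (c, a) * jform c q)"
        using a q Mc carrier_matD[OF J_mat_carrier[of m]] by (simp add: scalar_prod_def lessThan_atLeast0)
      also have "\<dots> = - (\<Sum>c<?N. jform q c * M $$ (c, a))"
        unfolding sum_negf[symmetric] by (intro sum.cong refl) (simp add: jform_swap[of _ q])
      finally show ?thesis using q by (simp add: sum_jform pt_def)
    qed
    have R_idx: "R $$ (k, q) = - (\<Sum>a<?N. jform k a * ?K $$ (a, q))" if k: "k < ?N" for k
    proof -
      have e: "?J * transpose_mat M * ?J = ?J * ?K" using MT by simp
      show ?thesis
        unfolding R_def e using k q K carrier_matD[OF J_mat_carrier[of m]] carrier_matD[OF K]
        by (simp add: scalar_prod_def lessThan_atLeast0 del: assoc_mult_mat)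
    qed
    have "(\<Sum>k<?N. ((R * ?D) $$ (k, q))\<^sup>2) = (\<Sum>k<?N. (R $$ (k, q) * ds ! (q div 2))\<^sup>2)"
    proof (intro sum.cong refl)
      fix k assume k: "k \<in> {..<?N}"
      have "(R * ?D) $$ (k, q) = (\<Sum>c<?N. R $$ (k, c) * (if c = q then ds ! (c div 2) else 0))"
        using k q R carrier_matD[OF D] len by (simp add: scalar_prod_def lessThan_atLeast0)
      also have "\<dots> = (\<Sum>c\<in>{q}. R $$ (k, c) * (if c = q then ds ! (c div 2) else 0))"
        using q by (intro sum.mono_neutral_right) auto
      finally show "((R * ?D) $$ (k, q))\<^sup>2 = (R $$ (k, q) * ds ! (q div 2))\<^sup>2" by simp
    qed
    also have "\<dots> = (ds ! (q div 2))\<^sup>2 * (\<Sum>k<?N. (\<Sum>a<?N. jform k a * ?K $$ (a, q))\<^sup>2)"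
      unfolding sum_distrib_left by (intro sum.cong refl) (simp only: lessThan_iff R_idx power_mult_distrib power2_minus mult.commute)
    also have "\<dots> = (ds ! (q div 2))\<^sup>2 * nsq (pt q)"
      unfolding jform_isometry nsq_def by (intro arg_cong2[where f = "(*)"] sum.cong refl) (use K_idx in blast)
    finally have "(ds ! (q div 2))\<^sup>2 * nsq (pt q) = (\<Sum>k<?N. ((B * transpose_mat M) $$ (k, q))\<^sup>2)"
      unfolding RD by simp
    also have "\<dots> = (\<Sum>k<?N. (\<Sum>j<?N. B $$ (k, j) * M $$ (q, j))\<^sup>2)"
      using q B Mc by (intro sum.cong refl) (simp add: scalar_prod_def lessThan_atLeast0)
    also have "\<dots> \<le> L\<^sup>2 * nsq q" unfolding nsq_def by (rule bound)
    finally show ?thesis .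
  qed
  obtain i where i: "i < m" "d = ds ! i" using d len by (auto simp: in_set_conv_nth)
  have d0: "d > 0" using W d by (auto simp: williamson_form_def)
  let ?q = "2 * i"
  have q: "?q < ?N" using i by simp
  \<comment> \<open>A zero row of \<open>M\<close> would produce a zero on the diagonal of
    \<open>D\<close>.\<close>
  have "nsq ?q > 0"
  proof (rule ccontr)
    assume "\<not> nsq ?q > 0"
    then have "nsq ?q = 0" using sum_nonneg[of "{..<?N}" "\<lambda>k. (M $$ (?q, k))\<^sup>2"] by (simp add: nsq_def)
    then have "M $$ (?q, k) = 0" if "k < ?N" for k
      using that by (auto simp: nsq_def sum_nonneg_eq_0_iff)
    then have "(M * B * transpose_mat M) $$ (?q, ?q) = 0"
      unfolding congruence_index[OF Mc B q q] by (simp add: bform_def)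
    then show False unfolding M(2) using q len d0 i by simp
  qed
  moreover have "d\<^sup>2 * (d\<^sup>2 * nsq ?q) \<le> L\<^sup>2 * (L\<^sup>2 * nsq ?q)"
  proof -
    have 1: "d\<^sup>2 * nsq (pt ?q) \<le> L\<^sup>2 * nsq ?q" using key[OF q] i by simp
    have "d\<^sup>2 * nsq (pt (pt ?q)) \<le> L\<^sup>2 * nsq (pt ?q)" using key[OF ptN[OF q]] i by (simp only: pt2) simp
    then have 2: "d\<^sup>2 * nsq ?q \<le> L\<^sup>2 * nsq (pt ?q)" by (simp only: pt2)
    then have "d\<^sup>2 * (d\<^sup>2 * nsq ?q) \<le> d\<^sup>2 * (L\<^sup>2 * nsq (pt ?q))" by (rule mult_left_mono) simp
    also have "\<dots> = L\<^sup>2 * (d\<^sup>2 * nsq (pt ?q))" by simp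
    also have "\<dots> \<le> L\<^sup>2 * (L\<^sup>2 * nsq ?q)" using 1 by (rule mult_left_mono) simp
    finally show ?thesis .
  qed
  ultimately have "(d\<^sup>2)\<^sup>2 \<le> (L\<^sup>2)\<^sup>2" by (simp add: power2_eq_square flip: mult.assoc)
  then have "d\<^sup>2 \<le> L\<^sup>2" by (rule power2_le_imp_le) simp
  then show ?thesis using L by (rule power2_le_imp_le)
qed

text \<open>Existence and uniqueness together make the definite description in
  \<open>symp_eig\<close> denote the actual list; positivity, the norm bound and the trace formula
  are read off from it.\<close>

lemma symp_eig_list:
  assumes "posdef_mat (2 * m) B"
  obtains ds where "williamson_form B m ds" "length ds = m" "\<And>j. symp_eig B j = ds ! (j - 1)"
proof -
  have B: "B \<in> carrier_mat (2 * m) (2 * m)" using assms by (simp add: posdef_mat_def)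
  obtain ds where ds: "williamson_form B m ds" using williamson_exists[OF assms] by blast
  then have "(THE ds. williamson_form B m ds) = ds" using williamson_unique[OF B] by blast
  then have "symp_eig B j = ds ! (j - 1)" for j using B by (simp add: symp_eig_def)
  then show ?thesis using that ds by (auto simp: williamson_form_def)
qed

lemma symp_eig_pos: "posdef_mat (2 * m) B \<Longrightarrow> j \<in> {1..m} \<Longrightarrow> symp_eig B j > 0"
  by (erule symp_eig_list) (auto simp: williamson_form_def)

lemma symp_eig_bound:
  assumes P: "posdef_mat (2 * m) B" and "L \<ge> 0"
    "\<And>x. (\<Sum>i<2 * m. (\<Sum>j<2 * m. B $$ (i, j) * x j)\<^sup>2) \<le> L\<^sup>2 * (\<Sum>j<2 * m. (x j)\<^sup>2)"
    and j: "j \<in> {1..m}"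
  shows "symp_eig B j \<le> L"
proof -
  have B: "B \<in> carrier_mat (2 * m) (2 * m)" using P by (simp add: posdef_mat_def)
  obtain ds where ds: "williamson_form B m ds" "length ds = m" "\<And>j. symp_eig B j = ds ! (j - 1)"
    using symp_eig_list[OF P] by blast
  show ?thesis unfolding ds(3) using j ds by (intro williamson_bound[OF ds(1) B assms(2,3)]) auto
qed

lemma symp_eig_trace:
  assumes P: "posdef_mat (2 * m) B"
  shows "diag_sum ((J_mat m * B) ^\<^sub>m (2 * p)) = 2 * (\<Sum>j = 1..m. (- (symp_eig B j)\<^sup>2) ^ p)"
proof -
  have B: "B \<in> carrier_mat (2 * m) (2 * m)" using P by (simp add: posdef_mat_def)
  obtain ds where ds: "williamson_form B m ds" "length ds = m" "\<And>j. symp_eig B j = ds ! (j - 1)"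
    using symp_eig_list[OF P] by blast
  have "(\<Sum>j = 1..m. (- (symp_eig B j)\<^sup>2) ^ p) = (\<Sum>i<m. (- (ds ! i)\<^sup>2) ^ p)"
    unfolding ds(3) by (rule sum.reindex_bij_witness[of _ Suc "\<lambda>j. j - 1"]) auto
  then show ?thesis
    unfolding williamson_trace[OF ds(1) B] by (simp add: sum_list_sum_nth ds(2) lessThan_atLeast0)
qed

section \<open>The norm of a symbol\<close>

text \<open>A countable set suffices to test a continuous inequality on \<open>m\<close> complex coordinates. This turns
  statements valid almost everywhere for each fixed vector into statements for all vectors at once.\<close>

lemma countable_test_functions:
  "\<exists>D :: (nat \<Rightarrow> complex) set. countable D \<and>
    (\<forall>(F :: (nat \<Rightarrow> complex) \<Rightarrow> real) x.
      (\<forall>X. (\<forall>i<m. (\<lambda>n. X n i) \<longlonglongrightarrow> x i) \<longrightarrow> (\<lambda>n. F (X n)) \<longlonglongrightarrow> F x) \<longrightarrow>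
      (\<forall>x\<in>D. 0 \<le> F x) \<longrightarrow> 0 \<le> F x)"
proof -
  obtain C :: "complex set" where C: "countable C" "\<And>X. open X \<Longrightarrow> X \<noteq> {} \<Longrightarrow> \<exists>d\<in>C. d \<in> X"
    using countable_dense_exists[where 'a = complex] by blast
  \<comment> \<open>Coding the vectors by lists over a countable dense set makes countability
    immediate; coordinates from \<open>m\<close> on are set to 0.\<close>
  define D where "D = (\<lambda>l i. if i < m then l ! i else (0::complex)) ` lists C"
  have "countable D" unfolding D_def using C(1) by simp
  moreover have "0 \<le> F x"
    if F: "\<forall>X. (\<forall>i<m. (\<lambda>n. X n i) \<longlonglongrightarrow> x i) \<longrightarrow> (\<lambda>n. F (X n)) \<longlonglongrightarrow> F x"
    and D: "\<forall>x\<in>D. 0 \<le> F x" for F :: "(nat \<Rightarrow> complex) \<Rightarrow> real" and x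
  proof -
    have "\<exists>d\<in>C. dist d (x i) < 1 / real (Suc n)" for n i
      using C(2)[of "ball (x i) (1 / real (Suc n))"] by (auto simp: dist_commute)
    then have "\<forall>n i. \<exists>d. d \<in> C \<and> dist d (x i) < 1 / real (Suc n)" by blast
    then obtain d where "\<forall>n i. d n i \<in> C \<and> dist (d n i) (x i) < 1 / real (Suc n)" by metis
    then have d: "\<And>n i. d n i \<in> C" "\<And>n i. dist (d n i) (x i) < 1 / real (Suc n)" by blast+
    define X where "X n i = (if i < m then d n i else 0)" for n i
    have "X n = (\<lambda>i. if i < m then map (d n) [0..<m] ! i else 0)" for n by (auto simp: X_def)
    then have "X n \<in> D" for n unfolding D_def using d(1) by (intro image_eqI[of _ _ "map (d n) [0..<m]"]) auto
    then have "0 \<le> F (X n)" for n using D by blast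
    moreover have "(\<lambda>n. F (X n)) \<longlonglongrightarrow> F x"
    proof (rule F[rule_format])
      fix i assume i: "i < m"
      have "(\<lambda>n. d n i) \<longlonglongrightarrow> x i"
      proof (rule metric_tendsto_imp_tendsto[OF LIMSEQ_inverse_real_of_nat])
        show "\<forall>\<^sub>F n in sequentially. dist (d n i) (x i) \<le> dist (inverse (real (Suc n))) 0"
          using d(2) by (intro always_eventually allI) (auto simp: field_simps intro: less_imp_le)
      qed
      then show "(\<lambda>n. X n i) \<longlonglongrightarrow> x i" using i by (simp add: X_def)
    qed
    ultimately show ?thesis by (metis LIMSEQ_le_const)
  qed
  ultimately show ?thesis by blast
qed

text \<open>Squared lengths are preferred to norms: they are sums of squared moduli, so limits,
  measurability and means pass through them directly.\<close>

definition apply_sq :: "nat \<Rightarrow> complex mat \<Rightarrow> (nat \<Rightarrow> complex) \<Rightarrow> real" where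
  "apply_sq m B x = (\<Sum>i<m. (cmod (\<Sum>j<m. B $$ (i, j) * x j))\<^sup>2)"

definition sq_sum :: "nat \<Rightarrow> (nat \<Rightarrow> complex) \<Rightarrow> real" where
  "sq_sum m x = (\<Sum>i<m. (cmod (x i))\<^sup>2)"

lemma cvec_norm_sq: "(cvec_norm v)\<^sup>2 = (\<Sum>i<dim_vec v. (cmod (v $ i))\<^sup>2)"
  by (simp add: cvec_norm_def L2_set_def sum_nonneg)

lemma cvec_norm_nonneg [simp]: "0 \<le> cvec_norm v"
  by (simp add: cvec_norm_def)

lemma cvec_norm_vec: "(cvec_norm (vec m x))\<^sup>2 = sq_sum m x"
  by (simp add: cvec_norm_sq sq_sum_def)

lemma cvec_norm_apply:
  assumes "B \<in> carrier_mat m m"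
  shows "(cvec_norm (B *\<^sub>v vec m x))\<^sup>2 = apply_sq m B x"
  using assms by (simp add: cvec_norm_sq apply_sq_def scalar_prod_def lessThan_atLeast0)

lemma vec_conv: "v \<in> carrier_vec m \<Longrightarrow> v = vec m (\<lambda>i. v $ i)"
  by auto

text \<open>Cauchy-Schwarz in every row. A crude constant suffices, since it only shows that the
  supremum in \<open>op_norm\<close> and the essential supremum are finite.\<close>

lemma apply_sq_bound:
  "apply_sq m B x \<le> (real m * (\<Sum>i<m. \<Sum>j<m. (cmod (B $$ (i, j)))\<^sup>2)) * sq_sum m x"
proof -
  have "(cmod (\<Sum>j<m. B $$ (i, j) * x j))\<^sup>2 \<le> real m * (\<Sum>j<m. (cmod (B $$ (i, j)))\<^sup>2) * sq_sum m x" for i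
  proof (cases "m = 0")
    case False
    have "cmod (\<Sum>j<m. B $$ (i, j) * x j) \<le> (\<Sum>j<m. cmod (B $$ (i, j)) * cmod (x j))"
      by (rule norm_sum[THEN order_trans]) (simp add: norm_mult)
    also have "\<dots> \<le> L2_set (\<lambda>j. cmod (B $$ (i, j))) {..<m} * L2_set (\<lambda>j. cmod (x j)) {..<m}"
      using L2_set_mult_ineq[of "\<lambda>j. cmod (B $$ (i, j))" "\<lambda>j. cmod (x j)" "{..<m}"] by simp
    finally have "(cmod (\<Sum>j<m. B $$ (i, j) * x j))\<^sup>2 \<le>
        (L2_set (\<lambda>j. cmod (B $$ (i, j))) {..<m} * L2_set (\<lambda>j. cmod (x j)) {..<m})\<^sup>2"
      by (rule power_mono) simp
    also have "\<dots> = 1 * ((\<Sum>j<m. (cmod (B $$ (i, j)))\<^sup>2) * sq_sum m x)"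
      by (simp add: power_mult_distrib L2_set_def sum_nonneg sq_sum_def)
    also have "\<dots> \<le> real m * ((\<Sum>j<m. (cmod (B $$ (i, j)))\<^sup>2) * sq_sum m x)"
      using False by (intro mult_right_mono mult_nonneg_nonneg) (auto simp: sum_nonneg sq_sum_def)
    finally show ?thesis by (simp add: mult.assoc)
  qed (simp add: sq_sum_def)
  then have "apply_sq m B x \<le> (\<Sum>i<m. real m * (\<Sum>j<m. (cmod (B $$ (i, j)))\<^sup>2) * sq_sum m x)"
    unfolding apply_sq_def by (intro sum_mono)
  then show ?thesis by (simp add: sum_distrib_left sum_distrib_right)
qed

lemma op_norm_SUP:
  assumes B: "B \<in> carrier_mat m m"
  shows "op_norm B = (SUP v \<in> {v \<in> carrier_vec m. cvec_norm v \<le> 1}. cvec_norm (B *\<^sub>v v))"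
    and "bdd_above ((\<lambda>v. cvec_norm (B *\<^sub>v v)) ` {v \<in> carrier_vec m. cvec_norm v \<le> 1})"
    and "{v \<in> carrier_vec m. cvec_norm v \<le> 1} \<noteq> {}"
proof -
  show "op_norm B = (SUP v \<in> {v \<in> carrier_vec m. cvec_norm v \<le> 1}. cvec_norm (B *\<^sub>v v))"
    using B by (simp add: op_norm_def)
  let ?K = "real m * (\<Sum>i<m. \<Sum>j<m. (cmod (B $$ (i, j)))\<^sup>2)"
  show "bdd_above ((\<lambda>v. cvec_norm (B *\<^sub>v v)) ` {v \<in> carrier_vec m. cvec_norm v \<le> 1})"
  proof (rule bdd_aboveI2)
    fix v assume v: "v \<in> {v \<in> carrier_vec m. cvec_norm v \<le> 1}"
    have "(cvec_norm (B *\<^sub>v v))\<^sup>2 = apply_sq m B (\<lambda>i. v $ i)"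
      using v cvec_norm_apply[OF B, of "\<lambda>i. v $ i"] vec_conv[of v m] by simp
    also have "\<dots> \<le> ?K * sq_sum m (\<lambda>i. v $ i)" by (rule apply_sq_bound)
    also have "sq_sum m (\<lambda>i. v $ i) = (cvec_norm v)\<^sup>2" using v by (auto simp: cvec_norm_sq sq_sum_def)
    also have "?K * (cvec_norm v)\<^sup>2 \<le> ?K * 1"
      using v by (intro mult_left_mono mult_nonneg_nonneg sum_nonneg power_le_one) auto
    finally show "cvec_norm (B *\<^sub>v v) \<le> sqrt ?K" by (simp add: real_le_rsqrt)
  qed
  have "0\<^sub>v m \<in> {v \<in> carrier_vec m. cvec_norm v \<le> 1}" by (simp add: cvec_norm_def L2_set_def)
  then show "{v \<in> carrier_vec m. cvec_norm v \<le> 1} \<noteq> {}" by blast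
qed

lemma op_norm_le_iff:
  assumes B: "B \<in> carrier_mat m m" and c: "c \<ge> 0"
  shows "op_norm B \<le> c \<longleftrightarrow> (\<forall>x. apply_sq m B x \<le> c\<^sup>2 * sq_sum m x)"
proof
  assume le: "op_norm B \<le> c"
  show "\<forall>x. apply_sq m B x \<le> c\<^sup>2 * sq_sum m x"
  proof
    fix x
    show "apply_sq m B x \<le> c\<^sup>2 * sq_sum m x"
    proof (cases "sq_sum m x = 0")
      case True
      then have "x i = 0" if "i < m" for i using that by (auto simp: sq_sum_def sum_nonneg_eq_0_iff)
      then show ?thesis using True by (simp add: apply_sq_def)
    next
      case False
      define s where "s = sqrt (sq_sum m x)"
      have s: "s > 0" "s\<^sup>2 = sq_sum m x"
        using False sum_nonneg[of "{..<m}" "\<lambda>i. (cmod (x i))\<^sup>2"] by (auto simp: s_def sq_sum_def)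
      define y where "y i = x i / of_real s" for i
      have "(cvec_norm (vec m y))\<^sup>2 = sq_sum m x / s\<^sup>2"
        unfolding cvec_norm_vec by (simp add: sq_sum_def y_def norm_divide power_divide sum_divide_distrib)
      then have "(cvec_norm (vec m y))\<^sup>2 \<le> 1\<^sup>2" using s False by simp
      then have "cvec_norm (vec m y) \<le> 1" by (rule power2_le_imp_le) simp
      then have "cvec_norm (B *\<^sub>v vec m y) \<le> op_norm B"
        unfolding op_norm_SUP(1)[OF B] by (intro cSUP_upper op_norm_SUP(2)[OF B]) auto
      then have "cvec_norm (B *\<^sub>v vec m y) \<le> c" using le by simp
      then have "(cvec_norm (B *\<^sub>v vec m y))\<^sup>2 \<le> c\<^sup>2" by (rule power_mono) simp
      then have "apply_sq m B y \<le> c\<^sup>2" unfolding cvec_norm_apply[OF B] .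
      moreover have "apply_sq m B y = apply_sq m B x / s\<^sup>2"
        by (simp add: apply_sq_def y_def norm_divide power_divide flip: sum_divide_distrib)
      ultimately have "apply_sq m B x / s\<^sup>2 \<le> c\<^sup>2" by simp
      then have "apply_sq m B x \<le> c\<^sup>2 * s\<^sup>2" using s(1) by (simp only: pos_divide_le_eq zero_less_power)
      then show ?thesis unfolding s(2) .
    qed
  qed
next
  assume *: "\<forall>x. apply_sq m B x \<le> c\<^sup>2 * sq_sum m x"
  show "op_norm B \<le> c"
    unfolding op_norm_SUP(1)[OF B]
  proof (rule cSUP_least[OF op_norm_SUP(3)[OF B]])
    fix v assume v: "v \<in> {v \<in> carrier_vec m. cvec_norm v \<le> 1}"
    have "(cvec_norm (B *\<^sub>v v))\<^sup>2 = apply_sq m B (\<lambda>i. v $ i)"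
      using v cvec_norm_apply[OF B, of "\<lambda>i. v $ i"] vec_conv[of v m] by simp
    also have "\<dots> \<le> c\<^sup>2 * sq_sum m (\<lambda>i. v $ i)" using * by blast
    also have "sq_sum m (\<lambda>i. v $ i) = (cvec_norm v)\<^sup>2" using v by (auto simp: cvec_norm_sq sq_sum_def)
    also have "c\<^sup>2 * (cvec_norm v)\<^sup>2 \<le> c\<^sup>2 * 1"
      using v by (intro mult_left_mono power_le_one) auto
    finally show "cvec_norm (B *\<^sub>v v) \<le> c" using c by (auto intro: power2_le_imp_le[OF _ c])
  qed
qed

lemma op_norm_nonneg:
  assumes B: "B \<in> carrier_mat m m" shows "op_norm B \<ge> 0"
proof -
  obtain v where "v \<in> {v \<in> carrier_vec m. cvec_norm v \<le> 1}" using op_norm_SUP(3)[OF B] by blast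
  then have "cvec_norm (B *\<^sub>v v) \<le> op_norm B"
    unfolding op_norm_SUP(1)[OF B] by (intro cSUP_upper op_norm_SUP(2)[OF B]) auto
  then show ?thesis using cvec_norm_nonneg order_trans by blast
qed

text \<open>By \<open>op_norm_le_iff\<close> the sublevel sets are described by inequalities that
  are continuous in the vector. Countably many test vectors decide them, and each inequality is
  measurable in \<theta>.\<close>

lemma op_norm_measurable:
  assumes A: "bsymbol m A" shows "(\<lambda>\<theta>. op_norm (A \<theta>)) \<in> borel_measurable circ"
  unfolding borel_measurable_iff_le
proof
  fix c
  have car: "A \<theta> \<in> carrier_mat m m" if "\<theta> \<in> {-pi..pi}" for \<theta> using A that by (auto simp: bsymbol_def)
  show "{\<theta> \<in> space circ. op_norm (A \<theta>) \<le> c} \<in> sets circ"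
  proof (cases "c \<ge> 0")
    case True
    obtain D :: "(nat \<Rightarrow> complex) set" where D: "countable D"
      "\<And>F x. \<forall>X. (\<forall>i<m. (\<lambda>n. X n i) \<longlonglongrightarrow> x i) \<longrightarrow> (\<lambda>n. F (X n)) \<longlonglongrightarrow> F x \<Longrightarrow>
        \<forall>x\<in>D. 0 \<le> (F x :: real) \<Longrightarrow> 0 \<le> F x"
      using countable_test_functions[of m] by metis
    have iff: "op_norm (A \<theta>) \<le> c \<longleftrightarrow> (\<forall>x\<in>D. 0 \<le> c\<^sup>2 * sq_sum m x - apply_sq m (A \<theta>) x)"
      if "\<theta> \<in> {-pi..pi}" for \<theta>
    proof -
      have "0 \<le> c\<^sup>2 * sq_sum m x - apply_sq m (A \<theta>) x"
        if *: "\<forall>x\<in>D. 0 \<le> c\<^sup>2 * sq_sum m x - apply_sq m (A \<theta>) x" for x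
      proof (rule D(2)[OF _ *], intro allI impI)
        fix X assume "\<forall>i<m. (\<lambda>n. X n i) \<longlonglongrightarrow> x i"
        then show "(\<lambda>n. c\<^sup>2 * sq_sum m (X n) - apply_sq m (A \<theta>) (X n)) \<longlonglongrightarrow> c\<^sup>2 * sq_sum m x - apply_sq m (A \<theta>) x"
          unfolding sq_sum_def apply_sq_def by (intro tendsto_intros) auto
      qed
      then show ?thesis using op_norm_le_iff[OF car[OF that] True] by auto
    qed
    have "(\<lambda>\<theta>. c\<^sup>2 * sq_sum m x - apply_sq m (A \<theta>) x) \<in> borel_measurable circ" for x
    proof -
      have "(\<lambda>\<theta>. \<Sum>j<m. A \<theta> $$ (i, j) * x j) \<in> borel_measurable circ" if "i < m" for i
        using A that by (intro bmeasD bmeas_sum bmeas_mult bmeas_const) (simp add: bsymbol_def)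
      then show ?thesis
        unfolding apply_sq_def by (intro borel_measurable_diff borel_measurable_const borel_measurable_sum
          borel_measurable_power borel_measurable_norm) auto
    qed
    then have "{\<theta> \<in> space circ. \<forall>x\<in>D. 0 \<le> c\<^sup>2 * sq_sum m x - apply_sq m (A \<theta>) x} \<in> sets circ"
      using D(1) by (intro sets.sets_Collect_countable_All' borel_measurable_le borel_measurable_const) auto
    also have "{\<theta> \<in> space circ. \<forall>x\<in>D. 0 \<le> c\<^sup>2 * sq_sum m x - apply_sq m (A \<theta>) x} =
        {\<theta> \<in> space circ. op_norm (A \<theta>) \<le> c}"
      using iff by auto
    finally show ?thesis .
  next
    case False
    then have "{\<theta> \<in> space circ. op_norm (A \<theta>) \<le> c} = {}"
      using op_norm_nonneg[OF car] by fastforce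
    then show ?thesis by (metis sets.empty_sets)
  qed
qed

text \<open>The point is that the essential supremum is a real number, so that
  \<open>real_of_ereal\<close> does not fall back on its default 0. It is at most
  \<open>sqrt ?K\<close>, and it is nonnegative because operator norms are and the circle is not a
  null set.\<close>

lemma op_norm_le_symbol_norm:
  assumes A: "bsymbol m A"
  shows "AE \<theta> in circ. op_norm (A \<theta>) \<le> symbol_norm A" and "symbol_norm A \<ge> 0"
proof -
  let ?f = "\<lambda>\<theta>. ereal (op_norm (A \<theta>))"
  let ?e = "esssup circ ?f"
  have car: "A \<theta> \<in> carrier_mat m m" if "\<theta> \<in> {-pi..pi}" for \<theta> using A that by (auto simp: bsymbol_def)
  have meas: "?f \<in> borel_measurable circ" using op_norm_measurable[OF A] by simp
  have "\<exists>C. AE \<theta> in circ. cmod (A \<theta> $$ (i, j)) \<le> C" if "i < m" "j < m" for i j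
    using A that by (auto simp: bsymbol_def bmeas_def)
  then obtain C where C: "\<And>i j. i < m \<Longrightarrow> j < m \<Longrightarrow> AE \<theta> in circ. cmod (A \<theta> $$ (i, j)) \<le> C i j"
    by metis
  have "AE \<theta> in circ. \<forall>i\<in>{..<m}. \<forall>j\<in>{..<m}. cmod (A \<theta> $$ (i, j)) \<le> C i j"
    using C by (intro AE_finite_allI) auto
  let ?K = "real m * (\<Sum>i<m. \<Sum>j<m. (C i j)\<^sup>2)"
  have K: "?K \<ge> 0" by (intro mult_nonneg_nonneg sum_nonneg) auto
  have "AE \<theta> in circ. op_norm (A \<theta>) \<le> sqrt ?K"
    using \<open>AE \<theta> in circ. \<forall>i\<in>{..<m}. \<forall>j\<in>{..<m}. cmod (A \<theta> $$ (i, j)) \<le> C i j\<close> AE_space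
  proof eventually_elim
    case (elim \<theta>)
    then have "\<theta> \<in> {-pi..pi}" by simp
    note c = car[OF this]
    have "apply_sq m (A \<theta>) x \<le> (sqrt ?K)\<^sup>2 * sq_sum m x" for x
    proof -
      have "apply_sq m (A \<theta>) x \<le> (real m * (\<Sum>i<m. \<Sum>j<m. (cmod (A \<theta> $$ (i, j)))\<^sup>2)) * sq_sum m x"
        by (rule apply_sq_bound)
      also have "\<dots> \<le> ?K * sq_sum m x"
        using elim by (intro mult_right_mono mult_left_mono sum_mono power_mono) (auto simp: sq_sum_def sum_nonneg)
      finally show ?thesis using K by simp
    qed
    then show ?case using op_norm_le_iff[OF c] K by simp
  qed
  then have "?e \<le> ereal (sqrt ?K)" using meas by (intro esssup_I) auto
  have AE1: "AE \<theta> in circ. ?f \<theta> \<le> ?e" by (rule esssup_AE)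
  have AE0: "AE \<theta> in circ. 0 \<le> ?f \<theta>"
    using op_norm_nonneg car by (intro AE_I2) auto
  have e0: "0 \<le> ?e"
  proof (rule ccontr)
    assume neg: "\<not> 0 \<le> ?e"
    have "AE \<theta> in circ. False" using AE1 AE0 by eventually_elim (use neg order_trans in blast)
    then have "emeasure circ (space circ) = 0"
      by (simp only: eventually_False ae_filter_eq_bot_iff)
    moreover have "emeasure circ (space circ) \<noteq> 0" by (simp add: emeasure_restrict_space)
    ultimately show False by simp
  qed
  then have e: "?e = ereal (symbol_norm A)"
    using \<open>?e \<le> ereal (sqrt ?K)\<close> unfolding symbol_norm_def by (cases ?e) auto
  show "AE \<theta> in circ. op_norm (A \<theta>) \<le> symbol_norm A" using AE1 unfolding e by simp
  show "symbol_norm A \<ge> 0" using e0 unfolding e by simp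
qed

lemma symbol_apply_bound:
  assumes A: "bsymbol m A"
  shows "AE \<theta> in circ. \<forall>x. apply_sq m (A \<theta>) x \<le> (symbol_norm A)\<^sup>2 * sq_sum m x"
  using op_norm_le_symbol_norm(1)[OF A] AE_space
proof eventually_elim
  case (elim \<theta>)
  then have "A \<theta> \<in> carrier_mat m m" using A by (auto simp: bsymbol_def)
  then show ?case using op_norm_le_iff op_norm_le_symbol_norm(2)[OF A] elim by blast
qed

text \<open>The block version of \<open>toeplitz_form_bound\<close>: the components of the image are
  coefficients of \<open>h = A q\<close>, where \<open>q\<close> is the vector of trigonometric
  polynomials with coefficients \<open>x\<close>. The bound on \<open>A \<theta>\<close> is used on
  the whole vector \<open>q\<close> at once, which keeps the constant equal to the symbol
  norm.\<close>

lemma toeplitz_apply_bound: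
  assumes A: "bsymbol m A"
  shows "apply_sq (n * m) (toeplitz_mat m A n) x \<le> (symbol_norm A)\<^sup>2 * sq_sum (n * m) x"
proof -
  let ?L = "symbol_norm A"
  define q where "q s \<theta> = (\<Sum>j<n. x (j * m + s) * chr (int j) \<theta>)" for s \<theta>
  define h where "h r \<theta> = (\<Sum>s<m. A \<theta> $$ (r, s) * q s \<theta>)" for r \<theta>
  have bA: "bmeas (\<lambda>\<theta>. A \<theta> $$ (r, s))" if "r < m" "s < m" for r s using A that by (simp add: bsymbol_def)
  have bq: "bmeas (q s)" for s unfolding q_def by (intro bmeas_sum bmeas_cmult bmeas_chr)
  have bh: "bmeas (h r)" if "r < m" for r unfolding h_def using that by (intro bmeas_sum bmeas_mult bA bq) auto
  have mq: "msq (q s) = (\<Sum>j<n. (cmod (x (j * m + s)))\<^sup>2)" for s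
  proof -
    have "q s = (\<lambda>\<theta>. \<Sum>r\<in>int ` {..<n}. x (nat r * m + s) * chr r \<theta>)"
      by (simp add: q_def[abs_def] sum.reindex)
    then show ?thesis by (simp only: msq_trig finite_imageI finite_lessThan) (simp add: sum.reindex)
  qed
  have fh: "fc (h r) (int i) = (\<Sum>j<n. \<Sum>s<m. fc (\<lambda>\<theta>. A \<theta> $$ (r, s)) (int i - int j) * x (j * m + s))"
    if r: "r < m" for r i
  proof -
    have "h r = (\<lambda>\<theta>. \<Sum>j<n. \<Sum>s<m. x (j * m + s) * (A \<theta> $$ (r, s) * chr (int j) \<theta>))"
      unfolding h_def q_def sum_distrib_left by (subst sum.swap) (simp add: mult_ac)
    then have "fc (h r) (int i) = (\<Sum>j<n. fc (\<lambda>\<theta>. \<Sum>s<m. x (j * m + s) * (A \<theta> $$ (r, s) * chr (int j) \<theta>)) (int i))"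
      using r by (simp only:) (subst fc_sum, auto intro!: bmeas_sum bmeas_cmult bmeas_mult bA)
    also have "\<dots> = (\<Sum>j<n. \<Sum>s<m. x (j * m + s) * fc (\<lambda>\<theta>. A \<theta> $$ (r, s)) (int i - int j))"
      using r by (intro sum.cong refl, subst fc_sum)
        (auto simp: fc_cmult fc_chr_mult intro!: bmeas_cmult bmeas_mult bA)
    finally show ?thesis by (simp add: mult.commute)
  qed
  have "apply_sq (n * m) (toeplitz_mat m A n) x = (\<Sum>i<n. \<Sum>r<m. (cmod (fc (h r) (int i)))\<^sup>2)"
    unfolding apply_sq_def sum_blocks
    by (intro sum.cong refl) (simp add: toeplitz_mat_index fh)
  also have "\<dots> = (\<Sum>r<m. \<Sum>i<n. (cmod (fc (h r) (int i)))\<^sup>2)" by (rule sum.swap)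
  also have "\<dots> \<le> (\<Sum>r<m. msq (h r))" by (intro sum_mono bessel_shifted bh) auto
  also have "\<dots> = Re (mean (\<lambda>\<theta>. \<Sum>r<m. h r \<theta> * cnj (h r \<theta>)))"
    by (subst mean_sum) (auto simp: msq_def intro!: bmeas_mult bmeas_cnj bh)
  also have "\<dots> \<le> Re (mean (\<lambda>\<theta>. \<Sum>s<m. of_real (?L\<^sup>2) * (q s \<theta> * cnj (q s \<theta>))))"
  proof (rule Re_mean_mono)
    show "AE \<theta> in circ. Re (\<Sum>r<m. h r \<theta> * cnj (h r \<theta>)) \<le> Re (\<Sum>s<m. of_real (?L\<^sup>2) * (q s \<theta> * cnj (q s \<theta>)))"
      using symbol_apply_bound[OF A]
    proof eventually_elim
      case (elim \<theta>)
      then have "apply_sq m (A \<theta>) (\<lambda>s. q s \<theta>) \<le> ?L\<^sup>2 * sq_sum m (\<lambda>s. q s \<theta>)" by blast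
      then show ?case
        unfolding mult_cnj apply_sq_def sq_sum_def h_def
        by (simp only: Re_sum Re_complex_of_real Re_mult_real sum_distrib_left)
    qed
  qed (intro bmeas_sum bmeas_cmult bmeas_mult bmeas_cnj bh bq; simp)+
  also have "\<dots> = (\<Sum>s<m. ?L\<^sup>2 * msq (q s))"
    by (subst mean_sum) (auto simp: mean_cmult msq_def Re_mult_real intro!: bmeas_mult bmeas_cmult bmeas_cnj bq simp del: of_real_power)
  also have "\<dots> = ?L\<^sup>2 * (\<Sum>s<m. \<Sum>j<n. (cmod (x (j * m + s)))\<^sup>2)" by (simp add: mq sum_distrib_left)
  also have "\<dots> = ?L\<^sup>2 * sq_sum (n * m) x" unfolding sq_sum_def sum_blocks by (subst sum.swap) simp
  finally show ?thesis .
qed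

section \<open>Coercivity of positive invertible operators\<close>

definition vec_inner :: "nat \<Rightarrow> complex vec \<Rightarrow> complex vec \<Rightarrow> complex" where
  "vec_inner m x y = (\<Sum>r<m. y $ r * cnj (x $ r))"

lemma cscalar_prod_conv: "x \<in> carrier_vec m \<Longrightarrow> y \<bullet>c x = vec_inner m x y"
  by (simp add: scalar_prod_def vec_inner_def lessThan_atLeast0)

lemma vec_inner_self: "x \<in> carrier_vec m \<Longrightarrow> vec_inner m x x = of_real ((cvec_norm x)\<^sup>2)"
  unfolding vec_inner_def cvec_norm_sq mult_cnj by (simp del: of_real_power)

lemma two_cmod_mult_le: "2 * cmod (a * cnj b) \<le> (cmod a)\<^sup>2 + (cmod b)\<^sup>2"
proof -
  have "0 \<le> (cmod a - cmod b)\<^sup>2" by simp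
  then show ?thesis by (simp add: norm_mult power2_diff)
qed

text \<open>The inequality of arithmetic and geometric means stands in for Cauchy-Schwarz. It passes
  termwise to series, and it is all that coercivity requires.\<close>

lemma cmod_vec_inner_le:
  assumes "x \<in> carrier_vec m" "y \<in> carrier_vec m"
  shows "cmod (vec_inner m x y) \<le> ((cvec_norm x)\<^sup>2 + (cvec_norm y)\<^sup>2) / 2"
proof -
  have "cmod (vec_inner m x y) \<le> (\<Sum>r<m. cmod (y $ r * cnj (x $ r)))" unfolding vec_inner_def by (rule norm_sum)
  also have "\<dots> \<le> (\<Sum>r<m. ((cmod (y $ r))\<^sup>2 + (cmod (x $ r))\<^sup>2) / 2)"
  proof (rule sum_mono)
    show "cmod (y $ r * cnj (x $ r)) \<le> ((cmod (y $ r))\<^sup>2 + (cmod (x $ r))\<^sup>2) / 2" for r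
      using two_cmod_mult_le[of "y $ r" "x $ r"] by simp
  qed
  also have "\<dots> = ((cvec_norm x)\<^sup>2 + (cvec_norm y)\<^sup>2) / 2"
    using assms by (auto simp: cvec_norm_sq sum.distrib add_divide_distrib sum_divide_distrib)
  finally show ?thesis .
qed

context
  fixes m :: nat
begin

section \<open>The inner product of square summable sequences\<close>

lemma l2_carrier: "x \<in> l2_space m \<Longrightarrow> x i \<in> carrier_vec m"
  by (simp add: l2_space_def)

lemma l2_summable: "x \<in> l2_space m \<Longrightarrow> summable (\<lambda>i. (cvec_norm (x i))\<^sup>2)"
  by (simp add: l2_space_def)

lemma l2_inner_suminf: "x \<in> l2_space m \<Longrightarrow> l2_inner x y = (\<Sum>i. vec_inner m (x i) (y i))"
  unfolding l2_inner_def by (intro suminf_cong cscalar_prod_conv l2_carrier)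

lemma summable_vec_inner:
  assumes "x \<in> l2_space m" "y \<in> l2_space m" shows "summable (\<lambda>i. vec_inner m (x i) (y i))"
proof (rule summable_comparison_test')
  show "summable (\<lambda>i. ((cvec_norm (x i))\<^sup>2 + (cvec_norm (y i))\<^sup>2) / 2)"
    using assms by (intro summable_divide summable_add l2_summable)
  show "norm (vec_inner m (x i) (y i)) \<le> ((cvec_norm (x i))\<^sup>2 + (cvec_norm (y i))\<^sup>2) / 2" if "i \<ge> 0" for i
    using assms by (intro cmod_vec_inner_le l2_carrier)
qed

lemma l2_norm_sq: "x \<in> l2_space m \<Longrightarrow> (l2_norm x)\<^sup>2 = (\<Sum>i. (cvec_norm (x i))\<^sup>2)"
  unfolding l2_norm_def by (intro real_sqrt_pow2 suminf_nonneg l2_summable) auto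

lemma l2_inner_self: "x \<in> l2_space m \<Longrightarrow> l2_inner x x = of_real ((l2_norm x)\<^sup>2)"
  by (simp add: l2_inner_suminf l2_norm_sq vec_inner_self l2_carrier suminf_of_real[symmetric] l2_summable del: of_real_power)

lemma cmod_l2_inner_le:
  assumes "x \<in> l2_space m" "y \<in> l2_space m"
  shows "cmod (l2_inner x y) \<le> ((l2_norm x)\<^sup>2 + (l2_norm y)\<^sup>2) / 2"
proof -
  have s: "summable (\<lambda>i. ((cvec_norm (x i))\<^sup>2 + (cvec_norm (y i))\<^sup>2) / 2)"
    using assms by (intro summable_divide summable_add l2_summable)
  have "cmod (l2_inner x y) \<le> (\<Sum>i. ((cvec_norm (x i))\<^sup>2 + (cvec_norm (y i))\<^sup>2) / 2)"
    unfolding l2_inner_suminf[OF assms(1)]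
    using assms by (intro norm_suminf_le s cmod_vec_inner_le l2_carrier)
  also have "\<dots> = ((l2_norm x)\<^sup>2 + (l2_norm y)\<^sup>2) / 2"
    using assms by (simp add: l2_norm_sq suminf_divide suminf_add summable_add l2_summable)
  finally show ?thesis .
qed

lemma l2_scale:
  assumes "x \<in> l2_space m" shows "(\<lambda>i. c \<cdot>\<^sub>v x i) \<in> l2_space m"
proof -
  have "(cvec_norm (c \<cdot>\<^sub>v x i))\<^sup>2 = (cmod c)\<^sup>2 * (cvec_norm (x i))\<^sup>2" for i
    by (simp add: cvec_norm_sq norm_mult power_mult_distrib sum_distrib_left)
  then show ?thesis using assms by (auto simp: l2_space_def intro: summable_mult)
qed

lemma l2_add:
  assumes "x \<in> l2_space m" "y \<in> l2_space m" shows "(\<lambda>i. x i + y i) \<in> l2_space m"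
proof -
  have "summable (\<lambda>i. (cvec_norm (x i + y i))\<^sup>2)"
  proof (rule summable_comparison_test')
    show "summable (\<lambda>i. 2 * (cvec_norm (x i))\<^sup>2 + 2 * (cvec_norm (y i))\<^sup>2)"
      using assms by (intro summable_mult summable_add l2_summable)
    fix i :: nat
    have c: "x i \<in> carrier_vec m" "y i \<in> carrier_vec m" using assms by (auto intro: l2_carrier)
    have "(cvec_norm (x i + y i))\<^sup>2 = (\<Sum>r<m. (cmod (x i $ r + y i $ r))\<^sup>2)"
      using c by (auto simp: cvec_norm_sq)
    also have "\<dots> \<le> (\<Sum>r<m. 2 * (cmod (x i $ r))\<^sup>2 + 2 * (cmod (y i $ r))\<^sup>2)"
      by (intro sum_mono norm_add_sq_le)
    also have "\<dots> = 2 * (cvec_norm (x i))\<^sup>2 + 2 * (cvec_norm (y i))\<^sup>2"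
      using c by (auto simp: cvec_norm_sq sum.distrib sum_distrib_left)
    finally show "norm ((cvec_norm (x i + y i))\<^sup>2) \<le> 2 * (cvec_norm (x i))\<^sup>2 + 2 * (cvec_norm (y i))\<^sup>2" by simp
  qed
  then show ?thesis using assms by (auto simp: l2_space_def)
qed

lemma l2_inner_add_right:
  assumes "x \<in> l2_space m" "y \<in> l2_space m" "z \<in> l2_space m"
  shows "l2_inner x (\<lambda>i. y i + z i) = l2_inner x y + l2_inner x z"
proof -
  have "vec_inner m (x i) (y i + z i) = vec_inner m (x i) (y i) + vec_inner m (x i) (z i)" for i
    using carrier_vecD[OF l2_carrier[OF assms(2)]] carrier_vecD[OF l2_carrier[OF assms(3)]]
    by (simp add: vec_inner_def distrib_right sum.distrib)
  then show ?thesis using assms by (simp add: l2_inner_suminf suminf_add summable_vec_inner)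
qed

lemma l2_inner_add_left:
  assumes "x \<in> l2_space m" "y \<in> l2_space m" "z \<in> l2_space m"
  shows "l2_inner (\<lambda>i. y i + z i) x = l2_inner y x + l2_inner z x"
proof -
  have "vec_inner m (y i + z i) (x i) = vec_inner m (y i) (x i) + vec_inner m (z i) (x i)" for i
    using carrier_vecD[OF l2_carrier[OF assms(2)]] carrier_vecD[OF l2_carrier[OF assms(3)]]
    by (simp add: vec_inner_def distrib_left sum.distrib)
  then show ?thesis using assms by (simp add: l2_inner_suminf l2_add suminf_add summable_vec_inner)
qed

lemma l2_inner_scale_right:
  assumes "x \<in> l2_space m" "y \<in> l2_space m"
  shows "l2_inner x (\<lambda>i. c \<cdot>\<^sub>v y i) = c * l2_inner x y"
proof -
  have "vec_inner m (x i) (c \<cdot>\<^sub>v y i) = c * vec_inner m (x i) (y i)" for i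
    using carrier_vecD[OF l2_carrier[OF assms(2)]] by (simp add: vec_inner_def sum_distrib_left mult.assoc)
  then show ?thesis using assms by (simp add: l2_inner_suminf suminf_mult summable_vec_inner)
qed

lemma l2_inner_scale_left:
  assumes "x \<in> l2_space m" "y \<in> l2_space m"
  shows "l2_inner (\<lambda>i. c \<cdot>\<^sub>v y i) x = cnj c * l2_inner y x"
proof -
  have "vec_inner m (c \<cdot>\<^sub>v y i) (x i) = cnj c * vec_inner m (y i) (x i)" for i
    using carrier_vecD[OF l2_carrier[OF assms(2)]] by (simp add: vec_inner_def sum_distrib_left mult_ac)
  then show ?thesis using assms by (simp add: l2_inner_suminf l2_scale suminf_mult summable_vec_inner)
qed

text \<open>Expand the nonnegative form of \<^term>\<open>T\<close> at \<open>x - t S x\<close>, where \<open>S\<close> is the inverse of \<open>T\<close>.\<close>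

lemma positive_invertible_coercive:
  assumes T: "l2_bounded_operator m T" and P: "l2_positive_invertible m T"
  shows "\<exists>\<delta>>0. \<forall>x\<in>l2_space m. \<delta> * (l2_norm x)\<^sup>2 \<le> Re (l2_inner x (T x))"
proof -
  obtain S where S: "l2_bounded_operator m S" "\<And>x. x \<in> l2_space m \<Longrightarrow> S (T x) = x \<and> T (S x) = x"
    using P by (auto simp: l2_positive_invertible_def l2_invertible_def)
  obtain C where C: "\<And>x. x \<in> l2_space m \<Longrightarrow> l2_norm (S x) \<le> C * l2_norm x"
    using S(1) unfolding l2_bounded_operator_def by blast
  have herm: "l2_inner x (T y) = l2_inner (T x) y" if "x \<in> l2_space m" "y \<in> l2_space m" for x y
    using P that by (auto simp: l2_positive_invertible_def l2_hermitian_def)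
  have T_in: "T x \<in> l2_space m" if "x \<in> l2_space m" for x using T that by (simp add: l2_bounded_operator_def)
  have T_add: "T (\<lambda>i. x i + y i) = (\<lambda>i. T x i + T y i)" if "x \<in> l2_space m" "y \<in> l2_space m" for x y
    using T that by (simp add: l2_bounded_operator_def)
  have T_scale: "T (\<lambda>i. c \<cdot>\<^sub>v x i) = (\<lambda>i. c \<cdot>\<^sub>v T x i)" if "x \<in> l2_space m" for c x
    using T that by (simp add: l2_bounded_operator_def)
  have S_in: "S x \<in> l2_space m" if "x \<in> l2_space m" for x using S(1) that by (simp add: l2_bounded_operator_def)
  have nonneg: "Re (l2_inner x (T x)) \<ge> 0" if x: "x \<in> l2_space m" for x
  proof (cases "x = (\<lambda>_. 0\<^sub>v m)")
    case True
    have "l2_inner x (T x) = (\<Sum>i. vec_inner m (x i) (T x i))" by (rule l2_inner_suminf[OF x])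
    also have "\<dots> = 0" unfolding True by (simp add: vec_inner_def)
    finally show ?thesis by simp
  next
    case False
    then show ?thesis using P x by (auto simp: l2_positive_invertible_def intro: less_imp_le)
  qed
  \<comment> \<open>From \<open>cmod_l2_inner_le\<close> and the bound \<open>C\<close> on the
    inverse, \<open>Re (l2_inner (S x) x) \<le> K * (l2_norm x)\<^sup>2\<close>.\<close>
  define K where "K = (C\<^sup>2 + 1) / 2"
  have K: "K > 0" by (simp add: K_def add_nonneg_pos)
  show ?thesis
  proof (intro exI conjI ballI)
    show "1 / K > 0" using K by simp
    fix x assume x: "x \<in> l2_space m"
    \<comment> \<open>With \<open>K\<close> as upper bound, the expanded form is at most
      \<open>\<langle>x, T x\<rangle> + (2 * t + K * t\<^sup>2) * (l2_norm x)\<^sup>2\<close>. The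
      minimizing value is \<open>t = - (1 / K)\<close>, and it leaves the margin
      \<open>1 / K\<close>.\<close>
    define t where "t = complex_of_real (- (1 / K))"
    let ?tS = "\<lambda>i. t \<cdot>\<^sub>v S x i"
    let ?z = "\<lambda>i. x i + ?tS i"
    have tS: "?tS \<in> l2_space m" by (intro l2_scale S_in x)
    have z: "?z \<in> l2_space m" by (intro l2_add x tS)
    have "T ?z = (\<lambda>i. T x i + T ?tS i)" by (rule T_add[OF x tS])
    moreover have "T ?tS = (\<lambda>i. t \<cdot>\<^sub>v T (S x) i)" by (rule T_scale[OF S_in[OF x]])
    ultimately have Tz: "T ?z = (\<lambda>i. T x i + t \<cdot>\<^sub>v x i)" using S(2)[OF x] by simp
    have tx: "(\<lambda>i. t \<cdot>\<^sub>v x i) \<in> l2_space m" by (intro l2_scale x)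
    have Tz_in: "(\<lambda>i. T x i + t \<cdot>\<^sub>v x i) \<in> l2_space m" by (intro l2_add T_in x tx)
    have "l2_inner ?z (T ?z) = l2_inner x (\<lambda>i. T x i + t \<cdot>\<^sub>v x i) + l2_inner ?tS (\<lambda>i. T x i + t \<cdot>\<^sub>v x i)"
      unfolding Tz by (rule l2_inner_add_left[OF Tz_in x tS])
    also have "l2_inner ?tS (\<lambda>i. T x i + t \<cdot>\<^sub>v x i) = cnj t * l2_inner (S x) (\<lambda>i. T x i + t \<cdot>\<^sub>v x i)"
      by (rule l2_inner_scale_left[OF Tz_in S_in[OF x]])
    also have "l2_inner (S x) (\<lambda>i. T x i + t \<cdot>\<^sub>v x i) = l2_inner (S x) (T x) + t * l2_inner (S x) x"
      using x by (simp add: l2_inner_add_right l2_inner_scale_right S_in T_in tx)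
    also have "l2_inner (S x) (T x) = l2_inner x x" using herm[OF S_in[OF x] x] S(2)[OF x] by simp
    also have "l2_inner x (\<lambda>i. T x i + t \<cdot>\<^sub>v x i) = l2_inner x (T x) + t * l2_inner x x"
      using x by (simp add: l2_inner_add_right l2_inner_scale_right T_in tx)
    finally have eq: "l2_inner ?z (T ?z) = l2_inner x (T x) + t * l2_inner x x +
        cnj t * (l2_inner x x + t * l2_inner (S x) x)" .
    note eq
    also have "l2_inner x (T x) + t * l2_inner x x + cnj t * (l2_inner x x + t * l2_inner (S x) x) =
        l2_inner x (T x) + (of_real (- (2 / K) * (l2_norm x)\<^sup>2) + of_real (1 / K\<^sup>2) * l2_inner (S x) x)"
      by (simp add: l2_inner_self[OF x] t_def power2_eq_square algebra_simps)
    finally have "Re (l2_inner ?z (T ?z)) = Re (l2_inner x (T x)) + (- (2 / K) * (l2_norm x)\<^sup>2 + 1 / K\<^sup>2 * Re (l2_inner (S x) x))"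
      by (simp only: plus_complex.simps Re_mult_real Re_complex_of_real)
    then have "2 / K * (l2_norm x)\<^sup>2 \<le> Re (l2_inner x (T x)) + 1 / K\<^sup>2 * Re (l2_inner (S x) x)"
      using nonneg[OF z] by simp
    moreover have "Re (l2_inner (S x) x) \<le> K * (l2_norm x)\<^sup>2"
    proof -
      have "Re (l2_inner (S x) x) \<le> ((l2_norm (S x))\<^sup>2 + (l2_norm x)\<^sup>2) / 2"
        using cmod_l2_inner_le[OF S_in[OF x] x] complex_Re_le_cmod order_trans by blast
      also have "(l2_norm (S x))\<^sup>2 \<le> (C * l2_norm x)\<^sup>2"
        using C[OF x] S_in[OF x] by (intro power_mono) (auto simp: l2_norm_def intro!: suminf_nonneg l2_summable)
      finally show ?thesis by (simp add: K_def power_mult_distrib field_simps)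
    qed
    then have "1 / K\<^sup>2 * Re (l2_inner (S x) x) \<le> 1 / K\<^sup>2 * (K * (l2_norm x)\<^sup>2)" by (intro mult_left_mono) auto
    moreover have "1 / K\<^sup>2 * (K * (l2_norm x)\<^sup>2) = 1 / K * (l2_norm x)\<^sup>2" using K by (simp add: power2_eq_square)
    ultimately show "1 / K * (l2_norm x)\<^sup>2 \<le> Re (l2_inner x (T x))" by (simp add: field_simps)
  qed
qed

end

text \<open>Sequences supported on the first \<open>n\<close> places, given by a vector of length \<open>n * m\<close>.\<close>

definition embed :: "nat \<Rightarrow> nat \<Rightarrow> (nat \<Rightarrow> complex) \<Rightarrow> nat \<Rightarrow> complex vec" where
  "embed m n y = (\<lambda>i. if i < n then vec m (\<lambda>s. y (i * m + s)) else 0\<^sub>v m)"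

lemma embed_index: "i < n \<Longrightarrow> r < m \<Longrightarrow> embed m n y i $ r = y (i * m + r)"
  by (simp add: embed_def)

lemma embed_sums:
  "(\<lambda>i. (cvec_norm (embed m n y i))\<^sup>2) sums sq_sum (n * m) y"
proof -
  have "(\<lambda>i. (cvec_norm (embed m n y i))\<^sup>2) sums (\<Sum>i<n. (cvec_norm (embed m n y i))\<^sup>2)"
    by (rule sums_finite) (auto simp: embed_def cvec_norm_sq)
  also have "(\<Sum>i<n. (cvec_norm (embed m n y i))\<^sup>2) = sq_sum (n * m) y"
    by (simp add: embed_def cvec_norm_sq sq_sum_def sum_blocks)
  finally show ?thesis .
qed

lemma embed_l2: "embed m n y \<in> l2_space m"
  using embed_sums[of m n y] by (auto simp: l2_space_def embed_def sums_iff)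

lemma embed_norm: "(l2_norm (embed m n y))\<^sup>2 = sq_sum (n * m) y"
  using embed_sums[of m n y] by (simp add: l2_norm_sq[OF embed_l2] sums_iff)

lemma toeplitz_op_embed:
  assumes "r < m"
  shows "toeplitz_op m A (embed m n y) i $ r =
    (\<Sum>j<n. \<Sum>s<m. fc (\<lambda>\<theta>. A \<theta> $$ (r, s)) (int i - int j) * y (j * m + s))"
proof -
  have e: "(fourier_coeff m A l *\<^sub>v embed m n y j) $ r =
      (if j < n then \<Sum>s<m. fc (\<lambda>\<theta>. A \<theta> $$ (r, s)) l * y (j * m + s) else 0)" for l j
  proof -
    have "(fourier_coeff m A l *\<^sub>v embed m n y j) $ r = (\<Sum>s<m. fourier_coeff m A l $$ (r, s) * embed m n y j $ s)"
      using assms by (auto simp: embed_def fourier_coeff_def scalar_prod_def lessThan_atLeast0)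
    then show ?thesis using assms by (auto simp: fourier_coeff_index embed_def)
  qed
  have "toeplitz_op m A (embed m n y) i $ r =
      (\<Sum>j. if j < n then \<Sum>s<m. fc (\<lambda>\<theta>. A \<theta> $$ (r, s)) (int i - int j) * y (j * m + s) else 0)"
    unfolding toeplitz_op_def using assms by (simp add: e)
  also have "\<dots> = (\<Sum>j<n. \<Sum>s<m. fc (\<lambda>\<theta>. A \<theta> $$ (r, s)) (int i - int j) * y (j * m + s))"
    by (subst suminf_finite[of "{..<n}"]) auto
  finally show ?thesis .
qed

text \<open>On finitely supported sequences the form of the operator is the form of a truncation.
  Positivity passes from the operator to the truncations, and to the symbol, only through this
  identity.\<close>

lemma embed_form:
  "l2_inner (embed m n y) (toeplitz_op m A (embed m n z)) =
    (\<Sum>i<n. \<Sum>r<m. \<Sum>j<n. \<Sum>s<m. cnj (y (i * m + r)) * fc (\<lambda>\<theta>. A \<theta> $$ (r, s)) (int i - int j) * z (j * m + s))"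
proof -
  let ?f = "\<lambda>i. vec_inner m (embed m n y i) (toeplitz_op m A (embed m n z) i)"
  have "l2_inner (embed m n y) (toeplitz_op m A (embed m n z)) = suminf ?f"
    by (rule l2_inner_suminf[OF embed_l2])
  also have "\<dots> = (\<Sum>i<n. ?f i)"
    by (rule suminf_finite) (auto simp: vec_inner_def embed_def)
  also have "\<dots> = (\<Sum>i<n. \<Sum>r<m. \<Sum>j<n. \<Sum>s<m.
      cnj (y (i * m + r)) * fc (\<lambda>\<theta>. A \<theta> $$ (r, s)) (int i - int j) * z (j * m + s))"
    unfolding vec_inner_def
    by (intro sum.cong refl) (simp add: toeplitz_op_embed embed_index sum_distrib_left mult_ac)
  finally show ?thesis .
qed

section \<open>Positivity of the symbol\<close>

lemma fc_cnj: "fc (\<lambda>\<theta>. cnj (f \<theta>)) n = cnj (fc f (- n))"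
  unfolding fc_def mean_cnj[symmetric] by (simp add: cnj_chr)

lemma bform_real_mat:
  assumes "B \<in> carrier_mat N N"
  shows "bform (\<lambda>a b. real_mat B $$ (a, b)) N x y =
    Re (\<Sum>p<N. \<Sum>q<N. cnj (of_real (x p)) * B $$ (p, q) * of_real (y q))"
  unfolding bform_def Re_sum using assms by (intro sum.cong refl) simp

text \<open>Approximate the indicator of \<open>{\<theta>. Re (G \<theta>) < 0}\<close> by a trigonometric polynomial in mean square.\<close>

lemma nonneg_of_trig_forms:
  assumes G: "bmeas G"
    and form: "\<And>S c. finite S \<Longrightarrow> 0 \<le> Re (mean (\<lambda>\<theta>. G \<theta> * ((\<Sum>n\<in>S. c n * chr n \<theta>) * cnj (\<Sum>n\<in>S. c n * chr n \<theta>))))"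
  shows "AE \<theta> in circ. 0 \<le> Re (G \<theta>)"
proof -
  obtain M where M: "M > 0" "AE \<theta> in circ. cmod (G \<theta>) \<le> M" using G by (rule bmeasE)
  define u where "u \<theta> = (if Re (G \<theta>) < 0 then 1 else 0 :: complex)" for \<theta>
  have u: "bmeas u"
  proof (rule bmeasI[of _ 1])
    have "{\<theta> \<in> space circ. Re (G \<theta>) < 0} \<in> sets circ"
      using bmeasD[OF G] by (intro borel_measurable_less borel_measurable_const) simp
    then show "u \<in> borel_measurable circ" unfolding u_def by (intro measurable_If measurable_const) auto
  qed (auto simp: u_def)
  have Gu: "bmeas (\<lambda>\<theta>. G \<theta> * u \<theta>)" by (intro bmeas_mult G u)
  have lower: "- (3 * M * e) \<le> Re (mean (\<lambda>\<theta>. G \<theta> * u \<theta>))" if e: "e > 0" "e \<le> 1" for e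
  proof -
    have "e\<^sup>2 > 0" using e by simp
    then obtain S c where S: "finite S" "msq (\<lambda>\<theta>. u \<theta> - (\<Sum>n\<in>S. c n * chr n \<theta>)) < e\<^sup>2"
      using trig_poly_dense[OF u] by blast
    define p where "p \<theta> = (\<Sum>n\<in>S. c n * chr n \<theta>)" for \<theta>
    define v where "v \<theta> = u \<theta> - p \<theta>" for \<theta>
    have p: "bmeas p" unfolding p_def by (intro bmeas_sum bmeas_cmult bmeas_chr)
    have v: "bmeas v" unfolding v_def by (intro bmeas_diff u p)
    have mv: "Re (mean (\<lambda>\<theta>. v \<theta> * cnj (v \<theta>))) < e\<^sup>2" using S(2) by (simp add: msq_def v_def p_def)
    \<comment> \<open>The squared moduli of \<open>p\<close> and \<open>u\<close> differ by at most
      \<open>w\<^sup>2 + 2 * w\<close>, where \<open>w\<close> is the modulus of \<open>v\<close>.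
      Splitting \<open>2 * w \<le> w\<^sup>2 / e + e\<close> is balanced against the mean square of
      \<open>v\<close>, which is below \<open>e\<^sup>2\<close>, so every term is of order
      \<open>M * e\<close>.\<close>
    let ?R = "\<lambda>\<theta>. G \<theta> * u \<theta> + (of_real (M * (1 + 1 / e)) * (v \<theta> * cnj (v \<theta>)) + of_real (M * e))"
    have "0 \<le> Re (mean (\<lambda>\<theta>. G \<theta> * (p \<theta> * cnj (p \<theta>))))" unfolding p_def by (rule form[OF S(1)])
    also have "\<dots> \<le> Re (mean ?R)"
    proof (rule Re_mean_mono)
      show "bmeas (\<lambda>\<theta>. G \<theta> * (p \<theta> * cnj (p \<theta>)))" "bmeas ?R"
        by (intro bmeas_add bmeas_mult bmeas_cnj bmeas_const G p u v)+
      show "AE \<theta> in circ. Re (G \<theta> * (p \<theta> * cnj (p \<theta>))) \<le> Re (?R \<theta>)"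
        using M(2)
      proof eventually_elim
        case (elim \<theta>)
        define a b w where "a = cmod (p \<theta>)" and "b = cmod (u \<theta>)" and "w = cmod (v \<theta>)"
        have ab: "\<bar>a - b\<bar> \<le> w" unfolding a_def b_def w_def v_def
          by (metis norm_minus_commute norm_triangle_ineq3)
        have b01: "b = 0 \<or> b = 1" by (simp add: b_def u_def)
        have "\<bar>a\<^sup>2 - b\<^sup>2\<bar> \<le> w\<^sup>2 + 2 * b * w"
        proof -
          have "\<bar>a - b\<bar> * (a + b) \<le> w * (w + 2 * b)"
            using ab b01 by (intro mult_mono) (auto simp: a_def w_def)
          moreover have "\<bar>a\<^sup>2 - b\<^sup>2\<bar> = \<bar>a - b\<bar> * \<bar>a + b\<bar>"
            by (simp add: abs_mult[symmetric] power2_eq_square algebra_simps)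
          moreover have "\<bar>a + b\<bar> = a + b" by (simp add: a_def b_def)
          ultimately show ?thesis by (simp add: power2_eq_square algebra_simps)
        qed
        also have "\<dots> \<le> (1 + 1 / e) * w\<^sup>2 + e"
        proof -
          have "0 \<le> (w - e)\<^sup>2 / e" using e by simp
          also have "\<dots> = w\<^sup>2 / e - 2 * w + e" using e by (simp add: power2_eq_square field_simps)
          finally have "2 * w \<le> w\<^sup>2 / e + e" by simp
          moreover have "0 \<le> w\<^sup>2 / e + e" using e by simp
          ultimately show ?thesis using b01 by (auto simp: algebra_simps)
        qed
        finally have ab2: "\<bar>a\<^sup>2 - b\<^sup>2\<bar> \<le> (1 + 1 / e) * w\<^sup>2 + e" .
        have "Re (G \<theta>) * (a\<^sup>2 - b\<^sup>2) \<le> \<bar>Re (G \<theta>)\<bar> * \<bar>a\<^sup>2 - b\<^sup>2\<bar>" by (metis abs_ge_self abs_mult)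
        also have "\<dots> \<le> M * ((1 + 1 / e) * w\<^sup>2 + e)"
          using elim ab2 abs_Re_le_cmod[of "G \<theta>"] M(1) by (intro mult_mono) auto
        finally have fin: "Re (G \<theta>) * a\<^sup>2 \<le> Re (G \<theta>) * b\<^sup>2 + M * ((1 + 1 / e) * w\<^sup>2 + e)"
          by (simp add: algebra_simps)
        have r1: "Re (G \<theta> * (p \<theta> * cnj (p \<theta>))) = Re (G \<theta>) * a\<^sup>2"
          unfolding mult_cnj a_def by (simp del: of_real_power)
        have r2: "Re (G \<theta> * u \<theta>) = Re (G \<theta>) * b\<^sup>2" by (simp add: u_def b_def)
        have r3: "Re (of_real (M * (1 + 1 / e)) * (v \<theta> * cnj (v \<theta>))) = M * (1 + 1 / e) * w\<^sup>2"
          unfolding mult_cnj w_def by (simp only: Re_mult_real Re_complex_of_real)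
        show ?case unfolding plus_complex.simps r1 r2 r3 Re_complex_of_real using fin by (simp add: algebra_simps)
      qed
    qed
    also have "mean ?R = mean (\<lambda>\<theta>. G \<theta> * u \<theta>) + (of_real (M * (1 + 1 / e)) * mean (\<lambda>\<theta>. v \<theta> * cnj (v \<theta>)) + of_real (M * e))"
    proof -
      have "mean (\<lambda>_. of_real (M * e)) = of_real (M * e)" using fc_const[of "of_real (M * e)" 0] by (simp add: fc_def)
      then show ?thesis
        by (subst mean_add, intro Gu, intro bmeas_add bmeas_mult bmeas_cnj bmeas_const v,
            subst mean_add, intro bmeas_mult bmeas_cnj bmeas_const v, intro bmeas_const)
          (simp only: mean_cmult)
    qed
    also have "Re \<dots> = Re (mean (\<lambda>\<theta>. G \<theta> * u \<theta>)) + (M * (1 + 1 / e) * Re (mean (\<lambda>\<theta>. v \<theta> * cnj (v \<theta>))) + M * e)"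
      unfolding plus_complex.simps Re_mult_real Re_complex_of_real ..
    also have "\<dots> \<le> Re (mean (\<lambda>\<theta>. G \<theta> * u \<theta>)) + (M * (1 + 1 / e) * e\<^sup>2 + M * e)"
      using mv M(1) e by (intro add_mono mult_left_mono order_refl) auto
    also have "M * (1 + 1 / e) * e\<^sup>2 + M * e = M * (e * e + 2 * e)"
      using e by (simp add: power2_eq_square field_simps)
    also have "\<dots> \<le> M * (3 * e)" using e M(1) by (intro mult_left_mono) (auto simp: mult_left_le)
    finally show ?thesis by (simp add: mult.assoc mult.left_commute)
  qed
  have "0 \<le> Re (mean (\<lambda>\<theta>. G \<theta> * u \<theta>))"
  proof (rule ccontr)
    assume "\<not> ?thesis"
    then have neg: "Re (mean (\<lambda>\<theta>. G \<theta> * u \<theta>)) < 0" by simp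
    \<comment> \<open>Chosen so that the error \<open>3 * M * e\<close> is at most half of the
      supposed negative value; the 1 secures \<open>e \<le> 1\<close>.\<close>
    define e where "e = min 1 (- Re (mean (\<lambda>\<theta>. G \<theta> * u \<theta>)) / (6 * M))"
    have e: "e > 0" "e \<le> 1" using divide_neg_pos[OF neg, of "6 * M"] M(1) by (auto simp: e_def)
    have "3 * M * e \<le> 3 * M * (- Re (mean (\<lambda>\<theta>. G \<theta> * u \<theta>)) / (6 * M))"
      using M(1) by (intro mult_left_mono) (auto simp: e_def)
    also have "\<dots> = - Re (mean (\<lambda>\<theta>. G \<theta> * u \<theta>)) / 2" using M(1) by simp
    finally show False using lower[OF e] neg by simp
  qed
  \<comment> \<open>The real part of \<open>G u\<close> is nowhere positive, yet its integral is
    nonnegative; hence it vanishes almost everywhere.\<close>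
  then have ge: "(LINT \<theta>|circ. Re (G \<theta> * u \<theta>)) \<ge> 0"
    unfolding Re_mean[OF Gu] using pi_gt_zero by (auto simp: zero_le_divide_iff simp del: times_complex.sel)
  have int: "integrable circ (\<lambda>\<theta>. - Re (G \<theta> * u \<theta>))"
    by (intro Bochner_Integration.integrable_minus integrable_Re bmeas_integrable Gu)
  have nn: "AE \<theta> in circ. 0 \<le> - Re (G \<theta> * u \<theta>)" by (intro AE_I2) (auto simp: u_def)
  have "(LINT \<theta>|circ. - Re (G \<theta> * u \<theta>)) \<ge> 0" by (rule integral_nonneg_AE[OF nn])
  then have "(LINT \<theta>|circ. - Re (G \<theta> * u \<theta>)) = 0"
    using ge Bochner_Integration.integral_minus[of circ "\<lambda>\<theta>. Re (G \<theta> * u \<theta>)"] by linarith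
  then have "AE \<theta> in circ. - Re (G \<theta> * u \<theta>) = 0"
    using integral_nonneg_eq_0_iff_AE[OF int nn] by simp
  then show ?thesis by eventually_elim (auto simp: u_def split: if_splits)
qed

lemma mean_trig_form:
  assumes g: "bmeas g" and S: "finite S"
  shows "mean (\<lambda>\<theta>. g \<theta> * ((\<Sum>n\<in>S. c n * chr n \<theta>) * cnj (\<Sum>n\<in>S. c n * chr n \<theta>))) =
    (\<Sum>a\<in>S. \<Sum>b\<in>S. cnj (c a) * fc g (a - b) * c b)"
proof -
  have "g \<theta> * ((\<Sum>n\<in>S. c n * chr n \<theta>) * cnj (\<Sum>n\<in>S. c n * chr n \<theta>)) =
      (\<Sum>a\<in>S. \<Sum>b\<in>S. (cnj (c a) * c b) * (g \<theta> * chr (- (a - b)) \<theta>))" for \<theta>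
  proof -
    have "(\<Sum>n\<in>S. c n * chr n \<theta>) * cnj (\<Sum>n\<in>S. c n * chr n \<theta>) =
        (\<Sum>a\<in>S. \<Sum>b\<in>S. (c b * chr b \<theta>) * (cnj (c a) * chr (- a) \<theta>))"
      by (simp add: sum_product cnj_chr) (rule sum.swap)
    also have "\<dots> = (\<Sum>a\<in>S. \<Sum>b\<in>S. (cnj (c a) * c b) * chr (- (a - b)) \<theta>)"
    proof (intro sum.cong refl)
      fix a b
      have "chr (- (a - b)) \<theta> = chr b \<theta> * chr (- a) \<theta>" by (simp add: chr_mult)
      then show "c b * chr b \<theta> * (cnj (c a) * chr (- a) \<theta>) = cnj (c a) * c b * chr (- (a - b)) \<theta>" by simp
    qed
    finally show ?thesis by (simp add: sum_distrib_left mult_ac)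
  qed
  then have "mean (\<lambda>\<theta>. g \<theta> * ((\<Sum>n\<in>S. c n * chr n \<theta>) * cnj (\<Sum>n\<in>S. c n * chr n \<theta>))) =
      mean (\<lambda>\<theta>. \<Sum>a\<in>S. \<Sum>b\<in>S. (cnj (c a) * c b) * (g \<theta> * chr (- (a - b)) \<theta>))" by simp
  also have "\<dots> = (\<Sum>a\<in>S. \<Sum>b\<in>S. (cnj (c a) * c b) * fc g (a - b))"
    by (subst mean_sum, intro bmeas_sum bmeas_cmult bmeas_mult g bmeas_chr, intro sum.cong refl,
        subst mean_sum, intro bmeas_cmult bmeas_mult g bmeas_chr, simp only: mean_cmult fc_def)
  finally show ?thesis by (simp add: mult_ac)
qed

locale positive_toeplitz =
  fixes m :: nat and A :: "real \<Rightarrow> complex mat"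
  assumes bs: "bsymbol m A"
    and psym: "partially_symmetric m A"
    and bounded: "l2_bounded_operator m (toeplitz_op m A)"
    and posinv: "l2_positive_invertible m (toeplitz_op m A)"
begin

abbreviation a where "a r s \<equiv> \<lambda>\<theta>. A \<theta> $$ (r, s)"

lemma bmeas_a: "r < m \<Longrightarrow> s < m \<Longrightarrow> bmeas (a r s)"
  using bs by (simp add: bsymbol_def)

lemma A_carrier: "\<theta> \<in> {-pi..pi} \<Longrightarrow> A \<theta> \<in> carrier_mat m m"
  using bs by (simp add: bsymbol_def)

lemma fc_a_real: "r < m \<Longrightarrow> s < m \<Longrightarrow> fc (a r s) n \<in> \<real>"
proof -
  assume rs: "r < m" "s < m"
  have "fourier_coeff m A n $$ (r, s) \<in> elements_mat (fourier_coeff m A n)"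
    using rs by (intro elements_matI[of _ m m r s]) (auto simp: fourier_coeff_def)
  then show ?thesis using psym rs by (auto simp: partially_symmetric_def fourier_coeff_index)
qed

lemma fc_a_even: "r < m \<Longrightarrow> s < m \<Longrightarrow> fc (a r s) (- n) = fc (a r s) n"
  using psym fourier_coeff_index[of r m s A "- n"] fourier_coeff_index[of r m s A n]
  by (simp add: partially_symmetric_def)

text \<open>Partial symmetry relates \<open>A_n\<close> to \<open>A_{-n}\<close> but does not say
  that a block is symmetric. Evaluating the Hermitian operator on two coordinate sequences equates
  one entry with the conjugate of the transposed entry at the opposite frequency; reality removes
  the conjugate, evenness the sign.\<close>

lemma fc_a_sym:
  assumes rs: "r < m" "s < m" shows "fc (a r s) l = fc (a s r) l"
proof -
  have *: "fc (a r s) (int i - int j) = fc (a s r) (int i - int j)" for i j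
  proof -
    define n where "n = Suc (i + j)"
    define y where "y = (\<lambda>p. if p = i * m + r then 1 else 0 :: complex)"
    define z where "z = (\<lambda>p. if p = j * m + s then 1 else 0 :: complex)"
    have ij: "i < n" "j < n" by (auto simp: n_def)
    have single: "(\<Sum>i'<n. \<Sum>r'<m. (if i' * m + r' = i * m + r then f i' r' else 0)) = f i r"
      if "i < n" "r < m" for i r and f :: "nat \<Rightarrow> nat \<Rightarrow> complex"
    proof -
      have "(i' * m + r' = i * m + r) = (i' = i \<and> r' = r)" if "r' < m" for i' r'
        using block_index(2,3)[of i' "Suc i'" r' m] block_index(2,3)[of i "Suc i" r m] that \<open>r < m\<close> by (metis lessI)
      then have "(\<Sum>i'<n. \<Sum>r'<m. (if i' * m + r' = i * m + r then f i' r' else 0)) =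
          (\<Sum>i'<n. \<Sum>r'<m. (if i' = i then if r' = r then f i' r' else 0 else 0))"
        by (intro sum.cong refl) auto
      also have "\<dots> = (\<Sum>i'<n. if i' = i then \<Sum>r'<m. (if r' = r then f i' r' else 0) else 0)"
        by (intro sum.cong refl) auto
      also have "\<dots> = f i r" using that by simp
      finally show ?thesis .
    qed
    have form: "l2_inner (embed m n y) (toeplitz_op m A (embed m n z)) = fc (a r s) (int i - int j)"
      "l2_inner (embed m n z) (toeplitz_op m A (embed m n y)) = fc (a s r) (int j - int i)"
    proof -
      have "l2_inner (embed m n y) (toeplitz_op m A (embed m n z)) =
          (\<Sum>i'<n. \<Sum>r'<m. if i' * m + r' = i * m + r then
            (\<Sum>j'<n. \<Sum>s'<m. if j' * m + s' = j * m + s then fc (a r' s') (int i' - int j') else 0) else 0)"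
        unfolding embed_form y_def z_def by (intro sum.cong refl) (auto intro!: sum.cong)
      then show "l2_inner (embed m n y) (toeplitz_op m A (embed m n z)) = fc (a r s) (int i - int j)"
        using ij rs by (simp add: single)
      have "l2_inner (embed m n z) (toeplitz_op m A (embed m n y)) =
          (\<Sum>i'<n. \<Sum>r'<m. if i' * m + r' = j * m + s then
            (\<Sum>j'<n. \<Sum>s'<m. if j' * m + s' = i * m + r then fc (a r' s') (int i' - int j') else 0) else 0)"
        unfolding embed_form y_def z_def by (intro sum.cong refl) (auto intro!: sum.cong)
      then show "l2_inner (embed m n z) (toeplitz_op m A (embed m n y)) = fc (a s r) (int j - int i)"
        using ij rs by (simp add: single)
    qed
    have in_l2: "toeplitz_op m A (embed m n x) \<in> l2_space m" for x
      using bounded embed_l2 by (auto simp: l2_bounded_operator_def)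
    have "l2_inner (embed m n y) (toeplitz_op m A (embed m n z)) = l2_inner (toeplitz_op m A (embed m n y)) (embed m n z)"
      using posinv embed_l2 by (auto simp: l2_positive_invertible_def l2_hermitian_def)
    also have "\<dots> = (\<Sum>i. cnj (vec_inner m (embed m n z i) (toeplitz_op m A (embed m n y) i)))"
      unfolding l2_inner_suminf[OF in_l2] by (simp add: vec_inner_def mult.commute)
    also have "\<dots> = cnj (l2_inner (embed m n z) (toeplitz_op m A (embed m n y)))"
      unfolding l2_inner_suminf[OF embed_l2] 
      using summable_sums[OF summable_vec_inner[OF embed_l2 in_l2]] by (intro sums_unique[symmetric]) (simp only: sums_cnj)
    finally have "fc (a r s) (int i - int j) = cnj (fc (a s r) (int j - int i))" unfolding form .
    also have "\<dots> = fc (a s r) (int j - int i)" using fc_a_real[OF rs(2,1)] by (simp add: Reals_cnj_iff)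
    also have "\<dots> = fc (a s r) (int i - int j)" using fc_a_even[OF rs(2,1), of "int j - int i"] by simp
    finally show ?thesis .
  qed
  \<comment> \<open>Any integer is the difference of its positive and negative part, one of which is
    0.\<close>
  show ?thesis using *[of "nat l" "nat (- l)"] by (cases "l \<ge> 0") auto
qed

text \<open>Conjugating a function conjugates its coefficients and reverses their order, so real and
  even coefficients belong to an almost everywhere real function. Symmetry follows likewise from
  \<open>fc_unique\<close>.\<close>

lemma AE_real_symmetric:
  "AE \<theta> in circ. \<forall>r<m. \<forall>s<m. A \<theta> $$ (r, s) \<in> \<real> \<and> A \<theta> $$ (r, s) = A \<theta> $$ (s, r)"
proof -
  have "AE \<theta> in circ. A \<theta> $$ (r, s) \<in> \<real> \<and> A \<theta> $$ (r, s) = A \<theta> $$ (s, r)" if "r < m" "s < m" for r s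
  proof -
    have "AE \<theta> in circ. cnj (a r s \<theta>) = a r s \<theta>"
    proof (rule fc_unique)
      fix n
      show "fc (\<lambda>\<theta>. cnj (a r s \<theta>)) n = fc (a r s) n"
        unfolding fc_cnj using fc_a_even[OF that] fc_a_real[OF that] by (simp add: Reals_cnj_iff)
    qed (use that bmeas_a in auto)
    moreover have "AE \<theta> in circ. a r s \<theta> = a s r \<theta>"
      using that by (intro fc_unique bmeas_a fc_a_sym)
    ultimately show ?thesis by eventually_elim (auto simp: Reals_cnj_iff)
  qed
  then have "AE \<theta> in circ. \<forall>r\<in>{..<m}. \<forall>s\<in>{..<m}. A \<theta> $$ (r, s) \<in> \<real> \<and> A \<theta> $$ (r, s) = A \<theta> $$ (s, r)"
    by (intro AE_finite_allI) auto
  then show ?thesis by eventually_elim auto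
qed

lemma posdef_toeplitz: "posdef_mat (n * m) (real_mat (toeplitz_mat m A n))"
  unfolding posdef_mat_def
proof (intro conjI allI impI)
  show "real_mat (toeplitz_mat m A n) \<in> carrier_mat (n * m) (n * m)" by (simp add: toeplitz_mat_carrier)
  show "real_mat (toeplitz_mat m A n) $$ (p, q) = real_mat (toeplitz_mat m A n) $$ (q, p)"
    if pq: "p < n * m" "q < n * m" for p q
  proof -
    have "m > 0" using pq by (cases m) auto
    then have *: "p mod m < m" "q mod m < m" by simp_all
    have "fc (a (p mod m) (q mod m)) (int (p div m) - int (q div m)) =
        fc (a (q mod m) (p mod m)) (- (int (q div m) - int (p div m)))"
      using fc_a_sym[OF *] by simp
    also have "\<dots> = fc (a (q mod m) (p mod m)) (int (q div m) - int (p div m))" by (rule fc_a_even[OF *(2,1)])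
    finally show ?thesis using pq * by (simp add: toeplitz_mat_def fourier_coeff_index)
  qed
  show "0 < bform (\<lambda>p q. real_mat (toeplitz_mat m A n) $$ (p, q)) (n * m) x x"
    if p: "p < n * m" "x p \<noteq> 0" for x p
  proof -
    define y where "y = (\<lambda>p. complex_of_real (x p))"
    have "m > 0" using p by (cases m) auto
    then have pm: "p div m < n" "p mod m < m" using p by (auto simp: less_mult_imp_div_less)
    have "embed m n y (p div m) $ (p mod m) = y p" using pm by (simp add: embed_index)
    then have "embed m n y \<noteq> (\<lambda>_. 0\<^sub>v m)" using p pm by (auto simp: y_def)
    then have "0 < Re (l2_inner (embed m n y) (toeplitz_op m A (embed m n y)))"
      using posinv embed_l2 by (auto simp: l2_positive_invertible_def)
    also have "l2_inner (embed m n y) (toeplitz_op m A (embed m n y)) =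
        (\<Sum>p<n * m. \<Sum>q<n * m. cnj (of_real (x p)) * toeplitz_mat m A n $$ (p, q) * of_real (x q))"
      unfolding embed_form sum_blocks by (intro sum.cong refl) (simp add: y_def toeplitz_mat_index)
    finally show ?thesis unfolding bform_real_mat[OF toeplitz_mat_carrier] .
  qed
qed

text \<open>For fixed \<open>x\<close>, test sequences of the form \<open>c_i x\<close> reduce the
  operator to a scalar Toeplitz form with symbol
  \<open>g \<theta> = \<langle>x, A(\<theta>) x\<rangle>\<close>. Coercivity says that
  \<open>g\<close> minus the constant \<open>d * sq_sum m x\<close> has nonnegative trigonometric
  forms. The exceptional null set still depends on \<open>x\<close>, the constant does not.\<close>

lemma AE_coercive:
  "\<exists>\<delta>>0. \<forall>x. AE \<theta> in circ. \<delta> * sq_sum m x \<le> Re (\<Sum>r<m. \<Sum>s<m. cnj (x r) * A \<theta> $$ (r, s) * x s)"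
proof -
  obtain d where d: "d > 0" "\<And>x. x \<in> l2_space m \<Longrightarrow> d * (l2_norm x)\<^sup>2 \<le> Re (l2_inner x (toeplitz_op m A x))"
    using positive_invertible_coercive[OF bounded posinv] by blast
  show ?thesis
  proof (intro exI[of _ d] conjI allI)
    fix x
    define g where "g \<theta> = (\<Sum>r<m. \<Sum>s<m. (cnj (x r) * x s) * A \<theta> $$ (r, s))" for \<theta>
    define G where "G \<theta> = g \<theta> - of_real (d * sq_sum m x)" for \<theta>
    have g: "bmeas g" unfolding g_def by (intro bmeas_sum bmeas_cmult bmeas_a) auto
    have G: "bmeas G" unfolding G_def by (intro bmeas_diff g bmeas_const)
    have fg: "fc g l = (\<Sum>r<m. \<Sum>s<m. (cnj (x r) * x s) * fc (a r s) l)" for l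
      unfolding g_def
      by (subst fc_sum, intro bmeas_sum bmeas_cmult bmeas_a, simp_all, intro sum.cong refl,
          subst fc_sum, intro bmeas_cmult bmeas_a, simp_all add: fc_cmult)
    have "AE \<theta> in circ. 0 \<le> Re (G \<theta>)"
    proof (rule nonneg_of_trig_forms[OF G])
      fix S :: "int set" and c :: "int \<Rightarrow> complex" assume S: "finite S"
      obtain N where N: "\<And>l. l \<in> S \<Longrightarrow> \<bar>l\<bar> \<le> int N"
      proof -
        have "\<bar>l\<bar> \<le> int (nat (Max (insert 0 (abs ` S))))" if "l \<in> S" for l
          using that S by (auto intro!: Max_ge simp: le_nat_iff)
        then show ?thesis using that by blast
      qed
      define n where "n = Suc (2 * N)"
      \<comment> \<open>Frequencies in \<open>S\<close> may be negative, positions in a sequence may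
        not. A shift by \<open>N\<close> is harmless because a Toeplitz form depends only on
        differences.\<close>
      define c' where "c' i = (if int i - int N \<in> S then c (int i - int N) else 0)" for i :: nat
      have reindex: "(\<Sum>i<n. if int i - int N \<in> S then f (int i - int N) else 0) = (\<Sum>l\<in>S. f l)"
        for f :: "int \<Rightarrow> 'z :: comm_monoid_add"
      proof -
        have "(\<Sum>l\<in>S. f l) = (\<Sum>i\<in>{i \<in> {..<n}. int i - int N \<in> S}. f (int i - int N))"
        proof (rule sum.reindex_bij_witness[of _ "\<lambda>i. int i - int N" "\<lambda>l. nat (l + int N)"])
          fix l assume l: "l \<in> S"
          then have "\<bar>l\<bar> \<le> int N" by (rule N)
          then show "int (nat (l + int N)) - int N = l" "nat (l + int N) \<in> {i \<in> {..<n}. int i - int N \<in> S}"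
            "f (int (nat (l + int N)) - int N) = f l"
            using l by (auto simp: n_def)
        qed auto
        then show ?thesis by (subst (asm) sum.inter_filter) auto
      qed
      define y where "y p = c' (p div m) * x (p mod m)" for p
      have y: "y (i * m + r) = c' i * x r" if "r < m" for i r
        using block_index(2,3)[of i "Suc i" r m] that by (simp add: y_def)
      have inner: "l2_inner (embed m n y) (toeplitz_op m A (embed m n y)) =
          (\<Sum>i\<in>S. \<Sum>j\<in>S. cnj (c i) * fc g (i - j) * c j)"
      proof -
        have "l2_inner (embed m n y) (toeplitz_op m A (embed m n y)) =
            (\<Sum>i<n. \<Sum>r<m. \<Sum>j<n. \<Sum>s<m. cnj (c' i) * ((cnj (x r) * x s) * fc (a r s) (int i - int j)) * c' j)"
          unfolding embed_form by (intro sum.cong refl) (simp add: y mult_ac)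
        also have "\<dots> = (\<Sum>i<n. \<Sum>j<n. \<Sum>r<m. \<Sum>s<m. cnj (c' i) * ((cnj (x r) * x s) * fc (a r s) (int i - int j)) * c' j)"
          by (intro sum.cong refl sum.swap)
        also have "\<dots> = (\<Sum>i<n. \<Sum>j<n. cnj (c' i) * fc g (int i - int j) * c' j)"
          unfolding fg by (simp add: sum_distrib_left sum_distrib_right)
        also have "\<dots> = (\<Sum>i<n. if int i - int N \<in> S then
            (\<Sum>j<n. if int j - int N \<in> S then
              cnj (c (int i - int N)) * fc g ((int i - int N) - (int j - int N)) * c (int j - int N) else 0) else 0)"
          by (intro sum.cong refl) (auto simp: c'_def intro!: sum.cong)
        also have "\<dots> = (\<Sum>i\<in>S. \<Sum>j\<in>S. cnj (c i) * fc g (i - j) * c j)"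
          unfolding reindex[of "\<lambda>j. cnj (c (int i - int N)) * fc g (int i - int N - j) * c j" for i]
          by (rule reindex[of "\<lambda>i. \<Sum>j\<in>S. cnj (c i) * fc g (i - j) * c j"])
        finally show ?thesis .
      qed
      have "sq_sum (n * m) y = (\<Sum>i<n. (cmod (c' i))\<^sup>2 * sq_sum m x)"
        unfolding sq_sum_def sum_blocks
        by (intro sum.cong refl) (simp add: y norm_mult power_mult_distrib sum_distrib_left)
      also have "\<dots> = (\<Sum>i<n. if int i - int N \<in> S then (cmod (c (int i - int N)))\<^sup>2 * sq_sum m x else 0)"
        by (intro sum.cong refl) (auto simp: c'_def)
      also have "\<dots> = (\<Sum>l\<in>S. (cmod (c l))\<^sup>2 * sq_sum m x)" by (rule reindex)
      finally have nrm: "sq_sum (n * m) y = (\<Sum>l\<in>S. (cmod (c l))\<^sup>2) * sq_sum m x" by (simp add: sum_distrib_right)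
      define p where "p \<theta> = (\<Sum>l\<in>S. c l * chr l \<theta>)" for \<theta>
      have p: "bmeas p" unfolding p_def by (intro bmeas_sum bmeas_cmult bmeas_chr)
      have "mean (\<lambda>\<theta>. G \<theta> * (p \<theta> * cnj (p \<theta>))) =
          mean (\<lambda>\<theta>. g \<theta> * (p \<theta> * cnj (p \<theta>)) - of_real (d * sq_sum m x) * (p \<theta> * cnj (p \<theta>)))"
        by (simp add: G_def left_diff_distrib)
      also have "\<dots> = mean (\<lambda>\<theta>. g \<theta> * (p \<theta> * cnj (p \<theta>))) - of_real (d * sq_sum m x) * mean (\<lambda>\<theta>. p \<theta> * cnj (p \<theta>))"
        by (subst mean_diff, intro bmeas_mult bmeas_cnj g p, intro bmeas_cmult bmeas_mult bmeas_cnj p, simp only: mean_cmult)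
      also have "mean (\<lambda>\<theta>. g \<theta> * (p \<theta> * cnj (p \<theta>))) = (\<Sum>i\<in>S. \<Sum>j\<in>S. cnj (c i) * fc g (i - j) * c j)"
        unfolding p_def by (rule mean_trig_form[OF g S])
      also have "mean (\<lambda>\<theta>. p \<theta> * cnj (p \<theta>)) = of_real (\<Sum>l\<in>S. (cmod (c l))\<^sup>2)"
        using msq_complex[of p] msq_trig[OF S, of c] by (simp only: p_def[abs_def])
      finally have "Re (mean (\<lambda>\<theta>. G \<theta> * (p \<theta> * cnj (p \<theta>)))) =
          Re (l2_inner (embed m n y) (toeplitz_op m A (embed m n y))) - d * sq_sum (n * m) y"
        unfolding inner nrm by (simp only: minus_complex.simps Re_mult_real Re_complex_of_real mult_ac)
      also have "\<dots> \<ge> 0" using d(2)[OF embed_l2, of n y] by (simp add: embed_norm)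
      finally show "0 \<le> Re (mean (\<lambda>\<theta>. G \<theta> * ((\<Sum>n\<in>S. c n * chr n \<theta>) * cnj (\<Sum>n\<in>S. c n * chr n \<theta>))))"
        unfolding p_def .
    qed
    then show "AE \<theta> in circ. d * sq_sum m x \<le> Re (\<Sum>r<m. \<Sum>s<m. cnj (x r) * A \<theta> $$ (r, s) * x s)"
    proof eventually_elim
      case (elim \<theta>)
      have "g \<theta> = (\<Sum>r<m. \<Sum>s<m. cnj (x r) * A \<theta> $$ (r, s) * x s)" unfolding g_def by (simp add: mult_ac)
      then show ?case using elim by (simp add: G_def)
    qed
  qed (use d in auto)
qed

text \<open>The margin \<delta> turns strict positivity into a closed condition on \<open>x\<close>.
  It therefore extends from countably many test vectors, with one common null set, to all vectors
  and still implies strict positivity.\<close>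

lemma AE_posdef: "AE \<theta> in circ. posdef_mat m (real_mat (A \<theta>))"
proof -
  obtain \<delta> where d: "\<delta> > 0" "\<And>x. AE \<theta> in circ. \<delta> * sq_sum m x \<le> Re (\<Sum>r<m. \<Sum>s<m. cnj (x r) * A \<theta> $$ (r, s) * x s)"
    using AE_coercive by blast
  define F where "F \<theta> x = Re (\<Sum>r<m. \<Sum>s<m. cnj (x r) * A \<theta> $$ (r, s) * x s) - \<delta> * sq_sum m x" for \<theta> x
  obtain D :: "(nat \<Rightarrow> complex) set" where D: "countable D"
    "\<And>F x. \<forall>X. (\<forall>i<m. (\<lambda>n. X n i) \<longlonglongrightarrow> x i) \<longrightarrow> (\<lambda>n. F (X n)) \<longlonglongrightarrow> F x \<Longrightarrow>
        \<forall>x\<in>D. 0 \<le> (F x :: real) \<Longrightarrow> 0 \<le> F x"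
    using countable_test_functions[of m] by metis
  have "AE \<theta> in circ. \<forall>x\<in>D. 0 \<le> F \<theta> x"
    unfolding F_def using d(2) D(1) by (subst AE_ball_countable) auto
  then show ?thesis
    using AE_real_symmetric AE_space
  proof eventually_elim
    case (elim \<theta>)
    have car: "A \<theta> \<in> carrier_mat m m" using elim by (intro A_carrier) simp
    have all: "0 \<le> F \<theta> x" for x
    proof (rule D(2)[OF _ elim(1)], intro allI impI)
      fix X assume "\<forall>i<m. (\<lambda>n. X n i) \<longlonglongrightarrow> x i"
      then show "(\<lambda>n. F \<theta> (X n)) \<longlonglongrightarrow> F \<theta> x"
        unfolding F_def sq_sum_def by (intro tendsto_intros) auto
    qed
    show ?case
      unfolding posdef_mat_def
    proof (intro conjI allI impI)
      show "real_mat (A \<theta>) \<in> carrier_mat m m" using car by simp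
      show "real_mat (A \<theta>) $$ (i, j) = real_mat (A \<theta>) $$ (j, i)" if "i < m" "j < m" for i j
        using car elim(2) that by simp
      show "0 < bform (\<lambda>a b. real_mat (A \<theta>) $$ (a, b)) m x x" if "i < m" "x i \<noteq> 0" for x i
      proof -
        have "sq_sum m (\<lambda>i. of_real (x i)) > 0"
          unfolding sq_sum_def using that by (intro sum_pos2[of _ i]) auto
        then have "0 < \<delta> * sq_sum m (\<lambda>i. of_real (x i))" using d(1) by simp
        then show ?thesis using all[of "\<lambda>i. of_real (x i)"] unfolding bform_real_mat[OF car] F_def by simp
      qed
    qed
  qed
qed

end

section \<open>Distribution of the symplectic eigenvalues\<close>

text \<open>Completeness of Lebesgue measure, carried over to the interval through extension by
  0.\<close>

lemma borel_measurable_circ_AE: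
  fixes f g :: "real \<Rightarrow> complex"
  assumes "f \<in> borel_measurable circ" "AE \<theta> in circ. f \<theta> = g \<theta>"
  shows "g \<in> borel_measurable circ"
proof -
  let ?e = "\<lambda>f x. if x \<in> {-pi..pi} then f x else (0 :: complex)"
  have "?e f \<in> borel_measurable lebesgue" using assms(1) by (subst borel_measurable_if) auto
  moreover have "AE x in lebesgue. ?e f x = ?e g x"
    using assms(2) by (subst (asm) AE_restrict_space_iff) auto
  ultimately have "?e g \<in> borel_measurable lebesgue" by (rule borel_measurable_AE)
  then show ?thesis by (subst (asm) borel_measurable_if) auto
qed

lemma cmod_mean_le:
  assumes f: "bmeas f" and C: "AE \<theta> in circ. cmod (f \<theta>) \<le> C"
  shows "cmod (mean f) \<le> C"
proof -
  have "norm (LINT \<theta>|circ. f \<theta>) \<le> (LINT \<theta>|circ. C)"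
  proof (rule order_trans[OF integral_norm_bound integral_mono_AE])
    show "integrable circ (\<lambda>\<theta>. norm (f \<theta>))" using bmeas_integrable[OF f] by simp
    show "integrable circ (\<lambda>\<theta>. C)" using finite_measure.integrable_const[OF finite_measure_circ] by blast
  qed (rule C)
  also have "\<dots> = 2 * pi * C" by (simp add: measure_restrict_space)
  finally show ?thesis by (simp add: mean_def norm_mult norm_divide field_simps)
qed

text \<open>Serves to prove that the sum of \<open>f\<close> over the symplectic eigenvalues of
  \<open>A \<theta>\<close> is measurable: it is approximated by traces, whose measurability is
  known.\<close>

lemma bmeas_uniform_limit:
  assumes g: "\<And>\<nu>. bmeas (g \<nu>)" and lim: "\<And>\<nu>. AE \<theta> in circ. cmod (f \<theta> - g \<nu> \<theta>) \<le> e \<nu>" and e: "e \<longlonglongrightarrow> (0::real)"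
  shows "bmeas f"
proof -
  have all: "AE \<theta> in circ. \<forall>\<nu>. cmod (f \<theta> - g \<nu> \<theta>) \<le> e \<nu>" using lim by (simp add: AE_all_countable)
  have "AE \<theta> in circ. lim (\<lambda>\<nu>. g \<nu> \<theta>) = f \<theta>"
    using all
  proof eventually_elim
    case (elim \<theta>)
    have "(\<lambda>\<nu>. f \<theta> - g \<nu> \<theta>) \<longlonglongrightarrow> 0"
      using elim by (intro Lim_null_comparison[OF _ e]) auto
    from tendsto_diff[OF tendsto_const[of "f \<theta>"] this] have "(\<lambda>\<nu>. g \<nu> \<theta>) \<longlonglongrightarrow> f \<theta>" by simp
    then show ?case by (rule limI)
  qed
  moreover have "(\<lambda>\<theta>. lim (\<lambda>\<nu>. g \<nu> \<theta>)) \<in> borel_measurable circ"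
    by (intro borel_measurable_lim_metric bmeasD g)
  ultimately have m: "f \<in> borel_measurable circ" using borel_measurable_circ_AE by blast
  obtain C where "AE \<theta> in circ. cmod (g 0 \<theta>) \<le> C" using g[of 0] by (auto simp: bmeas_def)
  then have "AE \<theta> in circ. cmod (f \<theta>) \<le> e 0 + C"
    using all
  proof eventually_elim
    case (elim \<theta>)
    have "cmod (f \<theta>) \<le> cmod (f \<theta> - g 0 \<theta>) + cmod (g 0 \<theta>)"
      using norm_triangle_ineq[of "f \<theta> - g 0 \<theta>" "g 0 \<theta>"] by simp
    then show ?case using elim(1) spec[OF elim(2), of 0] by linarith
  qed
  then show ?thesis using m by (rule bmeasI[rotated])
qed

text \<open>The substitution \<open>y = - d\<^sup>2\<close> maps the interval bijectively onto
  \<open>{- L\<^sup>2..0}\<close>, where Weierstrass applies to the real and imaginary parts. The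
  negative sign matches the traces of even powers of \<open>J B\<close>.\<close>

lemma uniform_approx_negsq_polynomial:
  fixes f :: "real \<Rightarrow> complex"
  assumes f: "continuous_on {0..L} f" and L: "L \<ge> 0" and e: "e > 0"
  shows "\<exists>c N. \<forall>d\<in>{0..L}. cmod (f d - (\<Sum>i\<le>N. c i * of_real ((- d\<^sup>2) ^ i))) \<le> e"
proof -
  let ?S = "{- L\<^sup>2..0}"
  define h where "h y = f (sqrt (- y))" for y
  have h: "continuous_on ?S h"
    unfolding h_def using L
    by (intro continuous_on_compose2[OF f] continuous_intros) (auto intro!: real_le_lsqrt)
  have approx: "\<exists>a N. \<forall>y\<in>?S. \<bar>g y - (\<Sum>i\<le>N. a i * y ^ i)\<bar> < e / 2"
    if g: "continuous_on ?S g" for g :: "real \<Rightarrow> real"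
  proof -
    obtain p where p: "real_polynomial_function p" "\<And>y. y \<in> ?S \<Longrightarrow> \<bar>g y - p y\<bar> < e / 2"
      using Stone_Weierstrass_real_polynomial_function[OF _ g, of "e / 2"] e by auto
    then show ?thesis unfolding real_polynomial_function_iff_sum by blast
  qed
  obtain a Na where a: "\<forall>y\<in>?S. \<bar>Re (h y) - (\<Sum>i\<le>Na. a i * y ^ i)\<bar> < e / 2"
    using approx[of "\<lambda>y. Re (h y)"] h by (auto intro: continuous_intros)
  obtain b Nb where b: "\<forall>y\<in>?S. \<bar>Im (h y) - (\<Sum>i\<le>Nb. b i * y ^ i)\<bar> < e / 2"
    using approx[of "\<lambda>y. Im (h y)"] h by (auto intro: continuous_intros)
  define N where "N = max Na Nb"
  define c where "c i = Complex (if i \<le> Na then a i else 0) (if i \<le> Nb then b i else 0)" for i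
  show ?thesis
  proof (intro exI[of _ c] exI[of _ N] ballI)
    fix d assume d: "d \<in> {0..L}"
    define y where "y = - d\<^sup>2"
    have y: "y \<in> ?S" using d by (auto simp: y_def power_mono)
    have hy: "h y = f d" using d by (simp add: h_def y_def)
    let ?z = "f d - (\<Sum>i\<le>N. c i * of_real (y ^ i))"
    have pad: "(\<Sum>i\<le>N. (if i \<le> M then u i else 0) * y ^ i) = (\<Sum>i\<le>M. u i * y ^ i)"
      if "M \<le> N" for M and u :: "nat \<Rightarrow> real"
      using that by (intro sum.mono_neutral_cong_right) auto
    have "Re ?z = Re (h y) - (\<Sum>i\<le>Na. a i * y ^ i)"
      using pad[of Na a] by (simp add: hy c_def N_def del: of_real_power)
    moreover have "Im ?z = Im (h y) - (\<Sum>i\<le>Nb. b i * y ^ i)"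
      using pad[of Nb b] by (simp add: hy c_def N_def del: of_real_power)
    ultimately have "\<bar>Re ?z\<bar> + \<bar>Im ?z\<bar> \<le> e" using a b y by force
    then show "cmod (f d - (\<Sum>i\<le>N. c i * of_real ((- d\<^sup>2) ^ i))) \<le> e"
      using cmod_le[of ?z] by (simp only: y_def)
  qed
qed

lemma real_mat_apply_bound:
  assumes B: "B \<in> carrier_mat N N" and bound: "\<And>x. apply_sq N B x \<le> L\<^sup>2 * sq_sum N x"
  shows "(\<Sum>i<N. (\<Sum>j<N. real_mat B $$ (i, j) * x j)\<^sup>2) \<le> L\<^sup>2 * (\<Sum>j<N. (x j)\<^sup>2)"
proof -
  have "(\<Sum>j<N. real_mat B $$ (i, j) * x j)\<^sup>2 \<le> (cmod (\<Sum>j<N. B $$ (i, j) * of_real (x j)))\<^sup>2"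
    if "i < N" for i
  proof -
    have "(\<Sum>j<N. real_mat B $$ (i, j) * x j) = Re (\<Sum>j<N. B $$ (i, j) * of_real (x j))"
      using B that by simp
    then show ?thesis using abs_Re_le_cmod by (metis abs_ge_zero power2_abs power_mono)
  qed
  then have "(\<Sum>i<N. (\<Sum>j<N. real_mat B $$ (i, j) * x j)\<^sup>2) \<le> apply_sq N B (\<lambda>j. of_real (x j))"
    unfolding apply_sq_def by (intro sum_mono) auto
  also have "\<dots> \<le> L\<^sup>2 * sq_sum N (\<lambda>j. of_real (x j))" by (rule bound)
  finally show ?thesis by (simp add: sq_sum_def)
qed

section \<open>The matrix J acting on symbols and truncations\<close>

definition cJ_mat :: "nat \<Rightarrow> complex mat" where
  "cJ_mat k = map_mat of_real (J_mat k)"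

lemma cJ_mat_carrier [simp]: "cJ_mat k \<in> carrier_mat (2 * k) (2 * k)"
  by (simp add: cJ_mat_def)

lemma cJ_mat_dim [simp]: "dim_row (cJ_mat k) = 2 * k" "dim_col (cJ_mat k) = 2 * k"
  by (simp_all add: cJ_mat_def)

lemma cJ_mat_index [simp]: "i < 2 * k \<Longrightarrow> j < 2 * k \<Longrightarrow> cJ_mat k $$ (i, j) = of_real (jform i j)"
  by (simp add: cJ_mat_def)

lemma diag_sum_symp_eig:
  assumes B: "B \<in> carrier_mat (2 * N) (2 * N)" and real: "\<And>i j. i < 2 * N \<Longrightarrow> j < 2 * N \<Longrightarrow> B $$ (i, j) \<in> \<real>"
    and P: "posdef_mat (2 * N) (real_mat B)"
  shows "diag_sum ((cJ_mat N * B) ^\<^sub>m (2 * p)) = 2 * (\<Sum>j = 1..N. of_real ((- (symp_eig (real_mat B) j)\<^sup>2) ^ p))"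
proof -
  let ?R = "real_mat B"
  have R: "?R \<in> carrier_mat (2 * N) (2 * N)" using B by simp
  have JR: "J_mat N * ?R \<in> carrier_mat (2 * N) (2 * N)" using R by (intro mult_carrier_mat[of _ _ "2 * N"]) auto
  have "B = map_mat of_real ?R" using B real by (intro eq_matI) auto
  then have "cJ_mat N * B = map_mat of_real (J_mat N * ?R)"
    unfolding cJ_mat_def using R by (subst of_real_hom.mat_hom_mult[OF J_mat_carrier R]) simp
  then have "(cJ_mat N * B) ^\<^sub>m (2 * p) = map_mat of_real ((J_mat N * ?R) ^\<^sub>m (2 * p))"
    by (simp add: of_real_hom.mat_hom_pow[OF JR])
  moreover have "diag_sum (map_mat of_real X) = (of_real (diag_sum X) :: complex)" if "X \<in> carrier_mat n n" for X n
    using that by (auto simp: diag_sum_def)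
  ultimately have "diag_sum ((cJ_mat N * B) ^\<^sub>m (2 * p)) = of_real (diag_sum ((J_mat N * ?R) ^\<^sub>m (2 * p)))"
    using pow_carrier_mat[OF JR, of "2 * p"] by metis
  then show ?thesis unfolding symp_eig_trace[OF P] by (simp del: of_real_power)
qed

text \<open>The block size \<open>2 * k\<close> is even, so a coupled pair \<open>2 * q\<close>,
  \<open>2 * q + 1\<close> never straddles two blocks.\<close>

lemma jform_blocks:
  assumes "r < 2 * k" "t < 2 * k"
  shows "jform (i * (2 * k) + r) (l * (2 * k) + t) = (if l = i then jform r t else 0)"
proof (cases "l = i")
  case True
  have "i * (2 * k) + r = 2 * (i * k) + r" "i * (2 * k) + t = 2 * (i * k) + t" by simp_all
  then show ?thesis using True by (simp only:) (auto simp: jform_def)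
next
  case False
  have "p div (2 * k) = q div (2 * k)" if "jform p q \<noteq> 0" for p q
  proof -
    have "p div 2 = q div 2" using that by (auto simp: jform_def split: if_splits)
    then show ?thesis by (simp add: div_mult2_eq)
  qed
  then show ?thesis
    using False block_index(2)[of i "Suc i" r "2 * k"] block_index(2)[of l "Suc l" t "2 * k"] assms by fastforce
qed

lemma bsymbol_cJ:
  assumes "bsymbol (2 * k) A" shows "bsymbol (2 * k) (\<lambda>\<theta>. cJ_mat k * A \<theta>)"
proof -
  have car: "A \<theta> \<in> carrier_mat (2 * k) (2 * k)" if "\<theta> \<in> {-pi..pi}" for \<theta> using assms that by (auto simp: bsymbol_def)
  have "bmeas (\<lambda>\<theta>. (cJ_mat k * A \<theta>) $$ (r, s))" if rs: "r < 2 * k" "s < 2 * k" for r s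
  proof -
    have "bmeas (\<lambda>\<theta>. (cJ_mat k * A \<theta>) $$ (r, s)) = bmeas (\<lambda>\<theta>. \<Sum>t<2 * k. cJ_mat k $$ (r, t) * A \<theta> $$ (t, s))"
      using rs by (intro bmeas_cong mult_mat_index car) auto
    moreover have "bmeas (\<lambda>\<theta>. \<Sum>t<2 * k. cJ_mat k $$ (r, t) * A \<theta> $$ (t, s))"
      using assms rs by (intro bmeas_sum bmeas_cmult) (simp add: bsymbol_def)
    ultimately show ?thesis by simp
  qed
  moreover have "cJ_mat k * A \<theta> \<in> carrier_mat (2 * k) (2 * k)" if "\<theta> \<in> {-pi..pi}" for \<theta>
    using car[OF that] by (intro mult_carrier_mat[of _ _ "2 * k"]) auto
  ultimately show ?thesis by (simp add: bsymbol_def)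
qed

lemma toeplitz_mat_cJ:
  assumes A: "bsymbol (2 * k) A"
  shows "toeplitz_mat (2 * k) (\<lambda>\<theta>. cJ_mat k * A \<theta>) n = cJ_mat (n * k) * toeplitz_mat (2 * k) A n"
proof (rule eq_matI)
  let ?m = "2 * k"
  have car: "A \<theta> \<in> carrier_mat ?m ?m" if "\<theta> \<in> {-pi..pi}" for \<theta> using A that by (auto simp: bsymbol_def)
  have nm: "2 * (n * k) = n * ?m" by simp
  fix p q
  assume "p < dim_row (cJ_mat (n * k) * toeplitz_mat ?m A n)" "q < dim_col (cJ_mat (n * k) * toeplitz_mat ?m A n)"
  then have pq: "p < n * ?m" "q < n * ?m" by simp_all
  then have "?m > 0" by (cases k) auto
  define i r j s where "i = p div ?m" and "r = p mod ?m" and "j = q div ?m" and "s = q mod ?m"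
  have ij: "i < n" "j < n" "r < ?m" "s < ?m"
    using pq \<open>?m > 0\<close> by (auto simp: i_def j_def r_def s_def less_mult_imp_div_less)
  have p: "p = i * ?m + r" and q: "q = j * ?m + s" by (simp_all only: i_def r_def j_def s_def div_mult_mod_eq)
  have "toeplitz_mat ?m (\<lambda>\<theta>. cJ_mat k * A \<theta>) n $$ (p, q) = fc (\<lambda>\<theta>. (cJ_mat k * A \<theta>) $$ (r, s)) (int i - int j)"
    unfolding p q using ij by (intro toeplitz_mat_index)
  also have "\<dots> = fc (\<lambda>\<theta>. \<Sum>t<?m. cJ_mat k $$ (r, t) * A \<theta> $$ (t, s)) (int i - int j)"
    using ij by (intro fc_cong mult_mat_index car) auto
  also have "\<dots> = (\<Sum>t<?m. of_real (jform r t) * fc (\<lambda>\<theta>. A \<theta> $$ (t, s)) (int i - int j))"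
    using A ij by (subst fc_sum) (auto simp: bsymbol_def fc_cmult intro!: bmeas_cmult)
  also have "\<dots> = (\<Sum>l<n. \<Sum>t<?m. of_real (jform (i * ?m + r) (l * ?m + t)) * fc (\<lambda>\<theta>. A \<theta> $$ (t, s)) (int l - int j))"
  proof -
    have "(\<Sum>l<n. \<Sum>t<?m. of_real (jform (i * ?m + r) (l * ?m + t)) * fc (\<lambda>\<theta>. A \<theta> $$ (t, s)) (int l - int j)) =
        (\<Sum>l<n. if l = i then \<Sum>t<?m. of_real (jform r t) * fc (\<lambda>\<theta>. A \<theta> $$ (t, s)) (int l - int j) else 0)"
      using ij by (intro sum.cong refl) (auto simp: jform_blocks)
    then show ?thesis using ij by simp
  qed
  also have "\<dots> = (\<Sum>a<n * ?m. cJ_mat (n * k) $$ (p, a) * toeplitz_mat ?m A n $$ (a, q))"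
    unfolding sum_blocks[where n = n and m = ?m] p q using ij block_index(1)[of _ n _ ?m]
    by (intro sum.cong refl) (simp add: toeplitz_mat_index nm del: mult_Suc_right)
  also have "\<dots> = (cJ_mat (n * k) * toeplitz_mat ?m A n) $$ (p, q)"
    using pq toeplitz_mat_carrier[of ?m A n] cJ_mat_carrier[of "n * k"]
    by (intro mult_mat_index[symmetric]) (simp_all only: nm)
  finally show "toeplitz_mat ?m (\<lambda>\<theta>. cJ_mat k * A \<theta>) n $$ (p, q) = (cJ_mat (n * k) * toeplitz_mat ?m A n) $$ (p, q)" .
qed simp_all

text \<open>Replacing \<open>f\<close> by a polynomial within \<epsilon> changes both sides by at
  most \<open>k * \<epsilon>\<close>, uniformly in \<open>n\<close>: there are \<open>n * k\<close>
  eigenvalues and the sum is divided by \<open>n\<close>. This uniformity permits exchanging the two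
  limits.\<close>

theorem (in positive_toeplitz) symp_eig_distribution:
  fixes f :: "real \<Rightarrow> complex"
  assumes m: "m = 2 * k" and f: "continuous_on {0..symbol_norm A} f"
  shows "bmeas (\<lambda>\<theta>. \<Sum>j = 1..k. f (symp_eig (real_mat (A \<theta>)) j))"
    and "(\<lambda>n. 1 / of_nat n * (\<Sum>j = 1..n * k. f (symp_eig (real_mat (toeplitz_mat m A n)) j)))
      \<longlonglongrightarrow> mean (\<lambda>\<theta>. \<Sum>j = 1..k. f (symp_eig (real_mat (A \<theta>)) j))"
proof -
  let ?L = "symbol_norm A"
  let ?T = "toeplitz_mat m A"
  have L: "?L \<ge> 0" by (rule op_norm_le_symbol_norm(2)[OF bs])
  let ?e = "\<lambda>\<theta> j. symp_eig (real_mat (A \<theta>)) j"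
  let ?d = "\<lambda>n j. symp_eig (real_mat (?T n)) j"
  let ?C = "\<lambda>\<theta>. cJ_mat k * A \<theta>"
  define \<Phi> where "\<Phi> \<theta> = (\<Sum>j = 1..k. f (?e \<theta> j))" for \<theta>
  define \<mu> where "\<mu> n = 1 / of_nat n * (\<Sum>j = 1..n * k. f (?d n j))" for n
  have C: "bsymbol m ?C" using bs unfolding m by (rule bsymbol_cJ)
  have nm: "n * m = 2 * (n * k)" for n by (simp add: m)
  have pdT: "posdef_mat (2 * (n * k)) (real_mat (?T n))" for n using posdef_toeplitz[of n] unfolding nm .
  have carT: "?T n \<in> carrier_mat (2 * (n * k)) (2 * (n * k))" for n using toeplitz_mat_carrier[of m A n] unfolding nm .
  have d: "?d n j \<in> {0..?L}" if "j \<in> {1..n * k}" for n j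
  proof -
    have "?d n j \<le> ?L"
    proof (rule symp_eig_bound[OF pdT L _ that])
      show "(\<Sum>i<2 * (n * k). (\<Sum>j<2 * (n * k). real_mat (?T n) $$ (i, j) * x j)\<^sup>2) \<le> ?L\<^sup>2 * (\<Sum>j<2 * (n * k). (x j)\<^sup>2)" for x
        using toeplitz_apply_bound[OF bs, of n] unfolding nm by (intro real_mat_apply_bound carT)
    qed
    then show ?thesis using symp_eig_pos[OF pdT that] by simp
  qed
  have e: "AE \<theta> in circ. posdef_mat (2 * k) (real_mat (A \<theta>)) \<and> (\<forall>j\<in>{1..k}. ?e \<theta> j \<in> {0..?L})"
    using AE_posdef symbol_apply_bound[OF bs] AE_space
  proof eventually_elim
    case (elim \<theta>)
    then have pd: "posdef_mat (2 * k) (real_mat (A \<theta>))" and car: "A \<theta> \<in> carrier_mat (2 * k) (2 * k)"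
      using A_carrier by (auto simp: m)
    have "?e \<theta> j \<in> {0..?L}" if "j \<in> {1..k}" for j
    proof -
      have "?e \<theta> j \<le> ?L"
        using elim(2) unfolding m by (intro symp_eig_bound[OF pd L _ that] real_mat_apply_bound car) auto
      then show ?thesis using symp_eig_pos[OF pd that] by simp
    qed
    then show ?case using pd by blast
  qed
  have trC: "AE \<theta> in circ. \<forall>p. diag_sum (?C \<theta> ^\<^sub>m (2 * p)) = 2 * (\<Sum>j = 1..k. of_real ((- (?e \<theta> j)\<^sup>2) ^ p))"
    using AE_posdef AE_real_symmetric AE_space
  proof eventually_elim
    case (elim \<theta>)
    then show ?case using A_carrier[of \<theta>] unfolding m by (intro allI diag_sum_symp_eig) auto
  qed
  have trT: "diag_sum (toeplitz_mat m ?C n ^\<^sub>m (2 * p)) = 2 * (\<Sum>j = 1..n * k. of_real ((- (?d n j)\<^sup>2) ^ p))" for n p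
  proof -
    have "toeplitz_mat m ?C n = cJ_mat (n * k) * ?T n" using bs unfolding m by (rule toeplitz_mat_cJ)
    moreover have "?T n $$ (i, j) \<in> \<real>" if ij: "i < 2 * (n * k)" "j < 2 * (n * k)" for i j
    proof -
      have "m > 0" using ij by (cases k) (auto simp: m)
      then show ?thesis using ij unfolding nm[symmetric]
        by (simp add: toeplitz_mat_def fourier_coeff_index fc_a_real)
    qed
    ultimately show ?thesis using diag_sum_symp_eig[OF carT _ pdT] by simp
  qed
  have bd: "bmeas (\<lambda>\<theta>. diag_sum (?C \<theta> ^\<^sub>m p))" for p
  proof -
    have "diag_sum (?C \<theta> ^\<^sub>m p) = (\<Sum>r<m. (?C \<theta> ^\<^sub>m p) $$ (r, r))" if "\<theta> \<in> {-pi..pi}" for \<theta>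
      using that by (simp add: diag_sum_def m)
    then have "bmeas (\<lambda>\<theta>. diag_sum (?C \<theta> ^\<^sub>m p)) = bmeas (\<lambda>\<theta>. \<Sum>r<m. (?C \<theta> ^\<^sub>m p) $$ (r, r))"
      by (intro bmeas_cong)
    then show ?thesis using C by (auto intro!: bmeas_sum bmeas_pow)
  qed
  \<comment> \<open>The trace form of the polynomial \<open>Q\<close>, measurable by construction.
    The factor one half compensates that every symplectic eigenvalue is counted twice in the
    trace.\<close>
  define g where "g c N \<theta> = (\<Sum>i\<le>N. (c i / 2) * diag_sum (?C \<theta> ^\<^sub>m (2 * i)))" for c :: "nat \<Rightarrow> complex" and N \<theta>
  have bg: "bmeas (g c N)" for c N unfolding g_def by (intro bmeas_sum bmeas_cmult bd)
  define Q where "Q c N y = (\<Sum>i\<le>N. c i * of_real ((- y\<^sup>2) ^ i))" for c :: "nat \<Rightarrow> complex" and N and y :: real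
  have sumQ: "(\<Sum>j\<in>J. Q c N (u j)) = (\<Sum>i\<le>N. (c i / 2) * (2 * (\<Sum>j\<in>J. of_real ((- (u j)\<^sup>2) ^ i))))"
    for J :: "nat set" and c N u
    unfolding Q_def by (subst sum.swap) (simp add: sum_distrib_left del: of_real_power)
  have gQ: "AE \<theta> in circ. g c N \<theta> = (\<Sum>j = 1..k. Q c N (?e \<theta> j))" for c N
    using trC by eventually_elim (simp only: g_def sumQ)
  have limQ: "(\<lambda>n. 1 / of_nat n * (\<Sum>j = 1..n * k. Q c N (?d n j))) \<longlonglongrightarrow> mean (g c N)" for c N
  proof -
    have "(\<lambda>n. \<Sum>i\<le>N. (c i / 2) * (diag_sum (toeplitz_mat m ?C n ^\<^sub>m (2 * i)) / of_nat n)) \<longlonglongrightarrow>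
        (\<Sum>i\<le>N. (c i / 2) * mean (\<lambda>\<theta>. diag_sum (?C \<theta> ^\<^sub>m (2 * i))))"
      by (intro tendsto_sum tendsto_mult tendsto_const toeplitz_power_trace[OF C])
    also have "(\<Sum>i\<le>N. (c i / 2) * mean (\<lambda>\<theta>. diag_sum (?C \<theta> ^\<^sub>m (2 * i)))) = mean (g c N)"
      unfolding g_def by (subst mean_sum) (auto simp: mean_cmult[symmetric] intro!: bmeas_cmult[OF bd, of "_ / 2", simplified])
    also have "(\<lambda>n. \<Sum>i\<le>N. (c i / 2) * (diag_sum (toeplitz_mat m ?C n ^\<^sub>m (2 * i)) / of_nat n)) =
        (\<lambda>n. 1 / of_nat n * (\<Sum>j = 1..n * k. Q c N (?d n j)))"
      unfolding sumQ trT sum_distrib_left[where A = "{..N}"] by (intro ext sum.cong refl) simp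
    finally show ?thesis .
  qed
  have near: "\<exists>c N. (AE \<theta> in circ. cmod (\<Phi> \<theta> - g c N \<theta>) \<le> real k * \<epsilon>) \<and>
      (\<forall>n. cmod (\<mu> n - 1 / of_nat n * (\<Sum>j = 1..n * k. Q c N (?d n j))) \<le> real k * \<epsilon>)" if \<epsilon>: "\<epsilon> > 0" for \<epsilon>
  proof -
    obtain c N where cN: "\<And>y. y \<in> {0..?L} \<Longrightarrow> cmod (f y - Q c N y) \<le> \<epsilon>"
      using uniform_approx_negsq_polynomial[OF f L \<epsilon>] unfolding Q_def by blast
    have sum_le: "cmod ((\<Sum>j = 1..M. f (u j)) - (\<Sum>j = 1..M. Q c N (u j))) \<le> real M * \<epsilon>"
      if "\<And>j. j \<in> {1..M} \<Longrightarrow> u j \<in> {0..?L}" for u M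
    proof -
      have "cmod (\<Sum>j = 1..M. f (u j) - Q c N (u j)) \<le> (\<Sum>j = 1..M. \<epsilon>)"
        using that by (intro sum_norm_le cN)
      then show ?thesis by (simp add: sum_subtractf)
    qed
    show ?thesis
    proof (intro exI conjI allI)
      show "AE \<theta> in circ. cmod (\<Phi> \<theta> - g c N \<theta>) \<le> real k * \<epsilon>"
        using gQ[of c N] e
      proof eventually_elim
        case (elim \<theta>)
        then show ?case unfolding \<Phi>_def elim(1) by (intro sum_le) blast
      qed
      fix n
      show "cmod (\<mu> n - 1 / of_nat n * (\<Sum>j = 1..n * k. Q c N (?d n j))) \<le> real k * \<epsilon>"
      proof (cases "n = 0")
        case False
        have "\<mu> n - 1 / of_nat n * (\<Sum>j = 1..n * k. Q c N (?d n j)) =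
            1 / of_nat n * ((\<Sum>j = 1..n * k. f (?d n j)) - (\<Sum>j = 1..n * k. Q c N (?d n j)))"
          by (simp add: \<mu>_def right_diff_distrib)
        then have "cmod (\<mu> n - 1 / of_nat n * (\<Sum>j = 1..n * k. Q c N (?d n j))) =
            cmod ((\<Sum>j = 1..n * k. f (?d n j)) - (\<Sum>j = 1..n * k. Q c N (?d n j))) / real n"
          by (simp add: norm_mult norm_divide)
        also have "\<dots> \<le> real (n * k) * \<epsilon> / real n" by (intro divide_right_mono sum_le d) auto
        finally show ?thesis using False by simp
      qed (use \<epsilon> in \<open>simp add: \<mu>_def\<close>)
    qed
  qed
  have b\<Phi>: "bmeas \<Phi>"
  proof -
    have "\<forall>\<nu>. \<exists>c N. AE \<theta> in circ. cmod (\<Phi> \<theta> - g c N \<theta>) \<le> real k * (1 / real (Suc \<nu>))"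
      using near[of "1 / real (Suc _)"] by (meson of_nat_0_less_iff zero_less_Suc zero_less_divide_1_iff)
    then obtain c N where cN: "\<And>\<nu>. AE \<theta> in circ. cmod (\<Phi> \<theta> - g (c \<nu>) (N \<nu>) \<theta>) \<le> real k * (1 / real (Suc \<nu>))"
      by metis
    show ?thesis
    proof (rule bmeas_uniform_limit[OF _ cN])
      show "(\<lambda>\<nu>. real k * (1 / real (Suc \<nu>))) \<longlonglongrightarrow> 0"
        using tendsto_mult_right_zero[OF LIMSEQ_inverse_real_of_nat, of "real k"] by (simp add: inverse_eq_divide)
    qed (rule bg)
  qed
  then show "bmeas (\<lambda>\<theta>. \<Sum>j = 1..k. f (?e \<theta> j))" unfolding \<Phi>_def .
  have "\<mu> \<longlonglongrightarrow> mean \<Phi>"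
  proof (rule LIMSEQ_I)
    fix r :: real assume r: "r > 0"
    \<comment> \<open>Three errors of at most \<open>r / 3\<close> are added: approximation on
      either side and convergence for \<open>Q\<close>. With \<open>k + 1\<close> in the
      denominator, \<open>k * \<epsilon> < r / 3\<close> is strict.\<close>
    define \<epsilon> where "\<epsilon> = r / (3 * (real k + 1))"
    have \<epsilon>: "\<epsilon> > 0" using r by (simp add: \<epsilon>_def)
    have "real k * \<epsilon> < (real k + 1) * \<epsilon>" using \<epsilon> by simp
    also have "(real k + 1) * \<epsilon> = r / 3" by (simp add: \<epsilon>_def field_simps)
    finally have k\<epsilon>: "real k * \<epsilon> < r / 3" .
    obtain c N where cN: "AE \<theta> in circ. cmod (\<Phi> \<theta> - g c N \<theta>) \<le> real k * \<epsilon>"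
      "\<And>n. cmod (\<mu> n - 1 / of_nat n * (\<Sum>j = 1..n * k. Q c N (?d n j))) \<le> real k * \<epsilon>"
      using near[OF \<epsilon>] by blast
    have "cmod (mean (\<lambda>\<theta>. \<Phi> \<theta> - g c N \<theta>)) \<le> real k * \<epsilon>"
      by (intro cmod_mean_le bmeas_diff b\<Phi> bg cN(1))
    then have 1: "cmod (mean \<Phi> - mean (g c N)) \<le> real k * \<epsilon>" by (simp add: mean_diff b\<Phi> bg)
    obtain n0 where n0: "\<And>n. n \<ge> n0 \<Longrightarrow>
        cmod (1 / of_nat n * (\<Sum>j = 1..n * k. Q c N (?d n j)) - mean (g c N)) < r / 3"
      using LIMSEQ_D[OF limQ[of c N], of "r / 3"] r by (metis divide_pos_pos zero_less_numeral)
    have "cmod (\<mu> n - mean \<Phi>) < r" if "n \<ge> n0" for n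
    proof -
      define q where "q = 1 / of_nat n * (\<Sum>j = 1..n * k. Q c N (?d n j))"
      have "cmod (\<mu> n - mean \<Phi>) \<le> cmod (\<mu> n - q) + cmod (q - mean (g c N)) + cmod (mean (g c N) - mean \<Phi>)"
        using norm_triangle_ineq[of "\<mu> n - q + (q - mean (g c N))" "mean (g c N) - mean \<Phi>"]
          norm_triangle_ineq[of "\<mu> n - q" "q - mean (g c N)"] by simp
      moreover have "cmod (\<mu> n - q) \<le> real k * \<epsilon>" unfolding q_def by (rule cN(2))
      moreover have "cmod (q - mean (g c N)) < r / 3" unfolding q_def by (rule n0[OF that])
      ultimately show ?thesis using 1 k\<epsilon> by (simp add: norm_minus_commute)
    qed
    then show "\<exists>n0. \<forall>n\<ge>n0. norm (\<mu> n - mean \<Phi>) < r" by blast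
  qed
  then show "(\<lambda>n. 1 / of_nat n * (\<Sum>j = 1..n * k. f (?d n j))) \<longlonglongrightarrow> mean (\<lambda>\<theta>. \<Sum>j = 1..k. f (?e \<theta> j))"
    unfolding \<mu>_def[abs_def] \<Phi>_def[abs_def] .
qed

theorem theorem4p1:
  fixes k :: nat and A :: "real \<Rightarrow> complex mat" and f :: "real \<Rightarrow> complex"
  assumes "k \<ge> 1"
    and "Linf_symbol (2 * k) A"
    and "partially_symmetric (2 * k) A"
    and "l2_bounded_operator (2 * k) (toeplitz_op (2 * k) A)"
    and "l2_positive_invertible (2 * k) (toeplitz_op (2 * k) A)"
    and "continuous_on {0..symbol_norm A} f"
  shows "integrable (lebesgue_on {-pi..pi})
           (\<lambda>\<theta>. \<Sum>j = 1..k. f (symp_eig (real_mat (A \<theta>)) j)) \<and>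
         (\<lambda>n. 1 / of_nat n *
             (\<Sum>j = 1..n * k. f (symp_eig (real_mat (toeplitz_mat (2 * k) A n)) j)))
         \<longlonglongrightarrow> 1 / (2 * of_real pi) *
             (LINT \<theta>|lebesgue_on {-pi..pi}. (\<Sum>j = 1..k. f (symp_eig (real_mat (A \<theta>)) j)))"
proof -
  interpret positive_toeplitz "2 * k" A
    using assms by unfold_locales (auto intro: Linf_symbol_bsymbol)
  show ?thesis
    using bmeas_integrable[OF symp_eig_distribution(1)[OF refl assms(6)]]
      symp_eig_distribution(2)[OF refl assms(6)] by (simp add: mean_def)
qed

end
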